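(* Let $N\in\{1,2,\dots\}$, let $\Omega\subset\mathbb{R}^N$ be a bounded domain, $T>0$, $0<M<\infty$, and let $P,h,H,F,G$ be functions as described in the context. Assume: (i) there is $C_1>0$ such that $F(s)\le C_1\,G'(s)\,G(s)$ for all $s\in(0,M]$; (ii) there are $\lambda\in(0,2)$ and $C_2>0$ such that $\left(\sqrt{sF(s)}\right)^{\lambda}\le C_2 H(s)$ for all $s\in[0,M]$. Let $u$, with $0\le u\le M$, be a solution (in the sense given in the context) of $$\frac{\partial}{\partial t}H(u)-F(u)\Delta u\le 0\ \text{ in }\Omega\times(0,T),\qquad u=\phi\ \text{ on }\partial\Omega\times(0,T),$$ where $\phi\ge 0$ and $\phi(x,t)\to 0$ as $t\to 0$, and let $\Omega'\subset\Omega$ be such that $u(x,0)=0$ for $x\in\Omega'$. Then for every ball $B_R(x_0)\Subset\Omega'$ and every $R'\in(0,R)$ there exists $T'\in(0,T]$ such that $u(x,t)=0$ for $(x,t)\in B_{R'}(x_0)\times[0,T']$.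
   Context: Functions. $P\in C([0,\infty))$, $P(0)=0$, and $0<P(s)<C<\infty$ for $s>0$. The function $h\in C((0,\infty))$ is positive and integrable at zero, and $H(u)=\int_0^u h(s)\,ds$. The function $F=hP$ satisfies $F(0)=0$ (that is, $F$ extends continuously to $0$ by the value $0$) and is differentiable on $(0,\infty)$ with a locally bounded derivative $F'>0$. Finally $G(u)=\int_0^u\sqrt{F'(s)}\,ds$, so $G(0)=0$ and $G'=\sqrt{F'}$ (one has $0\le G(u)\le\sqrt{uF(u)}$, so $G$ is finite). Solution. $u$ is a non-negative measurable function (pointwise equalities for $u$ are read almost everywhere) with $$u\in L^\infty_{loc}(\Omega\times[0,T]),\quad \nabla u\in L^2_{loc}(\Omega\times(0,T]),\quad u_t\in L^1_{loc}(\Omega\times(0,T]),$$ $u(\cdot,0)$ is continuous on $\Omega$, and $u(\cdot,t)\to u(\cdot,0)$ locally in measure in $\Omega$ as $t\to0$. The term $F(u)\Delta u$ is understood weakly: for $\theta\in Lip(\Omega)$ with compact support, $$-\int_\Omega\theta F(u)\Delta u\,dx=\int_\Omega\left[F(u)\nabla u\cdot\nabla\theta+F'(u)|\nabla u|^2\theta\right]dx=\int_\Omega\left[F(u)\nabla u\cdot\nabla\theta+|\nabla G(u)|^2\theta\right]dx,$$ where $F'(u)|\nabla u|^2=|\nabla G(u)|^2$ is taken to be $0$ where $u=0$ and is understood to lie in $L^1_{loc}(\Omega\times(0,T])$, so that the integrals make sense. Accordingly the differential inequality means that for every non-negative $\theta\in Lip(\Omega)$ with compact support in $\Omega$ and all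 $0<s<t\le T$ (for the representative of $u$ that is continuous in time with values in $L^1_{loc}(\Omega)$), $$\int_\Omega\theta H(u(x,t))\,dx-\int_\Omega\theta H(u(x,s))\,dx+\int_s^t\int_\Omega\left[F(u)\nabla u\cdot\nabla\theta+|\nabla G(u)|^2\theta\right]dx\,d\tau\le0 .$$ $B_R(x_0)$ is the open ball of radius $R$ centred at $x_0$; $A\Subset B$ means that $\overline A$ is compact and contained in $B$. *)

theory Defs
  imports "HOL-Analysis.Analysis"
begin

text \<open>
  Conventions.  Functions of space and time are total functions on \<open>(real ^ 'n) \<times> real\<close>;
  only their values on the stated sets matter.  Measurable means Lebesgue measurable.
\<close>

definition compactly_contained :: "'a::topological_space set \<Rightarrow> 'a set \<Rightarrow> bool"
  where "compactly_contained A B \<longleftrightarrow> compact (closure A) \<and> closure A \<subseteq> B"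

text \<open>
  \<open>H\<close>, \<open>F\<close>, \<open>G\<close> are constrained for non-negative arguments only;
  the derivative of \<open>G\<close> is always written \<open>sqrt (deriv F s)\<close>, since \<open>deriv F\<close> is not assumed
  continuous and \<open>G\<close> may fail to be differentiable on a null set.
\<close>

definition structure_functions ::
  "(real \<Rightarrow> real) \<Rightarrow> (real \<Rightarrow> real) \<Rightarrow> (real \<Rightarrow> real) \<Rightarrow> (real \<Rightarrow> real) \<Rightarrow> (real \<Rightarrow> real) \<Rightarrow> bool"
  where "structure_functions P h H F G \<longleftrightarrow>
    continuous_on {0..} P \<and> P 0 = 0 \<and> (\<exists>C. \<forall>s>0. 0 < P s \<and> P s < C) \<and>
    continuous_on {0<..} h \<and> (\<forall>s>0. 0 < h s) \<and>
    (\<exists>\<delta>>0. set_integrable lborel {0<..<\<delta>} h) \<and>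
    (\<forall>s\<ge>0. H s = (LBINT r:{0<..s}. h r)) \<and>
    (\<forall>s>0. F s = h s * P s) \<and> F 0 = 0 \<and> continuous_on {0..} F \<and>
    (\<forall>s>0. F differentiable at s \<and> 0 < deriv F s) \<and>
    (\<forall>K. compact K \<and> K \<subseteq> {0<..} \<longrightarrow> bounded (deriv F ` K)) \<and>
    (\<forall>s\<ge>0. G s = (LBINT r:{0<..s}. sqrt (deriv F r)))"

text \<open>
  Local spaces on a Borel set \<open>S\<close>, which need not be open: the bounds are required on compact
  subsets of \<open>S\<close>, so for \<open>S = \<Omega> \<times> {0<..T}\<close> they hold up to time \<open>T\<close> but not up to time \<open>0\<close>.
\<close>

definition Lp_loc :: "nat \<Rightarrow> 'a::euclidean_space set \<Rightarrow> ('a \<Rightarrow> 'b::euclidean_space) \<Rightarrow> bool"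
  where "Lp_loc p S f \<longleftrightarrow>
    f \<in> borel_measurable (lebesgue_on S) \<and>
    (\<forall>K. compact K \<and> K \<subseteq> S \<longrightarrow> set_integrable lebesgue K (\<lambda>z. norm (f z) ^ p))"

definition Linf_loc :: "'a::euclidean_space set \<Rightarrow> ('a \<Rightarrow> real) \<Rightarrow> bool"
  where "Linf_loc S f \<longleftrightarrow>
    f \<in> borel_measurable (lebesgue_on S) \<and>
    (\<forall>K. compact K \<and> K \<subseteq> S \<longrightarrow> (\<exists>B. AE z in lebesgue. z \<in> K \<longrightarrow> \<bar>f z\<bar> \<le> B))"

definition C1_test_function :: "'a::euclidean_space set \<Rightarrow> ('a \<Rightarrow> real) \<Rightarrow> bool"
  where "C1_test_function U \<eta> \<longleftrightarrow>
    (\<forall>z. \<eta> differentiable at z) \<and>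
    (\<forall>v. continuous_on UNIV (\<lambda>z. frechet_derivative \<eta> (at z) v)) \<and>
    compactly_contained {z. \<eta> z \<noteq> 0} U"

text \<open>\<open>w\<close> is the weak derivative of \<open>f\<close> on the open set \<open>U\<close> in the direction \<open>v\<close>.\<close>

definition weak_derivative ::
  "'a::euclidean_space set \<Rightarrow> 'a \<Rightarrow> ('a \<Rightarrow> real) \<Rightarrow> ('a \<Rightarrow> real) \<Rightarrow> bool"
  where "weak_derivative U v f w \<longleftrightarrow>
    Lp_loc 1 U f \<and> Lp_loc 1 U w \<and>
    (\<forall>\<eta>. C1_test_function U \<eta> \<longrightarrow>
      (LINT z:U|lebesgue. f z * frechet_derivative \<eta> (at z) v) =
      - (LINT z:U|lebesgue. w z * \<eta> z))"

definition weak_space_gradient ::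
  "(real ^ 'n) set \<Rightarrow> real \<Rightarrow> ((real ^ 'n) \<times> real \<Rightarrow> real)
    \<Rightarrow> ((real ^ 'n) \<times> real \<Rightarrow> real ^ 'n) \<Rightarrow> bool"
  where "weak_space_gradient \<Omega> T u Du \<longleftrightarrow>
    (\<forall>i. weak_derivative (\<Omega> \<times> {0<..<T}) (axis i 1, 0) u (\<lambda>z. Du z $ i))"

definition weak_time_derivative ::
  "(real ^ 'n) set \<Rightarrow> real \<Rightarrow> ((real ^ 'n) \<times> real \<Rightarrow> real)
    \<Rightarrow> ((real ^ 'n) \<times> real \<Rightarrow> real) \<Rightarrow> bool"
  where "weak_time_derivative \<Omega> T u ut \<longleftrightarrow> weak_derivative (\<Omega> \<times> {0<..<T}) (0, 1) u ut"

text \<open>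
  The gradient of a Lipschitz function; it is meaningful at almost every point, and is
  used under integrals only.
\<close>

definition grad :: "(real ^ 'n \<Rightarrow> real) \<Rightarrow> real ^ 'n \<Rightarrow> real ^ 'n"
  where "grad \<theta> x = (\<chi> i. frechet_derivative \<theta> (at x) (axis i 1))"

definition lipschitz_test_function :: "(real ^ 'n) set \<Rightarrow> (real ^ 'n \<Rightarrow> real) \<Rightarrow> bool"
  where "lipschitz_test_function \<Omega> \<theta> \<longleftrightarrow>
    (\<exists>L. L-lipschitz_on \<Omega> \<theta>) \<and> compactly_contained {x. \<theta> x \<noteq> 0} \<Omega>"

text \<open>
  \<open>v\<close> is a representative of \<open>u\<close> that is continuous on \<open>{0<..T}\<close> with values in the
  locally integrable functions on \<open>\<Omega>\<close>.
\<close>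

definition time_continuous_representative ::
  "(real ^ 'n) set \<Rightarrow> real \<Rightarrow> ((real ^ 'n) \<times> real \<Rightarrow> real)
    \<Rightarrow> ((real ^ 'n) \<times> real \<Rightarrow> real) \<Rightarrow> bool"
  where "time_continuous_representative \<Omega> T u v \<longleftrightarrow>
    (AE z in lebesgue. z \<in> \<Omega> \<times> {0<..T} \<longrightarrow> v z = u z) \<and>
    (\<forall>t\<in>{0<..T}. Lp_loc 1 \<Omega> (\<lambda>x. v (x, t))) \<and>
    (\<forall>K. compact K \<and> K \<subseteq> \<Omega> \<longrightarrow>
      (\<forall>t\<in>{0<..T}.
        ((\<lambda>\<tau>. LINT x:K|lebesgue. \<bar>v (x, \<tau>) - v (x, t)\<bar>) \<longlongrightarrow> 0) (at t within {0<..T})))"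

definition initial_limit_in_measure ::
  "(real ^ 'n) set \<Rightarrow> ((real ^ 'n) \<times> real \<Rightarrow> real) \<Rightarrow> (real ^ 'n \<Rightarrow> real) \<Rightarrow> bool"
  where "initial_limit_in_measure \<Omega> v u0 \<longleftrightarrow>
    (\<forall>K. compact K \<and> K \<subseteq> \<Omega> \<longrightarrow>
      (\<forall>\<epsilon>>0. ((\<lambda>t. measure lebesgue {x \<in> K. \<epsilon> < \<bar>v (x, t) - u0 x\<bar>}) \<longlongrightarrow> 0) (at_right 0)))"

text \<open>The expression \<open>F'(u) |\<nabla>u|\<^sup>2\<close>, that is \<open>|\<nabla>G(u)|\<^sup>2\<close>, set to \<open>0\<close> where \<open>u = 0\<close>.\<close>

definition grad_G_squared ::
  "(real \<Rightarrow> real) \<Rightarrow> ('a \<Rightarrow> real) \<Rightarrow> ('a \<Rightarrow> real ^ 'n) \<Rightarrow> 'a \<Rightarrow> real"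
  where "grad_G_squared F u Du z = (if u z = 0 then 0 else deriv F (u z) * (norm (Du z))\<^sup>2)"

text \<open>
  Non-negative solutions of \<open>\<partial>H(u)/\<partial>t - F(u) \<Delta>u \<le> 0\<close> in \<open>\<Omega> \<times> (0,T)\<close>.  The weak derivatives
  are unique up to null sets, and each time slice of \<open>v\<close> is unique up to a null set of \<open>\<Omega>\<close>.
\<close>

definition weak_solution_ineq ::
  "(real ^ 'n) set \<Rightarrow> real \<Rightarrow> (real \<Rightarrow> real) \<Rightarrow> (real \<Rightarrow> real)
    \<Rightarrow> ((real ^ 'n) \<times> real \<Rightarrow> real) \<Rightarrow> bool"
  where "weak_solution_ineq \<Omega> T H F u \<longleftrightarrow>
    (AE z in lebesgue. z \<in> \<Omega> \<times> {0..T} \<longrightarrow> 0 \<le> u z) \<and>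
    Linf_loc (\<Omega> \<times> {0..T}) u \<and>
    continuous_on \<Omega> (\<lambda>x. u (x, 0)) \<and>
    (\<exists>Du ut v.
      weak_space_gradient \<Omega> T u Du \<and> Lp_loc 2 (\<Omega> \<times> {0<..T}) Du \<and>
      weak_time_derivative \<Omega> T u ut \<and> Lp_loc 1 (\<Omega> \<times> {0<..T}) ut \<and>
      time_continuous_representative \<Omega> T u v \<and>
      initial_limit_in_measure \<Omega> v (\<lambda>x. u (x, 0)) \<and>
      Lp_loc 1 (\<Omega> \<times> {0<..T}) (grad_G_squared F u Du) \<and>
      (\<forall>\<theta> s t. lipschitz_test_function \<Omega> \<theta> \<and> (\<forall>x. 0 \<le> \<theta> x) \<and> 0 < s \<and> s < t \<and> t \<le> T \<longrightarrow>
        (LINT x:\<Omega>|lebesgue. \<theta> x * H (v (x, t))) - (LINT x:\<Omega>|lebesgue. \<theta> x * H (v (x, s)))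
        + (LINT z:\<Omega> \<times> {s..t}|lebesgue.
            F (u z) * (Du z \<bullet> grad \<theta> (fst z)) + grad_G_squared F u Du z * \<theta> (fst z))
        \<le> 0))"

text \<open>
  Boundary data \<open>u = \<phi>\<close> on the lateral boundary.  The regularity of \<open>u\<close> is local in \<open>\<Omega>\<close> and
  provides no trace, so the equation is stated for the values of \<open>u\<close>, which \<open>weak_solution_ineq\<close>
  leaves free there; a solution attaining \<open>\<phi>\<close> in any stronger sense, once given the values \<open>\<phi>\<close> on
  the lateral boundary, satisfies this condition.
\<close>

definition boundary_data ::
  "(real ^ 'n) set \<Rightarrow> real \<Rightarrow> ((real ^ 'n) \<times> real \<Rightarrow> real) \<Rightarrow> (real ^ 'n \<Rightarrow> real \<Rightarrow> real) \<Rightarrow> bool"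
  where "boundary_data \<Omega> T u \<phi> \<longleftrightarrow>
    (\<forall>x\<in>frontier \<Omega>. \<forall>t\<in>{0<..<T}. u (x, t) = \<phi> x t)"

end

theory Submission
  imports Defs
begin

text \<open>
  The theorem expresses finite speed of propagation, and it is proved by a local energy method.

  Energy.  Test the inequality with the square of a cutoff that lives in a slightly larger ball.
  Hypothesis (i), that is \<open>F \<le> C\<^sub>1 G' G\<close>, allows the term \<open>F(u) \<nabla>u \<cdot> \<nabla>\<theta>\<close> to be absorbed into
  \<open>|\<nabla>G(u)|\<^sup>2 \<theta>\<close> at the price of \<open>G(u)\<^sup>2\<close>, and the initial term vanishes because \<open>u\<close> starts from zero
  there.  So \<open>\<integral> H(u(t))\<close> and the space-time integral of \<open>|\<nabla>G(u)|\<^sup>2\<close> over a ball are at most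
  \<open>C / \<delta>\<^sup>2\<close> times the integral of \<open>G(u)\<^sup>2\<close> over the ball enlarged by \<open>\<delta>\<close> (lemma \<open>caccioppoli\<close>).

  Gain.  Averaging \<open>w(x)\<^sup>2 \<le> (w(x + y) - w(x))\<^sup>2 + 2 w(x) w(x + y)\<close> over \<open>|y| < \<rho>\<close> gives a Nash
  inequality: the integral of \<open>G(u)\<^sup>2\<close> up to time \<open>t\<close> is at most \<open>\<rho>\<^sup>2\<close> times that of \<open>|\<nabla>G(u)|\<^sup>2\<close>
  plus \<open>C t \<rho>\<^sup>-\<^sup>N\<close> times the supremum in time of \<open>(\<integral> G(u))\<^sup>2\<close>
  (lemma \<open>nash_inequality_translations\<close>).  By Cauchy-Schwarz \<open>G(s)\<^sup>2 \<le> s F(s)\<close>, so hypothesis (ii) says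
  that a power of \<open>G\<close> smaller than two is bounded by \<open>H\<close>; hence \<open>(\<integral> G(u))\<^sup>2\<close> is at most a power
  larger than one of \<open>\<integral> H(u)\<close>, and the second term is superlinear in the energy.  Along a sequence
  of shrinking balls, with \<open>\<rho>\<close> halved in each step and \<open>t\<close> small, the integrals of \<open>G(u)\<^sup>2\<close> therefore
  decay geometrically; on the limiting ball \<open>G(u) = 0\<close> (lemmas \<open>one_step\<close> and \<open>vanishing\<close>).

  Regularity.  Only a weak gradient of \<open>u\<close> is given, and \<open>G' = sqrt F'\<close> need not be continuous and may
  blow up at zero.  The Nash inequality asks only for an \<open>L\<^sup>2\<close> bound of the increments
  \<open>G(u(x + y)) - G(u(x))\<close> by \<open>|y| |\<nabla>G(u)|\<close>, and this is obtained line by line, without mollification: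
  by the fundamental lemma of the calculus of variations, \<open>u\<close> coincides on almost every segment with an
  indefinite integral of its weak derivative, and a one-dimensional chain rule applies there
  (lemmas \<open>increment_eq_integral_of_weak_derivative\<close> and \<open>G_increment_along_path\<close>).  That chain rule
  survives the discontinuities of \<open>F'\<close> because \<open>F'\<close>, being a derivative everywhere, is a pointwise limit
  of continuous difference quotients.

  Lebesgue measurable objects are replaced by Borel versions at the very end; the estimates are
  proved for Borel functions, in terms of non-negative integrals.
\<close>

section \<open>Continuously differentiable test functions\<close>

definition C1 :: "('a::euclidean_space \<Rightarrow> real) \<Rightarrow> bool"
  where "C1 f \<longleftrightarrow> (\<exists>D. (\<forall>z. (f has_derivative D z) (at z)) \<and>
    (\<forall>v. continuous_on UNIV (\<lambda>z. D z v)))"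

lemma C1I:
  assumes "\<And>z. (f has_derivative D z) (at z)" "\<And>v. continuous_on UNIV (\<lambda>z. D z v)"
  shows "C1 f"
  using assms unfolding C1_def by blast

lemma C1_continuous: "C1 f \<Longrightarrow> continuous_on S f"
  unfolding C1_def by (meson has_derivative_continuous continuous_at_imp_continuous_on)

lemma C1_differentiable: "C1 f \<Longrightarrow> f differentiable at z"
  unfolding C1_def differentiable_def by blast

lemma C1_has_derivative: "C1 f \<Longrightarrow> (f has_derivative frechet_derivative f (at z)) (at z)"
  using C1_differentiable frechet_derivative_works by blast

lemma C1_continuous_derivative: 
  assumes "C1 f"
  shows "continuous_on S (\<lambda>z. frechet_derivative f (at z) v)"
proof -
  obtain D where D: "\<forall>z. (f has_derivative D z) (at z)" "\<forall>v. continuous_on UNIV (\<lambda>z. D z v)"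
    using assms unfolding C1_def by blast
  have "frechet_derivative f (at z) = D z" for z
    using D(1) frechet_derivative_at by metis
  then have "continuous_on UNIV (\<lambda>z. frechet_derivative f (at z) v)" using D(2) by simp
  then show ?thesis by (rule continuous_on_subset) simp
qed

lemma C1_mult:
  assumes "C1 f" "C1 g"
  shows "C1 (\<lambda>z. f z * g z)"
  by (rule C1I[OF has_derivative_mult[OF C1_has_derivative[OF assms(1)] C1_has_derivative[OF assms(2)]]])
    (intro continuous_intros C1_continuous C1_continuous_derivative assms)

lemma C1_const: "C1 (\<lambda>z. c)"
  by (rule C1I[where D = "\<lambda>z v. 0"]) auto

lemma C1_prod:
  assumes "finite I" "\<And>i. i \<in> I \<Longrightarrow> C1 (f i)"
  shows "C1 (\<lambda>z. \<Prod>i\<in>I. f i z)"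
  using assms by (induction I rule: finite_induct) (auto intro: C1_mult C1_const)

lemma C1_compose:
  assumes "C1 f" "\<And>s. (g has_real_derivative g' s) (at s)" "continuous_on UNIV g'"
  shows "C1 (\<lambda>z. g (f z))"
proof (rule C1I)
  show "((\<lambda>z. g (f z)) has_derivative (\<lambda>v. g' (f z) * frechet_derivative f (at z) v)) (at z)" for z
    by (rule has_derivative_compose[OF C1_has_derivative[OF assms(1)] assms(2)[unfolded has_field_derivative_def]])
  show "continuous_on UNIV (\<lambda>z. g' (f z) * frechet_derivative f (at z) v)" for v
    by (intro continuous_intros C1_continuous_derivative assms continuous_on_compose2[OF assms(3)] C1_continuous) auto
qed

lemma C1_affine: "C1 (\<lambda>z. z \<bullet> b + c)"
  by (rule C1I[where D = "\<lambda>z v. v \<bullet> b"]) (auto intro!: derivative_eq_intros)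

lemma C1_affine': "C1 (\<lambda>z. c - z \<bullet> b)"
  by (rule C1I[where D = "\<lambda>z v. - (v \<bullet> b)"]) (auto intro!: derivative_eq_intros)

lemma C1_translate:
  assumes "C1 f"
  shows "C1 (\<lambda>z. f (z + c))"
proof (rule C1I)
  show "((\<lambda>z. f (z + c)) has_derivative (frechet_derivative f (at (z + c)))) (at z)" for z
    by (rule has_derivative_compose[OF _ C1_has_derivative[OF assms]]) (auto intro!: derivative_eq_intros)
  show "continuous_on UNIV (\<lambda>z. frechet_derivative f (at (z + c)) v)" for v
    by (rule continuous_on_compose2[OF C1_continuous_derivative[OF assms, of UNIV]]) (auto intro!: continuous_intros)
qed

lemma DERIV_pos_part_squared: "((\<lambda>s::real. (max 0 s)\<^sup>2) has_real_derivative 2 * max 0 s) (at s)"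
proof -
  consider "s < 0" | "s > 0" | "s = 0" by linarith
  then show ?thesis
  proof cases
    case 1
    then have "\<forall>\<^sub>F x in nhds s. x < 0" using eventually_nhds_in_open[of "{..<0}" s] by simp
    then have "\<forall>\<^sub>F x in nhds s. (max 0 x)\<^sup>2 = 0" by eventually_elim auto
    then show ?thesis using 1 by (subst DERIV_cong_ev[OF refl _ refl, where g = "\<lambda>_. 0"]) auto
  next
    case 2
    then have "\<forall>\<^sub>F x in nhds s. x > 0" using eventually_nhds_in_open[of "{0<..}" s] by simp
    then have "\<forall>\<^sub>F x in nhds s. (max 0 x)\<^sup>2 = x\<^sup>2" by eventually_elim auto
    then show ?thesis using 2
      by (subst DERIV_cong_ev[OF refl _ refl, where g = "\<lambda>x. x\<^sup>2"]) (auto intro!: derivative_eq_intros)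
  next
    case 3
    have "((\<lambda>h::real. (max 0 h)\<^sup>2 / h) \<longlongrightarrow> 0) (at 0)"
    proof (rule Lim_null_comparison[where g = "\<lambda>h. \<bar>h\<bar>"])
      show "\<forall>\<^sub>F x in at (0::real). norm ((max 0 x)\<^sup>2 / x) \<le> \<bar>x\<bar>"
        by (rule always_eventually) (auto simp: power2_eq_square max_def)
      show "((\<lambda>h::real. \<bar>h\<bar>) \<longlongrightarrow> 0) (at 0)"
        by (auto intro!: tendsto_eq_intros)
    qed
    then show ?thesis using 3 by (simp add: DERIV_def)
  qed
qed

lemma C1_pos_part_squared: "C1 f \<Longrightarrow> C1 (\<lambda>z. (max 0 (f z))\<^sup>2)"
  by (rule C1_compose[OF _ DERIV_pos_part_squared]) (auto intro!: continuous_intros)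

lemma C1_test_functionI:
  assumes "C1 f" "{z. f z \<noteq> 0} \<subseteq> S" "compact (closure S)" "closure S \<subseteq> U"
  shows "C1_test_function U f"
proof -
  have "closure {z. f z \<noteq> 0} \<subseteq> closure S" using assms(2) by (rule closure_mono)
  moreover then have "compact (closure {z. f z \<noteq> 0})"
    using assms(3) by (meson closed_closure compact_Int_closed compact_closure bounded_subset compact_imp_bounded closure_subset order_trans)
  ultimately show ?thesis
    using assms unfolding C1_test_function_def compactly_contained_def
    by (auto intro: C1_differentiable C1_continuous_derivative)
qed

lemma C1_test_function_C1: "C1_test_function U f \<Longrightarrow> C1 f"
  unfolding C1_test_function_def by (rule C1I[where D = "\<lambda>z. frechet_derivative f (at z)"]) (simp_all flip: frechet_derivative_works)

text \<open>
  The product over the coordinates of \<open>(z\<^sub>b - l\<^sub>b)\<^sub>+\<^sup>2 (r\<^sub>b - z\<^sub>b)\<^sub>+\<^sup>2\<close> is continuously differentiable and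
  positive exactly on the box.  Composed with \<open>s \<mapsto> k s\<^sup>2 / (1 + k s\<^sup>2)\<close> it tends to the indicator.
\<close>

lemma C1_approx_box:
  fixes l r :: "'a::euclidean_space"
  obtains \<eta> :: "nat \<Rightarrow> 'a \<Rightarrow> real" where
    "\<And>k. C1 (\<eta> k)" "\<And>k z. \<eta> k z \<noteq> 0 \<Longrightarrow> z \<in> box l r"
    "\<And>k z. 0 \<le> \<eta> k z" "\<And>k z. \<eta> k z \<le> 1"
    "\<And>z. (\<lambda>k. \<eta> k z) \<longlonglongrightarrow> indicator (box l r) z"
proof -
  define d where "d z = (\<Prod>b\<in>Basis. (max 0 (z \<bullet> b - l \<bullet> b))\<^sup>2 * (max 0 (r \<bullet> b - z \<bullet> b))\<^sup>2)" for z
  have d: "C1 d"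
    unfolding d_def using C1_affine[of _ "- (l \<bullet> _)"] C1_affine'
    by (intro C1_prod C1_mult C1_pos_part_squared) auto
  have d0: "d z \<noteq> 0 \<longleftrightarrow> z \<in> box l r" for z
    unfolding d_def box_def by (auto simp: max_def)
  define g where "g k t = real k * t\<^sup>2 / (1 + real k * t\<^sup>2)" for k t
  have pos: "1 + real k * t\<^sup>2 > 0" for k t by (simp add: add_pos_nonneg)
  have g: "C1 (\<lambda>z. g k (d z))" for k
  proof (rule C1_compose[OF d])
    show "(g k has_real_derivative 2 * real k * t / (1 + real k * t\<^sup>2)\<^sup>2) (at t)" for t
      unfolding g_def using pos[of k t]
      by (auto intro!: derivative_eq_intros simp: power2_eq_square field_simps)
    show "continuous_on UNIV (\<lambda>t. 2 * real k * t / (1 + real k * t\<^sup>2)\<^sup>2)"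
      using pos by (intro continuous_intros) (metis less_irrefl power_eq_0_iff)
  qed
  have lim: "(\<lambda>k. g k (d z)) \<longlonglongrightarrow> indicator (box l r) z" for z
  proof (cases "z \<in> box l r")
    case True
    then have "(d z)\<^sup>2 > 0" using d0 by auto
    then have "(\<lambda>k. (d z)\<^sup>2 / (1 / real k + (d z)\<^sup>2)) \<longlonglongrightarrow> (d z)\<^sup>2 / (0 + (d z)\<^sup>2)"
      by (intro tendsto_intros lim_1_over_n) auto
    moreover have "\<forall>\<^sub>F k in sequentially. (d z)\<^sup>2 / (1 / real k + (d z)\<^sup>2) = g k (d z)"
      using eventually_gt_at_top[of 0]
    proof eventually_elim
      case (elim k)
      then show ?case using pos[of k "d z"] \<open>(d z)\<^sup>2 > 0\<close> unfolding g_def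
        by (simp add: divide_simps) (simp add: algebra_simps)
    qed
    ultimately have "(\<lambda>k. g k (d z)) \<longlonglongrightarrow> (d z)\<^sup>2 / (0 + (d z)\<^sup>2)"
      by (rule Lim_transform_eventually)
    moreover have "(d z)\<^sup>2 / (0 + (d z)\<^sup>2) = indicator (box l r) z" using True \<open>(d z)\<^sup>2 > 0\<close> by simp
    ultimately show ?thesis by simp
  next
    case False
    then have "d z = 0" using d0 by auto
    then show ?thesis using False by (simp add: g_def)
  qed
  show ?thesis
  proof (rule that[OF g _ _ _ lim])
    show "g k (d z) \<noteq> 0 \<Longrightarrow> z \<in> box l r" for k z using d0 by (auto simp: g_def)
    show "0 \<le> g k (d z)" "g k (d z) \<le> 1" for k z
      unfolding g_def using pos[of k "d z"] by auto
  qed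
qed


text \<open>
  Boxes form an intersection-stable generator of the Borel sets, so the integrals over all Borel
  subsets of the box vanish as well.
\<close>

lemma integral_box_eq_0_imp_AE_0:
  fixes f :: "'a::euclidean_space \<Rightarrow> real"
  assumes int[measurable]: "integrable lborel f"
    and box: "\<And>l r. box l r \<subseteq> box a b \<Longrightarrow> (LBINT z:box l r. f z) = 0"
  shows "AE z in lborel. z \<in> box a b \<longrightarrow> f z = 0"
proof -
  let ?I = "\<lambda>A. LBINT z:A \<inter> box a b. f z"
  have fi: "set_integrable lborel A f" if "A \<in> sets borel" for A
    using integrable_mult_indicator[of A lborel f] int that by (simp add: set_integrable_def)
  have zero: "?I A = 0" if A: "A \<in> sets borel" for A
  proof -
    have "Int_stable (range (\<lambda>(a, b). box a b :: 'a set))"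
      by (auto simp: Int_stable_def box_Int_box)
    moreover have "(range (\<lambda>(a, b). box a b :: 'a set)) \<subseteq> Pow UNIV"
      by auto
    moreover have "A \<in> sigma_sets UNIV (range (\<lambda>(a, b). box a b))"
      using A unfolding borel_eq_box by simp
    ultimately show ?thesis
    proof (induction rule: sigma_sets_induct_disjoint)
      case (basic A)
      then obtain c d where A: "A = box c d" by auto
      have "A \<inter> box a b \<subseteq> box a b" by blast
      then show ?case unfolding A box_Int_box by (rule box)
    next
      case empty
      show ?case by (simp add: set_lebesgue_integral_def)
    next
      case (compl A)
      then have [measurable]: "A \<in> sets borel" by (simp add: borel_eq_box)
      have eq: "UNIV \<inter> box a b = (A \<inter> box a b) \<union> ((UNIV - A) \<inter> box a b)" by blast
      have "?I UNIV = ?I A + ?I (UNIV - A)"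
        unfolding eq by (rule set_integral_Un) (auto intro!: fi)
      then show ?case using compl box[of a b] by simp
    next
      case (union F)
      then have [measurable]: "\<And>i. F i \<in> sets borel" by (simp add: borel_eq_box subset_eq)
      have "?I (\<Union>i. F i) = (\<Sum>i. ?I (F i))"
        unfolding UN_extend_simps
        using union(1) by (intro lebesgue_integral_countable_add fi) (auto simp: disjoint_family_on_def)
      then show ?case using union by simp
    qed
  qed
  have "AE z in lborel. indicator (box a b) z *\<^sub>R f z = 0"
  proof (rule sigma_finite_measure.density_zero[OF sigma_finite_lborel])
    show "integrable lborel (\<lambda>z. indicator (box a b) z *\<^sub>R f z)"
      using fi[of "box a b"] by (simp add: set_integrable_def)
    show "set_lebesgue_integral lborel A (\<lambda>z. indicator (box a b) z *\<^sub>R f z) = 0" if "A \<in> sets lborel" for A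
      using zero[of A] that by (simp add: set_lebesgue_integral_def indicator_inter_arith mult.assoc)
  qed
  then show ?thesis by eventually_elim (auto simp: indicator_def)
qed

text \<open>
  The fundamental lemma of the calculus of variations.  Integrals over boxes are limits of integrals
  against test functions, and countably many boxes exhaust an open set.
\<close>

lemma fundamental_lemma:
  fixes f :: "'a::euclidean_space \<Rightarrow> real"
  assumes int[measurable]: "integrable lborel f" and "open U"
    and test: "\<And>\<eta>. C1_test_function U \<eta> \<Longrightarrow> (LBINT z. f z * \<eta> z) = 0"
  shows "AE z in lborel. z \<in> U \<longrightarrow> f z = 0"
proof -
  have box: "(LBINT z:box l r. f z) = 0" if cb: "cbox l r \<subseteq> U" for l r
  proof -
    obtain \<eta> where \<eta>: "\<And>k. C1 (\<eta> k)" "\<And>k z. \<eta> k z \<noteq> 0 \<Longrightarrow> z \<in> box l r"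
      "\<And>k z. 0 \<le> \<eta> k z" "\<And>k z. \<eta> k z \<le> 1"
      "\<And>z. (\<lambda>k. \<eta> k z) \<longlonglongrightarrow> indicator (box l r) z"
      using C1_approx_box by blast
    have [measurable]: "\<eta> k \<in> borel_measurable borel" for k
      by (intro borel_measurable_continuous_onI C1_continuous \<eta>)
    have "(\<lambda>k. LBINT z. f z * \<eta> k z) \<longlonglongrightarrow> (LBINT z. f z * indicator (box l r) z)"
    proof (rule integral_dominated_convergence)
      show "integrable lborel (\<lambda>z. norm (f z))" using int by simp
      show "AE z in lborel. norm (f z * \<eta> k z) \<le> norm (f z)" for k
        using \<eta>(3,4) by (auto simp: abs_mult mult_left_le)
      show "AE z in lborel. (\<lambda>k. f z * \<eta> k z) \<longlonglongrightarrow> f z * indicator (box l r) z"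
        by (intro AE_I2 tendsto_intros \<eta>)
    qed auto
    moreover have "(LBINT z. f z * \<eta> k z) = 0" for k
    proof (rule test, rule C1_test_functionI[OF \<eta>(1)])
      show "{z. \<eta> k z \<noteq> 0} \<subseteq> cbox l r" using \<eta>(2)[of k] box_subset_cbox by blast
    qed (use cb in auto)
    ultimately show ?thesis
      by (simp add: LIMSEQ_const_iff set_lebesgue_integral_def mult.commute)
  qed
  obtain \<D> where \<D>: "countable \<D>" "\<D> \<subseteq> Pow U" "\<And>X. X \<in> \<D> \<Longrightarrow> \<exists>a b. X = cbox a b" "\<Union>\<D> = U"
    using open_countable_Union_open_cbox[OF \<open>open U\<close>] by blast
  have "AE z in lborel. \<forall>X\<in>\<D>. z \<in> X \<longrightarrow> f z = 0"
    unfolding AE_ball_countable[OF \<D>(1)]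
  proof
    fix X assume X: "X \<in> \<D>"
    then obtain a b where ab: "X = cbox a b" using \<D>(3) by blast
    have "AE z in lborel. z \<in> box a b \<longrightarrow> f z = 0"
    proof (rule integral_box_eq_0_imp_AE_0[OF int])
      fix l r assume lr: "box l r \<subseteq> box a b"
      show "(LBINT z:box l r. f z) = 0"
      proof (cases "box l r = {}")
        case False
        moreover have "box a b \<noteq> {}" using False lr by blast
        ultimately have "cbox l r \<subseteq> cbox a b"
          using closure_mono[OF lr] closure_box[of l r] closure_box[of a b] by simp
        then show ?thesis using box X ab \<D>(2) by blast
      qed (simp add: set_lebesgue_integral_def)
    qed
    moreover have "AE z in lborel. z \<notin> cbox a b - box a b"
      by (rule AE_not_in) (auto simp: null_sets_def emeasure_Diff emeasure_lborel_cbox_eq emeasure_lborel_box_eq box_subset_cbox)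
    ultimately show "AE z in lborel. z \<in> X \<longrightarrow> f z = 0"
      unfolding ab by eventually_elim auto
  qed
  then show ?thesis by eventually_elim (use \<D>(4) in blast)
qed

section \<open>Weak derivatives and increments along segments\<close>

lemma lborel_translate:
  fixes c :: "'a::euclidean_space"
  shows "distr lborel borel (\<lambda>z. z + c) = lborel"
  using lborel_distr_plus[of c] unfolding add.commute[of _ c] .

lemma nn_integral_lborel_translate:
  fixes c :: "'a::euclidean_space"
  assumes [measurable]: "f \<in> borel_measurable borel"
  shows "(\<integral>\<^sup>+z. f (z + c) \<partial>lborel) = (\<integral>\<^sup>+z. f z \<partial>lborel)"
proof -
  have "(\<integral>\<^sup>+z. f z \<partial>lborel) = (\<integral>\<^sup>+z. f z \<partial>distr lborel borel (\<lambda>z. z + c))"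
    by (simp only: lborel_translate)
  also have "\<dots> = (\<integral>\<^sup>+z. f (z + c) \<partial>lborel)"
    by (rule nn_integral_distr) auto
  finally show ?thesis ..
qed

lemma integral_lborel_translate:
  fixes c :: "'a::euclidean_space" and f :: "'a \<Rightarrow> real"
  assumes [measurable]: "f \<in> borel_measurable borel"
  shows "(LBINT z. f (z + c)) = (LBINT z. f z)"
proof -
  have "(LBINT z. f z) = integral\<^sup>L (distr lborel borel (\<lambda>z. z + c)) f"
    by (simp only: lborel_translate)
  also have "\<dots> = (LBINT z. f (z + c))"
    by (rule integral_distr) auto
  finally show ?thesis ..
qed

lemma integrable_lborel_translate:
  fixes c :: "'a::euclidean_space" and f :: "'a \<Rightarrow> real"
  assumes "integrable lborel f"
  shows "integrable lborel (\<lambda>z. f (z + c))"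
proof -
  have "integrable (distr lborel borel (\<lambda>z. z + c)) f"
    using assms by (simp only: lborel_translate)
  then show ?thesis by (subst (asm) integrable_distr_eq) (use assms in auto)
qed

lemma frechet_derivative_0_off_support:
  fixes \<eta> :: "'a::euclidean_space \<Rightarrow> real"
  assumes "z \<notin> closure {z. \<eta> z \<noteq> 0}"
  shows "frechet_derivative \<eta> (at z) = (\<lambda>v. 0)"
proof -
  have "open (- closure {z. \<eta> z \<noteq> 0})" by auto
  then have "\<forall>\<^sub>F x in nhds z. x \<in> - closure {z. \<eta> z \<noteq> 0}"
    using assms by (intro eventually_nhds_in_open) auto
  then have "\<forall>\<^sub>F x in nhds z. 0 = \<eta> x"
    by eventually_elim (use closure_subset[of "{z. \<eta> z \<noteq> 0}"] in auto)
  then have "(\<eta> has_derivative (\<lambda>v. 0)) (at z)"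
    using has_derivative_transform_eventually[of "\<lambda>_. 0" "\<lambda>v. 0" z UNIV \<eta>]
    by (auto simp: eventually_nhds eventually_at_filter dest: eventually_nhds_x_imp_x elim!: eventually_mono)
  then show ?thesis by (rule frechet_derivative_at[symmetric])
qed

lemma C1_test_function_translate:
  fixes \<eta> :: "'a::euclidean_space \<Rightarrow> real"
  assumes "C1_test_function U \<eta>" and "\<And>z. z \<in> U \<Longrightarrow> z - c \<in> V"
  shows "C1_test_function V (\<lambda>z. \<eta> (z + c))"
proof -
  let ?K = "closure {z. \<eta> z \<noteq> 0}"
  let ?S = "(\<lambda>z. z - c) ` ?K"
  have K: "compact ?K" "?K \<subseteq> U"
    using assms(1) by (auto simp: C1_test_function_def compactly_contained_def)
  have S: "compact ?S" by (intro compact_continuous_image K continuous_intros)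
  show ?thesis
  proof (rule C1_test_functionI)
    show "C1 (\<lambda>z. \<eta> (z + c))" by (rule C1_translate[OF C1_test_function_C1[OF assms(1)]])
    show "{z. \<eta> (z + c) \<noteq> 0} \<subseteq> ?S"
    proof
      fix z assume "z \<in> {z. \<eta> (z + c) \<noteq> 0}"
      then have "z + c \<in> ?K" using closure_subset[of "{z. \<eta> z \<noteq> 0}"] by auto
      then show "z \<in> ?S" by (intro image_eqI[where x = "z + c"]) auto
    qed
    show "compact (closure ?S)" "closure ?S \<subseteq> V"
      using S K(2) assms(2) compact_imp_closed[OF S] by (auto simp: closure_closed)
  qed
qed

lemma frechet_derivative_translate:
  assumes "C1 \<eta>"
  shows "frechet_derivative (\<lambda>z. \<eta> (z + c)) (at z) = frechet_derivative \<eta> (at (z + c))"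
proof -
  have "((\<lambda>z. \<eta> (z + c)) has_derivative frechet_derivative \<eta> (at (z + c))) (at z)"
    by (rule has_derivative_compose[OF _ C1_has_derivative[OF assms]]) (auto intro!: derivative_eq_intros)
  then show ?thesis by (rule frechet_derivative_at[symmetric])
qed

lemma C1_increment:
  fixes \<eta> :: "'a::euclidean_space \<Rightarrow> real"
  assumes "C1 \<eta>" "0 \<le> \<tau>"
  shows "\<eta> (z - \<tau> *\<^sub>R e) - \<eta> z = - (LBINT \<sigma>. indicator {0..\<tau>} \<sigma> * frechet_derivative \<eta> (at (z - \<sigma> *\<^sub>R e)) e)"
proof -
  let ?d = "\<lambda>\<sigma>. frechet_derivative \<eta> (at (z - \<sigma> *\<^sub>R e)) e"
  have der: "((\<lambda>\<sigma>. \<eta> (z - \<sigma> *\<^sub>R e)) has_vector_derivative - ?d \<sigma>) (at \<sigma> within {0..\<tau>})" for \<sigma>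
  proof -
    have lin: "linear (frechet_derivative \<eta> (at w))" for w
      using C1_has_derivative[OF assms(1)] has_derivative_linear by blast
    have "((\<lambda>\<sigma>. \<eta> (z - \<sigma> *\<^sub>R e)) has_derivative (\<lambda>h. frechet_derivative \<eta> (at (z - \<sigma> *\<^sub>R e)) (- (h *\<^sub>R e)))) (at \<sigma> within {0..\<tau>})"
      by (rule has_derivative_compose[OF _ C1_has_derivative[OF assms(1)]]) (auto intro!: derivative_eq_intros)
    then show ?thesis
      unfolding has_vector_derivative_def
      by (simp add: linear_neg[OF lin] linear_scale[OF lin])
  qed
  have cont: "continuous_on {0..\<tau>} (\<lambda>\<sigma>. - ?d \<sigma>)"
    by (intro continuous_on_minus continuous_on_compose2[OF C1_continuous_derivative[OF assms(1), of UNIV]])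
      (auto intro!: continuous_intros)
  have "(\<integral>\<sigma>. indicator {0..\<tau>} \<sigma> *\<^sub>R (- ?d \<sigma>) \<partial>lborel) = \<eta> (z - \<tau> *\<^sub>R e) - \<eta> (z - 0 *\<^sub>R e)"
    by (rule integral_FTC_Icc[OF assms(2) der cont])
  then show ?thesis by simp
qed

text \<open>
  The integrability behind every exchange of integrals over the point and over the position on a
  segment: translations preserve the \<open>L\<^sup>1\<close> norm of \<open>D\<close>, so the iterated integral is finite.
\<close>

lemma pair_product_integrable_translate:
  fixes D :: "'a::euclidean_space \<Rightarrow> real"
  assumes int: "integrable lborel D" and [measurable]: "w \<in> borel_measurable borel"
    and w: "\<And>z. \<bar>w z\<bar> \<le> B"
  shows "integrable (lborel \<Otimes>\<^sub>M lborel) (\<lambda>(\<sigma>::real, z). indicator {0..\<tau>} \<sigma> * (D (z + \<sigma> *\<^sub>R e) * w z))"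
proof (rule integrableI_bounded)
  have [measurable]: "D \<in> borel_measurable borel" using int by auto
  show "(\<lambda>(\<sigma>, z). indicator {0..\<tau>} \<sigma> * (D (z + \<sigma> *\<^sub>R e) * w z)) \<in> borel_measurable (lborel \<Otimes>\<^sub>M lborel)"
    by measurable
  have B: "0 \<le> B" using w[of undefined] by linarith
  have "(\<integral>\<^sup>+x. ennreal (norm (case x of (\<sigma>::real, z) \<Rightarrow> indicator {0..\<tau>} \<sigma> * (D (z + \<sigma> *\<^sub>R e) * w z))) \<partial>(lborel \<Otimes>\<^sub>M lborel))
      = (\<integral>\<^sup>+\<sigma>. \<integral>\<^sup>+z. ennreal (norm (indicator {0..\<tau>} \<sigma> * (D (z + \<sigma> *\<^sub>R e) * w z))) \<partial>lborel \<partial>lborel)"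
    by (subst lborel.nn_integral_fst[symmetric]) auto
  also have "\<dots> \<le> (\<integral>\<^sup>+\<sigma>. (\<integral>\<^sup>+z. ennreal B * ennreal (norm (D (z + \<sigma> *\<^sub>R e))) \<partial>lborel) * indicator {0..\<tau>} \<sigma> \<partial>lborel)"
  proof (rule nn_integral_mono)
    fix \<sigma> :: real
    show "(\<integral>\<^sup>+z. ennreal (norm (indicator {0..\<tau>} \<sigma> * (D (z + \<sigma> *\<^sub>R e) * w z))) \<partial>lborel)
      \<le> (\<integral>\<^sup>+z. ennreal B * ennreal (norm (D (z + \<sigma> *\<^sub>R e))) \<partial>lborel) * indicator {0..\<tau>} \<sigma>"
      using w B by (auto simp: indicator_def abs_mult ennreal_mult'[symmetric] mult.commute
          intro!: nn_integral_mono ennreal_leI mult_right_mono)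
  qed
  also have "\<dots> = (\<integral>\<^sup>+\<sigma>. ennreal B * (\<integral>\<^sup>+z. ennreal (norm (D z)) \<partial>lborel) * indicator {0..\<tau>} \<sigma> \<partial>lborel)"
  proof -
    have "(\<integral>\<^sup>+z. ennreal (norm (D (z + c))) \<partial>lborel) = (\<integral>\<^sup>+z. ennreal (norm (D z)) \<partial>lborel)" for c
      by (rule nn_integral_lborel_translate) auto
    then show ?thesis by (simp add: nn_integral_cmult)
  qed
  also have "\<dots> = ennreal B * (\<integral>\<^sup>+z. ennreal (norm (D z)) \<partial>lborel) * emeasure lborel {0..\<tau>}"
    by (subst nn_integral_cmult_indicator) auto
  also have "\<dots> < \<infinity>"
    using int unfolding integrable_iff_bounded by (auto simp: ennreal_mult_less_top emeasure_lborel_Icc_eq)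
  finally show "(\<integral>\<^sup>+x. ennreal (norm (case x of (\<sigma>::real, z) \<Rightarrow> indicator {0..\<tau>} \<sigma> * (D (z + \<sigma> *\<^sub>R e) * w z))) \<partial>(lborel \<Otimes>\<^sub>M lborel)) < \<infinity>" .
qed

text \<open>
  Both sides agree when tested against any \<open>\<eta>\<close>.  A translation moves the increment from \<open>U\<close> to \<open>\<eta>\<close>,
  where it is an integral of classical derivatives of the shifted functions \<open>z \<mapsto> \<eta>(z - \<sigma> e)\<close>; these are
  test functions on \<open>V\<close>, so for each \<open>\<sigma>\<close> the weak derivative may take over, and Fubini collects the
  result.
\<close>

lemma increment_eq_integral_of_weak_derivative:
  fixes U d :: "'a::euclidean_space \<Rightarrow> real"
  assumes [measurable]: "U \<in> borel_measurable borel" and bU: "\<And>z. \<bar>U z\<bar> \<le> M"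
    and d: "integrable lborel d"
    and weak: "\<And>\<eta>. C1_test_function V \<eta> \<Longrightarrow>
      (LBINT z. U z * frechet_derivative \<eta> (at z) e) = - (LBINT z. d z * \<eta> z)"
    and "open W" "bounded W" and W: "\<And>z \<sigma>. z \<in> W \<Longrightarrow> \<sigma> \<in> {0..\<tau>} \<Longrightarrow> z + \<sigma> *\<^sub>R e \<in> V"
    and "0 \<le> \<tau>"
  shows "AE z in lborel. z \<in> W \<longrightarrow> U (z + \<tau> *\<^sub>R e) - U z = (LBINT \<sigma>. indicator {0..\<tau>} \<sigma> * d (z + \<sigma> *\<^sub>R e))"
proof -
  have [measurable]: "d \<in> borel_measurable borel" using d by auto
  have [measurable]: "W \<in> sets borel" using \<open>open W\<close> by auto
  \<comment> \<open>the claimed increment, integrable on the whole space\<close>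
  define k where "k z = (LBINT \<sigma>. indicator {0..\<tau>} \<sigma> * d (z + \<sigma> *\<^sub>R e))" for z
  have M: "0 \<le> M" using bU[of undefined] by linarith
  have k: "integrable lborel k"
    using lborel_pair.integrable_snd[OF pair_product_integrable_translate[OF d, of "\<lambda>_. 1" 1 \<tau> e]]
    unfolding k_def by simp
  have Wfin: "emeasure lborel W < \<infinity>" using \<open>bounded W\<close> by (rule emeasure_bounded_finite)
  have UW: "integrable lborel (\<lambda>z. indicator W z * U (z + c))" for c
  proof (rule Bochner_Integration.integrable_bound)
    show "integrable lborel (\<lambda>z. M * indicator W z)"
      using Wfin by (intro integrable_mult_right integrable_real_indicator) auto
  qed (use bU M in \<open>auto simp: indicator_def\<close>)
  define f where "f z = indicator W z * (U (z + \<tau> *\<^sub>R e) - U z - k z)" for z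
  have f: "integrable lborel f"
    unfolding f_def right_diff_distrib
    using UW[of "\<tau> *\<^sub>R e"] UW[of 0] k
    by (intro Bochner_Integration.integrable_diff) (auto intro: integrable_real_mult_indicator simp: mult.commute)
  have "AE z in lborel. z \<in> W \<longrightarrow> f z = 0"
  proof (rule fundamental_lemma[OF f \<open>open W\<close>])
    fix \<eta> assume \<eta>: "C1_test_function W \<eta>"
    then have C: "C1 \<eta>" by (rule C1_test_function_C1)
    let ?K = "closure {z. \<eta> z \<noteq> 0}"
    have K: "compact ?K" "?K \<subseteq> W"
      using \<eta> by (auto simp: C1_test_function_def compactly_contained_def)
    have off: "\<eta> z = 0" if "z \<notin> W" for z
      using that K(2) closure_subset[of "{z. \<eta> z \<noteq> 0}"] by auto
    let ?d\<eta> = "\<lambda>z. frechet_derivative \<eta> (at z) e"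
    have c\<eta>: "continuous_on S \<eta>" "continuous_on S ?d\<eta>" for S
      by (rule C1_continuous[OF C] C1_continuous_derivative[OF C])+
    have [measurable]: "\<eta> \<in> borel_measurable borel" "?d\<eta> \<in> borel_measurable borel"
      by (intro borel_measurable_continuous_onI c\<eta>)+
    have ex: "\<exists>B. \<forall>z. \<bar>\<eta> z\<bar> \<le> B \<and> \<bar>?d\<eta> z\<bar> \<le> B"
    proof -
      have "bounded (\<eta> ` ?K)" "bounded (?d\<eta> ` ?K)"
        by (intro compact_imp_bounded compact_continuous_image c\<eta> K)+
      then obtain B1 B2 where B: "\<And>z. z \<in> ?K \<Longrightarrow> \<bar>\<eta> z\<bar> \<le> B1" "\<And>z. z \<in> ?K \<Longrightarrow> \<bar>?d\<eta> z\<bar> \<le> B2"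
        unfolding bounded_iff by (metis imageI real_norm_def)
      have "\<bar>\<eta> z\<bar> \<le> \<bar>B1\<bar> + \<bar>B2\<bar> \<and> \<bar>?d\<eta> z\<bar> \<le> \<bar>B1\<bar> + \<bar>B2\<bar>" for z
      proof (cases "z \<in> ?K")
        case True
        then show ?thesis using B(1)[OF True] B(2)[OF True] by linarith
      next
        case False
        moreover have "\<eta> z = 0" using False closure_subset[of "{z. \<eta> z \<noteq> 0}"] by auto
        ultimately show ?thesis using frechet_derivative_0_off_support[OF False] by simp
      qed
      then show ?thesis by blast
    qed
    then obtain B where B: "\<And>z. \<bar>\<eta> z\<bar> \<le> B" "\<And>z. \<bar>?d\<eta> z\<bar> \<le> B" by blast
    have B0: "0 \<le> B" using B(1)[of undefined] by linarith
    have test: "C1_test_function V (\<lambda>z. \<eta> (z + - (\<sigma> *\<^sub>R e)))" if "\<sigma> \<in> {0..\<tau>}" for \<sigma>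
      using W that by (intro C1_test_function_translate[OF \<eta>]) auto
    \<comment> \<open>the weak derivative, tested with \<open>\<eta>\<close> shifted by \<open>\<sigma> e\<close>\<close>
    have shifted: "(LBINT z. U z * ?d\<eta> (z - \<sigma> *\<^sub>R e)) = - (LBINT z. d (z + \<sigma> *\<^sub>R e) * \<eta> z)"
      if "\<sigma> \<in> {0..\<tau>}" for \<sigma>
    proof -
      have "(LBINT z. U z * ?d\<eta> (z + - (\<sigma> *\<^sub>R e))) = - (LBINT z. d z * \<eta> (z + - (\<sigma> *\<^sub>R e)))"
        using weak[OF test[OF that]] by (simp only: frechet_derivative_translate[OF C])
      also have "(LBINT z. d z * \<eta> (z + - (\<sigma> *\<^sub>R e))) = (LBINT z. d (z + \<sigma> *\<^sub>R e) * \<eta> z)"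
        using integral_lborel_translate[of "\<lambda>z. d z * \<eta> (z + - (\<sigma> *\<^sub>R e))" "\<sigma> *\<^sub>R e"] by simp
      finally show ?thesis by simp
    qed
    obtain \<rho> where \<rho>: "\<And>z. z \<in> ?K \<Longrightarrow> norm z \<le> \<rho>"
      using compact_imp_bounded[OF K(1)] unfolding bounded_iff by blast
    let ?C = "cball 0 (\<rho> + \<tau> * norm e) :: 'a set"
    have d\<eta>0: "?d\<eta> (z - \<sigma> *\<^sub>R e) = 0" if "\<sigma> \<in> {0..\<tau>}" "z \<notin> ?C" for \<sigma> z
    proof (rule ccontr)
      assume "?d\<eta> (z - \<sigma> *\<^sub>R e) \<noteq> 0"
      then have "z - \<sigma> *\<^sub>R e \<in> ?K" using frechet_derivative_0_off_support by metis
      then have "norm (z - \<sigma> *\<^sub>R e) \<le> \<rho>" by (rule \<rho>)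
      moreover have "norm z \<le> norm (z - \<sigma> *\<^sub>R e) + norm (\<sigma> *\<^sub>R e)"
        using norm_triangle_ineq[of "z - \<sigma> *\<^sub>R e" "\<sigma> *\<^sub>R e"] by simp
      moreover have "norm (\<sigma> *\<^sub>R e) \<le> \<tau> * norm e" using that(1) by (auto intro: mult_right_mono)
      ultimately show False using that(2) by auto
    qed
    have Ud\<eta>: "integrable (lborel \<Otimes>\<^sub>M lborel) (\<lambda>(\<sigma>::real, z). indicator {0..\<tau>} \<sigma> * (U z * ?d\<eta> (z - \<sigma> *\<^sub>R e)))"
    proof (rule Bochner_Integration.integrable_bound)
      have "emeasure lborel ?C < \<infinity>" by (rule emeasure_bounded_finite) simp
      then have "emeasure (lborel \<Otimes>\<^sub>M lborel) ({0..\<tau>} \<times> ?C) < \<infinity>"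
        by (subst lborel.emeasure_pair_measure_Times) (auto simp: ennreal_mult_less_top emeasure_lborel_Icc_eq)
      then show "integrable (lborel \<Otimes>\<^sub>M lborel) (\<lambda>x::real \<times> 'a. M * B * indicator ({0..\<tau>} \<times> ?C) x)"
        by (intro integrable_mult_right integrable_real_indicator) auto
      show "(\<lambda>(\<sigma>::real, z). indicator {0..\<tau>} \<sigma> * (U z * ?d\<eta> (z - \<sigma> *\<^sub>R e))) \<in> borel_measurable (lborel \<Otimes>\<^sub>M lborel)"
        by measurable
      show "AE x in lborel \<Otimes>\<^sub>M lborel. norm (case x of (\<sigma>::real, z) \<Rightarrow> indicator {0..\<tau>} \<sigma> * (U z * ?d\<eta> (z - \<sigma> *\<^sub>R e)))
          \<le> norm (M * B * indicator ({0..\<tau>} \<times> ?C) x)"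
      proof (rule AE_I2, clarsimp)
        fix \<sigma> :: real and z :: 'a
        have "\<bar>U z * ?d\<eta> (z - \<sigma> *\<^sub>R e)\<bar> \<le> M * B"
          unfolding abs_mult using bU B M by (intro mult_mono) auto
        then show "\<bar>indicator {0..\<tau>} \<sigma> * (U z * ?d\<eta> (z - \<sigma> *\<^sub>R e))\<bar> \<le> \<bar>M * B * indicator ({0..\<tau>} \<times> ?C) (\<sigma>, z)\<bar>"
          using d\<eta>0[of \<sigma> z] M B0 by (cases "z \<in> ?C"; cases "\<sigma> \<in> {0..\<tau>}") (simp_all add: indicator_times)
      qed
    qed
    have D\<eta>: "integrable (lborel \<Otimes>\<^sub>M lborel) (\<lambda>(\<sigma>::real, z). indicator {0..\<tau>} \<sigma> * (d (z + \<sigma> *\<^sub>R e) * \<eta> z))"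
      by (rule pair_product_integrable_translate[OF d _ B(1)]) auto
    have U\<eta>: "integrable lborel (\<lambda>z. U (z + c) * \<eta> z)" for c
    proof (rule Bochner_Integration.integrable_bound[where f = "\<lambda>z. B * (indicator W z * U (z + c))"])
      show "AE z in lborel. norm (U (z + c) * \<eta> z) \<le> norm (B * (indicator W z * U (z + c)))"
      proof (rule AE_I2)
        fix z
        show "norm (U (z + c) * \<eta> z) \<le> norm (B * (indicator W z * U (z + c)))"
          using B(1)[of z] B0 off[of z] by (cases "z \<in> W") (auto simp: abs_mult mult.commute intro!: mult_right_mono)
      qed
    qed (use UW in auto)
    have U\<eta>': "integrable lborel (\<lambda>z. U z * \<eta> (z - \<tau> *\<^sub>R e))"
      using integrable_lborel_translate[OF U\<eta>[of "\<tau> *\<^sub>R e"], of "- (\<tau> *\<^sub>R e)"] by simp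
    have k\<eta>: "integrable lborel (\<lambda>z. k z * \<eta> z)"
      by (rule Bochner_Integration.integrable_bound[where f = "\<lambda>z. B * k z"])
        (use k B(1) B0 in \<open>auto simp: abs_mult mult.commute[of _ "\<eta> _"] intro!: mult_right_mono\<close>)
    have "(LBINT z. f z * \<eta> z) = (LBINT z. U (z + \<tau> *\<^sub>R e) * \<eta> z - U (z + 0) * \<eta> z - k z * \<eta> z)"
      by (intro Bochner_Integration.integral_cong refl) (auto simp: f_def indicator_def off algebra_simps)
    also have "\<dots> = (LBINT z. U (z + \<tau> *\<^sub>R e) * \<eta> z) - (LBINT z. U (z + 0) * \<eta> z) - (LBINT z. k z * \<eta> z)"
      using U\<eta> k\<eta> by (simp only: Bochner_Integration.integral_diff Bochner_Integration.integrable_diff)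
    also have "(LBINT z. U (z + \<tau> *\<^sub>R e) * \<eta> z) = (LBINT z. U z * \<eta> (z - \<tau> *\<^sub>R e))"
      using integral_lborel_translate[of "\<lambda>z. U z * \<eta> (z - \<tau> *\<^sub>R e)" "\<tau> *\<^sub>R e"] by simp
    also have "\<dots> - (LBINT z. U (z + 0) * \<eta> z) = (LBINT z. U z * (\<eta> (z - \<tau> *\<^sub>R e) - \<eta> z))"
      using U\<eta>' U\<eta>[of 0] by (simp add: right_diff_distrib)
    also have "\<dots> = - (LBINT z. U z * (LBINT \<sigma>. indicator {0..\<tau>} \<sigma> * ?d\<eta> (z - \<sigma> *\<^sub>R e)))"
      by (simp only: C1_increment[OF C \<open>0 \<le> \<tau>\<close>] mult_minus_right Bochner_Integration.integral_minus)
    also have "(LBINT z. U z * (LBINT \<sigma>. indicator {0..\<tau>} \<sigma> * ?d\<eta> (z - \<sigma> *\<^sub>R e)))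
        = (LBINT z. LBINT \<sigma>. indicator {0..\<tau>} \<sigma> * (U z * ?d\<eta> (z - \<sigma> *\<^sub>R e)))"
      by (intro Bochner_Integration.integral_cong refl, subst integral_mult_right_zero[symmetric])
        (simp only: mult.left_commute)
    also have "\<dots> = (LBINT \<sigma>. LBINT z. indicator {0..\<tau>} \<sigma> * (U z * ?d\<eta> (z - \<sigma> *\<^sub>R e)))"
      by (rule lborel_pair.Fubini_integral[OF Ud\<eta>])
    also have "\<dots> = (LBINT \<sigma>. - (LBINT z. indicator {0..\<tau>} \<sigma> * (d (z + \<sigma> *\<^sub>R e) * \<eta> z)))"
      by (intro Bochner_Integration.integral_cong refl) (auto simp: indicator_def shifted)
    also have "\<dots> = - (LBINT z. LBINT \<sigma>. indicator {0..\<tau>} \<sigma> * (d (z + \<sigma> *\<^sub>R e) * \<eta> z))"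
      using lborel_pair.Fubini_integral[OF D\<eta>] by simp
    also have "(LBINT z. LBINT \<sigma>. indicator {0..\<tau>} \<sigma> * (d (z + \<sigma> *\<^sub>R e) * \<eta> z)) = (LBINT z. k z * \<eta> z)"
      unfolding k_def by (simp flip: mult.assoc)
    finally show "(LBINT z. f z * \<eta> z) = 0" by simp
  qed
  then show ?thesis
    by eventually_elim (auto simp: f_def k_def)
qed

section \<open>The chain rule along an indefinite integral\<close>

text \<open>
  On a short interval \<open>\<phi> \<circ> \<psi>\<close> is within \<open>e\<close> of a constant, for which the formula is trivial; so the error
  there is at most \<open>2 e\<close> times the integral of \<open>|p|\<close>.  This bound is additive over adjacent intervals,
  which allows Bolzano's bisection to carry it to the whole of \<open>{a..b}\<close>.
\<close>

lemma chain_rule_indefinite_integral: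
  fixes \<psi> p \<Phi> \<phi> :: "real \<Rightarrow> real"
  assumes "a \<le> b" and p: "p absolutely_integrable_on {a..b}"
    and \<psi>: "\<And>t. t \<in> {a..b} \<Longrightarrow> \<psi> t = \<psi> a + integral {a..t} p"
    and range: "\<And>t. t \<in> {a..b} \<Longrightarrow> \<psi> t \<in> {c..d}"
    and \<phi>: "continuous_on {c..d} \<phi>"
    and \<Phi>: "\<And>s. s \<in> {c..d} \<Longrightarrow> (\<Phi> has_real_derivative \<phi> s) (at s within {c..d})"
  shows "\<Phi> (\<psi> b) - \<Phi> (\<psi> a) = integral {a..b} (\<lambda>t. \<phi> (\<psi> t) * p t)"
    and "(\<lambda>t. \<phi> (\<psi> t) * p t) absolutely_integrable_on {a..b}"
proof -
  have pi: "p integrable_on {a..b}" and api: "(\<lambda>t. \<bar>p t\<bar>) integrable_on {a..b}"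
    using p unfolding absolutely_integrable_on_def by auto
  have "continuous_on {a..b} (\<lambda>t. \<psi> a + integral {a..t} p)"
    by (intro continuous_intros indefinite_integral_continuous_1 pi)
  then have c\<psi>: "continuous_on {a..b} \<psi>"
    by (rule continuous_on_eq) (rule \<psi>[symmetric])
  have c\<phi>\<psi>: "continuous_on {a..b} (\<lambda>t. \<phi> (\<psi> t))"
    by (rule continuous_on_compose2[OF \<phi> c\<psi>]) (use range in auto)
  show abs: "(\<lambda>t. \<phi> (\<psi> t) * p t) absolutely_integrable_on {a..b}"
  proof (rule absolutely_integrable_bounded_measurable_product_real[OF _ _ _ p])
    show "(\<lambda>t. \<phi> (\<psi> t)) \<in> borel_measurable (lebesgue_on {a..b})"
      using c\<phi>\<psi> by (intro continuous_imp_measurable_on_sets_lebesgue) auto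
    show "bounded ((\<lambda>t. \<phi> (\<psi> t)) ` {a..b})"
      using compact_continuous_image[OF c\<phi>\<psi>] compact_imp_bounded by blast
  qed auto
  define E where "E x y = \<Phi> (\<psi> y) - \<Phi> (\<psi> x) - integral {x..y} (\<lambda>t. \<phi> (\<psi> t) * p t)" for x y
  have int: "(\<lambda>t. \<phi> (\<psi> t) * p t) integrable_on {x..y}" "p integrable_on {x..y}" "(\<lambda>t. \<bar>p t\<bar>) integrable_on {x..y}"
    if "a \<le> x" "y \<le> b" for x y
    using that abs unfolding absolutely_integrable_on_def
    by (auto intro!: integrable_on_subinterval[of _ "{a..b}"] pi api)
  have incr: "\<psi> y - \<psi> x = integral {x..y} p" if "a \<le> x" "x \<le> y" "y \<le> b" for x y
    using \<psi>[of x] \<psi>[of y] that Henstock_Kurzweil_Integration.integral_combine[of a x y p] int(2)[of a y] by auto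
  have small: "\<bar>E a b\<bar> \<le> 2 * e * integral {a..b} (\<lambda>t. \<bar>p t\<bar>)" if "e > 0" for e
  proof -
    define Q where "Q x y \<longleftrightarrow> (a \<le> x \<and> x \<le> y \<and> y \<le> b \<longrightarrow> \<bar>E x y\<bar> \<le> 2 * e * integral {x..y} (\<lambda>t. \<bar>p t\<bar>))" for x y
    have "Q a b"
      using \<open>a \<le> b\<close>
    proof (induction rule: Bolzano)
      case (trans x y z)
      show ?case unfolding Q_def
      proof
        assume xz: "a \<le> x \<and> x \<le> z \<and> z \<le> b"
        have "integral {x..z} (\<lambda>t. \<phi> (\<psi> t) * p t) = integral {x..y} (\<lambda>t. \<phi> (\<psi> t) * p t) + integral {y..z} (\<lambda>t. \<phi> (\<psi> t) * p t)"
          using xz trans by (intro Henstock_Kurzweil_Integration.integral_combine[symmetric] int) auto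
        moreover have "integral {x..z} (\<lambda>t. \<bar>p t\<bar>) = integral {x..y} (\<lambda>t. \<bar>p t\<bar>) + integral {y..z} (\<lambda>t. \<bar>p t\<bar>)"
          using xz trans by (intro Henstock_Kurzweil_Integration.integral_combine[symmetric] int) auto
        ultimately show "\<bar>E x z\<bar> \<le> 2 * e * integral {x..z} (\<lambda>t. \<bar>p t\<bar>)"
          using trans xz unfolding Q_def E_def by (simp add: distrib_left)
      qed
    next
      case (local x)
      obtain \<eta> where \<eta>: "\<eta> > 0" "\<And>s. s \<in> {c..d} \<Longrightarrow> \<bar>s - \<psi> x\<bar> < \<eta> \<Longrightarrow> \<bar>\<phi> s - \<phi> (\<psi> x)\<bar> < e"
        using \<phi>[unfolded continuous_on_iff, rule_format, of "\<psi> x" e] range[of x] local \<open>e > 0\<close>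
        by (auto simp: dist_real_def)
      obtain k where k: "k > 0" "\<And>t. t \<in> {a..b} \<Longrightarrow> \<bar>t - x\<bar> < k \<Longrightarrow> \<bar>\<psi> t - \<psi> x\<bar> < \<eta>"
        using c\<psi>[unfolded continuous_on_iff, rule_format, of x \<eta>] local \<open>\<eta> > 0\<close>
        by (auto simp: dist_real_def)
      show ?case
      proof (intro exI[of _ k] conjI allI impI)
        fix y z assume yz: "y \<le> x \<and> x \<le> z \<and> z - y < k"
        show "Q y z" unfolding Q_def
        proof
          assume yz': "a \<le> y \<and> y \<le> z \<and> z \<le> b"
          let ?c = "\<phi> (\<psi> x)"
          have near: "\<bar>\<psi> t - \<psi> x\<bar> < \<eta>" "\<bar>\<phi> (\<psi> t) - ?c\<bar> < e" if "t \<in> {y..z}" for t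
            using k(2)[of t] \<eta>(2)[of "\<psi> t"] range[of t] yz yz' that by auto
          define I where "I = {c..d} \<inter> {\<psi> x - \<eta><..<\<psi> x + \<eta>}"
          have A: "norm ((\<lambda>s. \<Phi> s - ?c * s) (\<psi> z) - (\<lambda>s. \<Phi> s - ?c * s) (\<psi> y)) \<le> e * norm (\<psi> z - \<psi> y)"
          proof (rule field_differentiable_bound[where S = I])
            show "convex I" unfolding I_def by (intro convex_Int) auto
            show "((\<lambda>s. \<Phi> s - ?c * s) has_field_derivative (\<phi> s - ?c)) (at s within I)" if "s \<in> I" for s
            proof -
              have "(\<Phi> has_field_derivative \<phi> s) (at s within I)"
                using that by (intro DERIV_subset[OF \<Phi>]) (auto simp: I_def)
              then show ?thesis by (auto intro!: derivative_eq_intros)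
            qed
            show "norm (\<phi> s - ?c) \<le> e" if "s \<in> I" for s
              using \<eta>(2)[of s] that by (auto simp: I_def abs_less_iff)
            show "\<psi> z \<in> I" "\<psi> y \<in> I"
              using near(1)[of z] near(1)[of y] range[of z] range[of y] yz yz' by (auto simp: I_def abs_less_iff)
          qed
          have A': "norm (integral {y..z} p) \<le> integral {y..z} (\<lambda>t. \<bar>p t\<bar>)"
            using yz' by (intro integral_norm_bound_integral int) auto
          have "\<Phi> (\<psi> z) - \<Phi> (\<psi> y) - ?c * (\<psi> z - \<psi> y)
              = (\<lambda>s. \<Phi> s - ?c * s) (\<psi> z) - (\<lambda>s. \<Phi> s - ?c * s) (\<psi> y)"
            by (simp add: algebra_simps)
          then have "\<bar>\<Phi> (\<psi> z) - \<Phi> (\<psi> y) - ?c * (\<psi> z - \<psi> y)\<bar> \<le> e * norm (\<psi> z - \<psi> y)"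
            using A by (metis real_norm_def)
          also have "\<dots> \<le> e * integral {y..z} (\<lambda>t. \<bar>p t\<bar>)"
            using A' incr[of y z] yz' \<open>e > 0\<close> by (intro mult_left_mono) auto
          finally have 1: "\<bar>\<Phi> (\<psi> z) - \<Phi> (\<psi> y) - ?c * (\<psi> z - \<psi> y)\<bar> \<le> e * integral {y..z} (\<lambda>t. \<bar>p t\<bar>)" .
          have "norm (integral {y..z} (\<lambda>t. \<phi> (\<psi> t) * p t - ?c * p t)) \<le> integral {y..z} (\<lambda>t. e * \<bar>p t\<bar>)"
          proof (rule integral_norm_bound_integral)
            show "norm (\<phi> (\<psi> t) * p t - ?c * p t) \<le> e * \<bar>p t\<bar>" if "t \<in> {y..z}" for t
              using near(2)[OF that] by (auto simp: abs_mult left_diff_distrib[symmetric] intro!: mult_right_mono)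
            show "(\<lambda>t. \<phi> (\<psi> t) * p t - ?c * p t) integrable_on {y..z}"
              using yz' by (intro integrable_diff integrable_on_mult_right int) auto
            show "(\<lambda>t. e * \<bar>p t\<bar>) integrable_on {y..z}"
              using yz' by (intro integrable_on_mult_right int) auto
          qed
          moreover have "integral {y..z} (\<lambda>t. \<phi> (\<psi> t) * p t - ?c * p t)
              = integral {y..z} (\<lambda>t. \<phi> (\<psi> t) * p t) - ?c * integral {y..z} p"
            using int[of y z] yz' by (subst integral_diff) (auto intro: integrable_on_mult_right)
          ultimately have 2: "\<bar>integral {y..z} (\<lambda>t. \<phi> (\<psi> t) * p t) - ?c * (\<psi> z - \<psi> y)\<bar> \<le> e * integral {y..z} (\<lambda>t. \<bar>p t\<bar>)"
            using incr[of y z] yz' by simp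
          show "\<bar>E y z\<bar> \<le> 2 * e * integral {y..z} (\<lambda>t. \<bar>p t\<bar>)"
            using 1 2 unfolding E_def by linarith
        qed
      qed fact
    qed
    then show ?thesis using \<open>a \<le> b\<close> by (simp add: Q_def)
  qed
  have "\<bar>E a b\<bar> \<le> 0"
  proof (rule field_le_epsilon)
    fix e :: real assume "e > 0"
    define J where "J = integral {a..b} (\<lambda>t. \<bar>p t\<bar>)"
    have "J \<ge> 0" unfolding J_def by (intro integral_nonneg api) auto
    have "\<bar>E a b\<bar> \<le> 2 * (e / (2 * (J + 1))) * J"
      using small[of "e / (2 * (J + 1))"] \<open>e > 0\<close> \<open>J \<ge> 0\<close> by (simp add: J_def)
    also have "\<dots> \<le> 0 + e" using \<open>e > 0\<close> \<open>J \<ge> 0\<close> by (simp add: field_simps)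
    finally show "\<bar>E a b\<bar> \<le> 0 + e" .
  qed
  then show "\<Phi> (\<psi> b) - \<Phi> (\<psi> a) = integral {a..b} (\<lambda>t. \<phi> (\<psi> t) * p t)"
    by (simp add: E_def)
qed

text \<open>
  The outer derivative need not be continuous: a bounded pointwise limit of continuous functions is
  enough, by dominated convergence on both sides.
\<close>

lemma chain_rule_limit_of_continuous:
  fixes \<psi> p g :: "real \<Rightarrow> real" and \<phi> :: "nat \<Rightarrow> real \<Rightarrow> real"
  assumes "a \<le> b" and p: "p absolutely_integrable_on {a..b}"
    and \<psi>: "\<And>t. t \<in> {a..b} \<Longrightarrow> \<psi> t = \<psi> a + integral {a..t} p"
    and range: "\<And>t. t \<in> {a..b} \<Longrightarrow> \<psi> t \<in> {c..d}"
    and \<phi>: "\<And>k. continuous_on {c..d} (\<phi> k)"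
    and bound: "\<And>k s. s \<in> {c..d} \<Longrightarrow> \<bar>\<phi> k s\<bar> \<le> B"
    and lim: "\<And>s. s \<in> {c..d} \<Longrightarrow> (\<lambda>k. \<phi> k s) \<longlonglongrightarrow> g s"
  shows "integral {c..\<psi> b} g - integral {c..\<psi> a} g = integral {a..b} (\<lambda>t. g (\<psi> t) * p t)"
    and "(\<lambda>t. g (\<psi> t) * p t) integrable_on {a..b}"
proof -
  define \<Phi> where "\<Phi> k x = integral {c..x} (\<phi> k)" for k x
  have \<Phi>: "(\<Phi> k has_real_derivative \<phi> k s) (at s within {c..d})" if "s \<in> {c..d}" for k s
    unfolding \<Phi>_def using integral_has_real_derivative[OF \<phi> that] .
  have chain: "\<Phi> k (\<psi> b) - \<Phi> k (\<psi> a) = integral {a..b} (\<lambda>t. \<phi> k (\<psi> t) * p t)"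
      "(\<lambda>t. \<phi> k (\<psi> t) * p t) absolutely_integrable_on {a..b}" for k
    by (rule chain_rule_indefinite_integral[OF assms(1-4) \<phi> \<Phi>]; assumption)+
  have "(\<lambda>t. \<phi> k (\<psi> t) * p t) integrable_on {a..b}" for k
    using chain(2) unfolding absolutely_integrable_on_def by auto
  moreover have "(\<lambda>t. B * \<bar>p t\<bar>) integrable_on {a..b}"
    using p unfolding absolutely_integrable_on_def by (auto intro!: integrable_on_mult_right)
  moreover have "norm (\<phi> k (\<psi> t) * p t) \<le> B * \<bar>p t\<bar>" if "t \<in> {a..b}" for k t
    using bound[OF range[OF that]] by (auto simp: abs_mult intro!: mult_right_mono)
  moreover have "(\<lambda>k. \<phi> k (\<psi> t) * p t) \<longlonglongrightarrow> g (\<psi> t) * p t" if "t \<in> {a..b}" for t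
    by (intro tendsto_intros lim range that)
  ultimately have R0: "(\<lambda>t. g (\<psi> t) * p t) integrable_on {a..b}"
    and R: "(\<lambda>k. integral {a..b} (\<lambda>t. \<phi> k (\<psi> t) * p t)) \<longlonglongrightarrow> integral {a..b} (\<lambda>t. g (\<psi> t) * p t)"
    using dominated_convergence[of "\<lambda>k t. \<phi> k (\<psi> t) * p t" "{a..b}" "\<lambda>t. B * \<bar>p t\<bar>" "\<lambda>t. g (\<psi> t) * p t"]
    by blast+
  show "(\<lambda>t. g (\<psi> t) * p t) integrable_on {a..b}" by (rule R0)
  have L: "(\<lambda>k. \<Phi> k x) \<longlonglongrightarrow> integral {c..x} g" if "x \<in> {c..d}" for x
    unfolding \<Phi>_def
  proof (rule dominated_convergence(2)[where h = "\<lambda>_. B"])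
    show "\<phi> k integrable_on {c..x}" for k
      using that by (intro integrable_continuous_real continuous_on_subset[OF \<phi>]) auto
  qed (use that bound lim in auto)
  have "(\<lambda>k. \<Phi> k (\<psi> b) - \<Phi> k (\<psi> a)) \<longlonglongrightarrow> integral {c..\<psi> b} g - integral {c..\<psi> a} g"
    using \<open>a \<le> b\<close> by (intro tendsto_diff L range) auto
  then show "integral {c..\<psi> b} g - integral {c..\<psi> a} g = integral {a..b} (\<lambda>t. g (\<psi> t) * p t)"
    using R unfolding chain(1) by (rule LIMSEQ_unique)
qed

section \<open>The structure functions\<close>

text \<open>
  The derivative of \<open>G\<close>.  With the value \<open>0\<close> at the origin, \<open>sqrt_deriv F (u z) * norm (Du z)\<close> is
  \<open>|\<nabla>G(u)|\<close> with the convention that this vanishes where \<open>u = 0\<close>.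
\<close>

definition sqrt_deriv :: "(real \<Rightarrow> real) \<Rightarrow> real \<Rightarrow> real"
  where "sqrt_deriv F s = (if 0 < s then sqrt (deriv F s) else 0)"

lemma sqrt_deriv_nonpos [simp]: "s \<le> 0 \<Longrightarrow> sqrt_deriv F s = 0"
  by (simp add: sqrt_deriv_def)

context
  fixes P h H F G :: "real \<Rightarrow> real"
  assumes sf: "structure_functions P h H F G"
begin

lemma F_deriv: "0 < s \<Longrightarrow> (F has_real_derivative deriv F s) (at s)"
  using sf unfolding structure_functions_def by (simp add: DERIV_deriv_iff_real_differentiable)

lemma F_deriv_pos: "0 < s \<Longrightarrow> 0 < deriv F s"
  using sf unfolding structure_functions_def by simp

lemma F_continuous: "continuous_on {0..} F"
  using sf unfolding structure_functions_def by simp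

lemma F_0 [simp]: "F 0 = 0"
  using sf unfolding structure_functions_def by simp

lemma sqrt_deriv_nonneg: "0 \<le> sqrt_deriv F s"
  using F_deriv_pos[of s] by (auto simp: sqrt_deriv_def intro: less_imp_le)

lemma sqrt_deriv_squared: "0 < s \<Longrightarrow> (sqrt_deriv F s)\<^sup>2 = deriv F s"
  using F_deriv_pos[of s] by (simp add: sqrt_deriv_def)

lemma F_strict_mono: 
  assumes "0 \<le> a" "a < b"
  shows "F a < F b"
proof (rule DERIV_pos_imp_increasing_open[OF \<open>a < b\<close>])
  show "\<exists>y. DERIV F x :> y \<and> 0 < y" if "a < x" "x < b" for x
    using F_deriv[of x] F_deriv_pos[of x] that assms by auto
  show "continuous_on {a..b} F"
    using assms by (intro continuous_on_subset[OF F_continuous]) auto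
qed

lemma F_mono: "0 \<le> a \<Longrightarrow> a \<le> b \<Longrightarrow> F a \<le> F b"
  using F_strict_mono[of a b] by (cases "a = b") auto

lemma F_nonneg: "0 \<le> s \<Longrightarrow> 0 \<le> F s"
  using F_mono[of 0 s] by simp

text \<open>
  Continuous approximations of \<open>G'\<close>, built from the difference quotients of \<open>F\<close> with step
  \<open>1 / Suc k\<close>; they replace the possibly discontinuous derivative of \<open>F\<close>.
\<close>

definition quotient_root :: "nat \<Rightarrow> real \<Rightarrow> real"
  where "quotient_root k s = sqrt (real (Suc k) * (F (max 0 s + 1 / real (Suc k)) - F (max 0 s)))"

lemma quotient_root_continuous: "continuous_on S (quotient_root k)"
  unfolding quotient_root_def
  by (intro continuous_intros continuous_on_compose2[OF F_continuous]) (auto intro!: add_nonneg_nonneg)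

lemma quotient_root_tendsto:
  assumes "0 < s"
  shows "(\<lambda>k. quotient_root k s) \<longlonglongrightarrow> sqrt_deriv F s"
proof -
  have "((\<lambda>e. (F (s + e) - F s) / e) \<longlongrightarrow> deriv F s) (at 0)"
    using F_deriv[OF assms] by (simp add: DERIV_def)
  moreover have "filterlim (\<lambda>k. 1 / real (Suc k)) (at 0) sequentially"
    using LIMSEQ_Suc[OF lim_1_over_n] by (auto simp: filterlim_at)
  ultimately have "(\<lambda>k. (F (s + 1 / real (Suc k)) - F s) / (1 / real (Suc k))) \<longlonglongrightarrow> deriv F s"
    by (rule filterlim_compose)
  then have "(\<lambda>k. real (Suc k) * (F (s + 1 / real (Suc k)) - F s)) \<longlonglongrightarrow> deriv F s"
    by (simp add: mult.commute del: of_nat_Suc)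
  then have "(\<lambda>k. sqrt (real (Suc k) * (F (s + 1 / real (Suc k)) - F s))) \<longlonglongrightarrow> sqrt (deriv F s)"
    by (rule tendsto_real_sqrt)
  then show ?thesis using assms by (simp add: quotient_root_def sqrt_deriv_def)
qed

text \<open>
  By the mean value theorem a difference quotient is a value of \<open>F'\<close> at a nearby point, and \<open>F'\<close> is
  bounded on compact subsets of the open half-line.
\<close>

lemma quotient_root_bounded:
  assumes "0 < a"
  shows "\<exists>B. \<forall>k. \<forall>s\<in>{a..b}. \<bar>quotient_root k s\<bar> \<le> B"
proof -
  have "compact {a..b + 1}" "{a..b + 1} \<subseteq> {0<..}" using assms by auto
  then have "bounded (deriv F ` {a..b + 1})"
    using sf unfolding structure_functions_def by metis
  then obtain B where B: "\<And>s. s \<in> {a..b + 1} \<Longrightarrow> \<bar>deriv F s\<bar> \<le> B"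
    unfolding bounded_iff by (metis imageI real_norm_def)
  have "\<bar>quotient_root k s\<bar> \<le> sqrt B" if s: "s \<in> {a..b}" for k s
  proof -
    define e where "e = 1 / real (Suc k)"
    have e: "0 < e" "e \<le> 1" by (auto simp: e_def)
    have "\<exists>z. s < z \<and> z < s + e \<and> F (s + e) - F s = (s + e - s) * deriv F z"
      using e s assms by (intro MVT2) (auto intro!: F_deriv)
    then obtain z where z: "s < z" "z < s + e" "F (s + e) - F s = e * deriv F z" by auto
    then have "F (s + e) - F s \<le> e * B"
      using B[of z] s e by auto
    then have "real (Suc k) * (F (s + e) - F s) \<le> B"
      unfolding e_def by (simp add: field_simps)
    moreover have "0 \<le> real (Suc k) * (F (s + e) - F s)"
      using F_mono[of s "s + e"] s e assms by simp
    ultimately show ?thesis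
      using s assms by (simp add: quotient_root_def e_def del: of_nat_Suc)
  qed
  then show ?thesis by blast
qed

lemma sqrt_deriv_measurable [measurable]: "sqrt_deriv F \<in> borel_measurable borel"
proof (rule borel_measurable_LIMSEQ_real)
  show "(\<lambda>k. indicator {0<..} s * quotient_root k s) \<longlonglongrightarrow> sqrt_deriv F s" for s
    using quotient_root_tendsto[of s] by (cases "0 < s") auto
  have [measurable]: "quotient_root k \<in> borel_measurable borel" for k
    by (rule borel_measurable_continuous_onI[OF quotient_root_continuous])
  show "(\<lambda>s. indicator {0<..} s * quotient_root k s) \<in> borel_measurable borel" for k
    by measurable
qed

lemma nn_integral_deriv_F_Icc:
  assumes "0 < a" "a \<le> b"
  shows "(\<integral>\<^sup>+s\<in>{a..b}. ennreal ((sqrt_deriv F s)\<^sup>2) \<partial>lborel) = ennreal (F b - F a)"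
  using assms by (intro nn_integral_FTC_Icc) (auto simp: sqrt_deriv_squared intro!: F_deriv less_imp_le[OF F_deriv_pos])

text \<open>
  The left end point may be \<open>0\<close>, where \<open>F'\<close> may be unbounded; the interval is exhausted from inside.
\<close>

lemma nn_integral_deriv_F:
  assumes "0 \<le> a" "a \<le> b"
  shows "(\<integral>\<^sup>+s\<in>{a<..b}. ennreal ((sqrt_deriv F s)\<^sup>2) \<partial>lborel) \<le> ennreal (F b - F a)"
proof -
  define \<mu> where "\<mu> = density lborel (\<lambda>s. ennreal ((sqrt_deriv F s)\<^sup>2))"
  \<comment> \<open>closed intervals away from \<open>a\<close>, on which the fundamental theorem of calculus applies\<close>
  define A where "A n = {a + 1 / real (Suc n)..b}" for n
  have "(\<lambda>n. emeasure \<mu> (A n)) \<longlonglongrightarrow> emeasure \<mu> (\<Union>n. A n)"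
  proof (rule Lim_emeasure_incseq)
    show "range A \<subseteq> sets \<mu>" by (auto simp: A_def \<mu>_def)
    show "incseq A"
    proof (rule incseq_SucI)
      fix n
      have "1 / real (Suc (Suc n)) \<le> 1 / real (Suc n)" by (simp add: divide_simps)
      then show "A n \<subseteq> A (Suc n)" by (auto simp: A_def simp del: of_nat_Suc)
    qed
  qed
  moreover have "(\<Union>n. A n) = {a<..b}"
  proof (intro equalityI subsetI)
    fix s assume s: "s \<in> {a<..b}"
    then obtain n where "1 / real (Suc n) < s - a"
      using nat_approx_posE[of "s - a"] by auto
    then show "s \<in> (\<Union>n. A n)" using s by (auto simp: A_def intro!: exI[of _ n])
  next
    fix s assume "s \<in> (\<Union>n. A n)"
    then obtain n where "a + 1 / real (Suc n) \<le> s" "s \<le> b" by (auto simp: A_def)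
    moreover have "0 < 1 / real (Suc n)" by simp
    ultimately have "a < s" "s \<le> b" by linarith+
    then show "s \<in> {a<..b}" by simp
  qed
  moreover have "emeasure \<mu> (A n) \<le> ennreal (F b - F a)" for n
  proof (cases "a + 1 / real (Suc n) \<le> b")
    case True
    have p: "0 < 1 / real (Suc n)" by simp
    have "emeasure \<mu> (A n) = ennreal (F b - F (a + 1 / real (Suc n)))"
      unfolding \<mu>_def A_def using True assms p
      by (subst emeasure_density) (auto simp del: of_nat_Suc intro!: nn_integral_deriv_F_Icc add_nonneg_pos)
    also have "\<dots> \<le> ennreal (F b - F a)"
      using F_mono[of a "a + 1 / real (Suc n)"] assms p by (intro ennreal_leI) (simp del: of_nat_Suc)
    finally show ?thesis .
  qed (simp add: A_def)
  ultimately have "emeasure \<mu> {a<..b} \<le> ennreal (F b - F a)"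
    by (metis LIMSEQ_le_const2)
  then show ?thesis by (simp add: \<mu>_def emeasure_density)
qed

lemma sqrt_deriv_integrable: "0 \<le> a \<Longrightarrow> set_integrable lborel {a<..b} (sqrt_deriv F)"
proof -
  assume a: "0 \<le> a"
  show ?thesis
  proof (cases "a \<le> b")
    case True
    have "(\<integral>\<^sup>+s. ennreal (norm (indicator {a<..b} s *\<^sub>R (sqrt_deriv F s)\<^sup>2)) \<partial>lborel) < \<infinity>"
      using nn_integral_deriv_F[OF a True]
      by (simp add: indicator_mult_ennreal mult.commute) (auto intro: le_less_trans)
    then have "integrable lborel (\<lambda>s. indicator {a<..b} s *\<^sub>R (sqrt_deriv F s)\<^sup>2)"
      by (intro integrableI_bounded) auto
    moreover have "integrable lborel (\<lambda>s. indicator {a<..b} s *\<^sub>R (1::real))"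
      using True by (intro integrable_scaleR_left integrable_real_indicator) auto
    ultimately have "integrable lborel (\<lambda>s. indicator {a<..b} s *\<^sub>R (1 + (sqrt_deriv F s)\<^sup>2))"
      unfolding scaleR_add_right by (rule Bochner_Integration.integrable_add[rotated])
    then show ?thesis unfolding set_integrable_def
    proof (rule Bochner_Integration.integrable_bound)
      have "x \<le> 1 + x\<^sup>2" if "0 \<le> x" for x :: real
        using that sum_squares_bound[of 1 x] by simp
      then show "AE s in lborel. norm (indicator {a<..b} s *\<^sub>R sqrt_deriv F s) \<le> norm (indicator {a<..b} s *\<^sub>R (1 + (sqrt_deriv F s)\<^sup>2))"
        using sqrt_deriv_nonneg by (auto simp: indicator_def)
    qed auto
  qed (simp add: set_integrable_def)
qed

lemma G_eq: "0 \<le> s \<Longrightarrow> G s = (LBINT r:{0<..s}. sqrt_deriv F r)"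
  using sf unfolding structure_functions_def
  by (auto simp: sqrt_deriv_def intro!: set_lebesgue_integral_cong)

lemma G_diff:
  assumes "0 \<le> a" "a \<le> b"
  shows "G b - G a = (LBINT r:{a<..b}. sqrt_deriv F r)"
proof -
  have eq: "{0<..b} = {0<..a} \<union> {a<..b}" using assms by auto
  have "G b = G a + (LBINT r:{a<..b}. sqrt_deriv F r)"
    using assms unfolding G_eq[OF assms(1)] G_eq[OF order_trans[OF assms]] eq
    by (intro set_integral_Un sqrt_deriv_integrable) auto
  then show ?thesis by simp
qed

lemma G_0 [simp]: "G 0 = 0"
  using G_eq[of 0] by (simp add: set_lebesgue_integral_def)

lemma G_diff_nonneg: "0 \<le> a \<Longrightarrow> a \<le> b \<Longrightarrow> 0 \<le> G b - G a"
  unfolding G_diff set_lebesgue_integral_def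
  by (intro Bochner_Integration.integral_nonneg) (auto simp: sqrt_deriv_nonneg indicator_def)

lemma G_mono: "0 \<le> a \<Longrightarrow> a \<le> b \<Longrightarrow> G a \<le> G b"
  using G_diff_nonneg[of a b] by simp

lemma G_nonneg: "0 \<le> s \<Longrightarrow> 0 \<le> G s"
  using G_mono[of 0 s] by simp

text \<open>
  Cauchy-Schwarz for \<open>G' = sqrt F'\<close>, in the form \<open>2 c G' \<le> c\<^sup>2 + F'\<close> with the optimal weight
  \<open>c\<^sup>2 = (F b - F a) / (b - a)\<close>.
\<close>

lemma G_diff_squared_le:
  assumes "0 \<le> a" "a \<le> b"
  shows "(G b - G a)\<^sup>2 \<le> (b - a) * (F b - F a)"
proof (cases "a = b")
  case False
  then have ab: "a < b" using assms by simp
  define d where "d = F b - F a"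
  have d: "d > 0" using F_strict_mono[OF assms(1) ab] by (simp add: d_def)
  define c where "c = sqrt (d / (b - a))"
  have c: "c > 0" "c\<^sup>2 = d / (b - a)" using d ab by (auto simp: c_def)
  let ?I = "indicator {a<..b} :: real \<Rightarrow> real"
  have sq: "(LBINT s:{a<..b}. (sqrt_deriv F s)\<^sup>2) \<le> d" and isq: "set_integrable lborel {a<..b} (\<lambda>s. (sqrt_deriv F s)\<^sup>2)"
  proof -
    have n: "(\<integral>\<^sup>+s. ennreal (?I s *\<^sub>R (sqrt_deriv F s)\<^sup>2) \<partial>lborel) \<le> ennreal d"
      using nn_integral_deriv_F[OF assms] unfolding d_def by (simp add: indicator_mult_ennreal mult.commute)
    show "set_integrable lborel {a<..b} (\<lambda>s. (sqrt_deriv F s)\<^sup>2)"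
      unfolding set_integrable_def using n
      by (intro integrableI_bounded) (auto intro: le_less_trans)
    show "(LBINT s:{a<..b}. (sqrt_deriv F s)\<^sup>2) \<le> d"
      unfolding set_lebesgue_integral_def
      using n d by (intro integral_real_bounded) auto
  qed
  have const: "set_integrable lborel {a<..b} (\<lambda>_. c\<^sup>2)"
    unfolding set_integrable_def using ab by (intro integrable_scaleR_left integrable_real_indicator) auto
  have "2 * c * (G b - G a) = (LBINT s:{a<..b}. 2 * c * sqrt_deriv F s)"
    using assms by (simp add: G_diff)
  also have "\<dots> \<le> (LBINT s:{a<..b}. c\<^sup>2 + (sqrt_deriv F s)\<^sup>2)"
  proof (rule set_integral_mono)
    show "set_integrable lborel {a<..b} (\<lambda>s. 2 * c * sqrt_deriv F s)"
      using sqrt_deriv_integrable[OF assms(1)] by (intro set_integrable_mult_right) auto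
    show "set_integrable lborel {a<..b} (\<lambda>s. c\<^sup>2 + (sqrt_deriv F s)\<^sup>2)"
      by (intro set_integral_add isq const)
    show "2 * c * sqrt_deriv F s \<le> c\<^sup>2 + (sqrt_deriv F s)\<^sup>2" for s
      by (simp add: sum_squares_bound)
  qed
  also have "\<dots> = (LBINT s:{a<..b}. c\<^sup>2) + (LBINT s:{a<..b}. (sqrt_deriv F s)\<^sup>2)"
    by (intro set_integral_add isq const)
  also have "\<dots> \<le> c\<^sup>2 * (b - a) + d"
    using sq ab by (simp add: set_integral_const mult.commute)
  also have "\<dots> = 2 * d" using c ab by simp
  finally have "c * (G b - G a) \<le> d" by simp
  then have "(c * (G b - G a))\<^sup>2 \<le> d\<^sup>2"
    using c G_diff_nonneg[OF assms] by (intro power_mono) auto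
  then have "d / (b - a) * (G b - G a)\<^sup>2 \<le> d\<^sup>2" by (simp only: power_mult_distrib c)
  then have "d * ((G b - G a)\<^sup>2 / (b - a)) \<le> d * d" by (simp add: power2_eq_square)
  then have "(G b - G a)\<^sup>2 / (b - a) \<le> d" using d by (simp only: mult_le_cancel_left_pos)
  then show ?thesis using ab by (simp add: pos_divide_le_eq d_def mult.commute)
qed simp

lemma G_continuous: "continuous_on {0..} G"
proof -
  have "(G \<longlongrightarrow> G s) (at s within {0..})" if s: "0 \<le> s" for s
  proof -
    have F: "(F \<longlongrightarrow> F s) (at s within {0..})"
      using F_continuous s by (auto simp: continuous_on_def)
    have "((\<lambda>x. sqrt \<bar>(x - s) * (F x - F s)\<bar>) \<longlongrightarrow> sqrt \<bar>(s - s) * (F s - F s)\<bar>) (at s within {0..})"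
      by (intro tendsto_intros F)
    then have lim: "((\<lambda>x. sqrt \<bar>(x - s) * (F x - F s)\<bar>) \<longlongrightarrow> 0) (at s within {0..})" by simp
    have "((\<lambda>x. G x - G s) \<longlongrightarrow> 0) (at s within {0..})"
    proof (rule Lim_null_comparison[OF _ lim])
      have "\<bar>G x - G s\<bar> \<le> sqrt \<bar>(x - s) * (F x - F s)\<bar>" if "0 \<le> x" for x
      proof (rule real_le_rsqrt)
        show "\<bar>G x - G s\<bar>\<^sup>2 \<le> \<bar>(x - s) * (F x - F s)\<bar>"
        proof (cases "x \<le> s")
          case True
          have "(G s - G x)\<^sup>2 \<le> (s - x) * (F s - F x)" by (rule G_diff_squared_le[OF that True])
          then show ?thesis by (simp add: power2_commute algebra_simps)
        next
          case False
          then have "(G x - G s)\<^sup>2 \<le> (x - s) * (F x - F s)" using s by (intro G_diff_squared_le) auto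
          then show ?thesis by simp
        qed
      qed
      then show "\<forall>\<^sub>F x in at s within {0..}. norm (G x - G s) \<le> sqrt \<bar>(x - s) * (F x - F s)\<bar>"
        by (auto simp: eventually_at_filter)
    qed
    then show ?thesis by (simp add: LIM_zero_iff)
  qed
  then show ?thesis by (auto simp: continuous_on_def)
qed

text \<open>
  The link with hypothesis (ii), which bounds a power of \<open>sqrt (s F(s))\<close> by \<open>H\<close>.
\<close>

lemma G_le_sqrt: "0 \<le> s \<Longrightarrow> G s \<le> sqrt (s * F s)"
  using G_diff_squared_le[of 0 s] by (intro real_le_rsqrt) auto

lemma G_pos:
  assumes "0 < s"
  shows "0 < G s"
proof (rule ccontr)
  assume "\<not> 0 < G s"
  then have "(LBINT r:{0<..s}. sqrt_deriv F r) = 0"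
    using G_eq[of s] G_nonneg[of s] assms by simp
  then have "AE r in lborel. indicator {0<..s} r *\<^sub>R sqrt_deriv F r = 0"
    unfolding set_lebesgue_integral_def
    using sqrt_deriv_integrable[of 0 s]
    by (subst (asm) integral_nonneg_eq_0_iff_AE) (auto simp: set_integrable_def sqrt_deriv_nonneg indicator_def)
  then have "AE r in lborel. r \<notin> {0<..s}"
  proof eventually_elim
    case (elim r)
    then show ?case using sqrt_deriv_squared[of r] F_deriv_pos[of r] by (auto simp: indicator_def)
  qed
  then have "emeasure lborel {0<..s} = 0"
    by (subst (asm) AE_iff_measurable[of "{0<..s}"]) auto
  then show False using assms by simp
qed

lemma G_max_measurable [measurable]: "(\<lambda>s. G (max 0 s)) \<in> borel_measurable borel"
  by (intro borel_measurable_continuous_onI continuous_on_compose2[OF G_continuous]) (auto intro!: continuous_intros)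

lemma F_max_measurable [measurable]: "(\<lambda>s. F (max 0 s)) \<in> borel_measurable borel"
  by (intro borel_measurable_continuous_onI continuous_on_compose2[OF F_continuous]) (auto intro!: continuous_intros)

lemma h_integrable: "set_integrable lborel {0<..s} h"
proof -
  obtain \<delta> where \<delta>: "\<delta> > 0" "set_integrable lborel {0<..<\<delta>} h"
    using sf unfolding structure_functions_def by auto
  have "continuous_on {\<delta> / 2..s} h"
    using sf \<delta> unfolding structure_functions_def by (auto elim!: continuous_on_subset)
  then have "set_integrable lborel {\<delta> / 2..s} h" by (rule borel_integrable_atLeastAtMost')
  then have "set_integrable lborel ({0<..<\<delta>} \<union> {\<delta> / 2..s}) h"
    using \<delta> by (intro set_integrable_Un) auto
  then show ?thesis by (rule set_integrable_subset) (use \<delta> in auto)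
qed

lemma H_eq: "0 \<le> s \<Longrightarrow> H s = (LBINT r:{0<..s}. h r)"
  using sf unfolding structure_functions_def by auto

lemma H_mono:
  assumes "0 \<le> a" "a \<le> b"
  shows "H a \<le> H b"
proof -
  have "h r > 0" if "r > 0" for r using sf that unfolding structure_functions_def by auto
  then show ?thesis
    unfolding H_eq[OF assms(1)] H_eq[OF order_trans[OF assms]] set_lebesgue_integral_def
    using assms h_integrable unfolding set_integrable_def
    by (intro Bochner_Integration.integral_mono) (auto simp: indicator_def intro: less_imp_le)
qed

lemma H_nonneg: "0 \<le> s \<Longrightarrow> 0 \<le> H s"
  using H_mono[of 0 s] H_eq[of 0] by (simp add: set_lebesgue_integral_def)

lemma H_max_measurable [measurable]: "(\<lambda>s. H (max 0 s)) \<in> borel_measurable borel"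
  by (intro borel_measurable_mono monoI H_mono) auto

text \<open>
  The energy \<open>H(u)\<close> is small where \<open>u\<close> is small; this is what makes the initial energy vanish.
\<close>

lemma H_small:
  assumes "0 < e"
  shows "\<exists>d>0. H d \<le> e"
proof -
  have "(\<lambda>n. H (1 / real (Suc n))) \<longlonglongrightarrow> (LBINT r::real. (0::real))"
    unfolding H_eq[OF zero_le_divide_1_iff[THEN iffD2, OF of_nat_0_le_iff]] set_lebesgue_integral_def
  proof (rule integral_dominated_convergence[where w = "\<lambda>r. norm (indicator {0<..1} r *\<^sub>R h r)"])
    show "integrable lborel (\<lambda>r. norm (indicator {0<..1} r *\<^sub>R h r))"
      using h_integrable[of 1] unfolding set_integrable_def by (rule integrable_norm)
    show "(\<lambda>r. indicator {0<..1 / real (Suc n)} r *\<^sub>R h r) \<in> borel_measurable lborel" for n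
      using h_integrable[of "1 / real (Suc n)"] unfolding set_integrable_def by (rule borel_measurable_integrable)
    show "AE r in lborel. norm (indicator {0<..1 / real (Suc n)} r *\<^sub>R h r) \<le> norm (indicator {0<..1} r *\<^sub>R h r)" for n
    proof (rule AE_I2)
      fix r
      have "1 / real (Suc n) \<le> 1" by simp
      then have "indicator {0<..1 / real (Suc n)} r \<le> (indicator {0<..1} r :: real)"
        unfolding indicator_def by (smt (verit) greaterThanAtMost_iff of_bool_def)
      then show "norm (indicator {0<..1 / real (Suc n)} r *\<^sub>R h r) \<le> norm (indicator {0<..1} r *\<^sub>R h r)"
        by (auto simp: abs_mult intro!: mult_right_mono)
    qed
    show "AE r in lborel. (\<lambda>n. indicator {0<..1 / real (Suc n)} r *\<^sub>R h r) \<longlonglongrightarrow> 0"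
    proof (rule AE_I2)
      fix r :: real
      show "(\<lambda>n. indicator {0<..1 / real (Suc n)} r *\<^sub>R h r) \<longlonglongrightarrow> 0"
      proof (cases "0 < r")
        case True
        have "\<forall>\<^sub>F n in sequentially. 1 / real (Suc n) < r"
          using LIMSEQ_Suc[OF lim_1_over_n] True by (rule order_tendstoD)
        then have "\<forall>\<^sub>F n in sequentially. indicator {0<..1 / real (Suc n)} r *\<^sub>R h r = 0"
          by eventually_elim (auto simp: indicator_def)
        then show ?thesis by (rule tendsto_eventually)
      qed simp
    qed
  qed auto
  then have "\<forall>\<^sub>F n in sequentially. H (1 / real (Suc n)) < e"
    using assms by (intro order_tendstoD(2)) auto
  then obtain n where "H (1 / real (Suc n)) < e"
    by (auto simp: eventually_sequentially)
  then show ?thesis by (intro exI[of _ "1 / real (Suc n)"]) auto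
qed

lemma F_comp_measurable:
  assumes "U \<in> borel_measurable M" "\<And>z. 0 \<le> U z"
  shows "(\<lambda>z. F (U z)) \<in> borel_measurable M"
  using measurable_compose[OF assms(1) F_max_measurable] assms(2) by (simp add: max_absorb2)

lemma G_comp_measurable:
  assumes "U \<in> borel_measurable M" "\<And>z. 0 \<le> U z"
  shows "(\<lambda>z. G (U z)) \<in> borel_measurable M"
  using measurable_compose[OF assms(1) G_max_measurable] assms(2) by (simp add: max_absorb2)

lemma H_comp_measurable:
  assumes "U \<in> borel_measurable M" "\<And>z. 0 \<le> U z"
  shows "(\<lambda>z. H (U z)) \<in> borel_measurable M"
  using measurable_compose[OF assms(1) H_max_measurable] assms(2) by (simp add: max_absorb2)

end

section \<open>Increments of G along a path\<close>

context
  fixes P h H F G :: "real \<Rightarrow> real"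
  assumes sf: "structure_functions P h H F G"
begin

lemmas [measurable] = sqrt_deriv_measurable[OF sf]

lemma integral_sqrt_deriv:
  assumes "0 < c" "c \<le> x"
  shows "integral {c..x} (sqrt_deriv F) = G x - G c"
proof -
  have "G x - G c = (LBINT r:{c<..x}. sqrt_deriv F r)"
    by (rule G_diff[OF sf]) (use assms in auto)
  also have "\<dots> = integral {c<..x} (sqrt_deriv F)"
    by (rule set_borel_integral_eq_integral(2)[OF sqrt_deriv_integrable[OF sf]]) (use assms in auto)
  also have "\<dots> = integral {c..x} (sqrt_deriv F)"
    by (rule integral_spike_set; rule negligible_subset[of "{c}"]) auto
  finally show ?thesis by simp
qed

text \<open>
  Away from the level \<open>0\<close> the function \<open>G'\<close> is a bounded limit of its continuous approximations, so
  the chain rule applies.  Cauchy-Schwarz on a time interval of length at most one then gives the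
  estimate; it is used as \<open>2 X k \<le> X\<^sup>2 + k\<^sup>2\<close>, where \<open>X\<close> is the
  increment and \<open>k = G'(\<psi>) p\<close> its density.
\<close>

lemma G_increment_above:
  fixes \<psi> p :: "real \<Rightarrow> real"
  assumes p: "p absolutely_integrable_on {0..1}"
    and [measurable]: "p \<in> borel_measurable borel" "\<psi> \<in> borel_measurable borel"
    and \<psi>: "\<And>t. t \<in> {0..1} \<Longrightarrow> \<psi> t = \<psi> 0 + integral {0..t} p"
    and "0 < c" and ab: "0 \<le> \<alpha>" "\<alpha> \<le> \<beta>" "\<beta> \<le> 1"
    and above: "\<And>t. t \<in> {\<alpha>..\<beta>} \<Longrightarrow> c \<le> \<psi> t"
  shows "ennreal ((G (\<psi> \<beta>) - G (\<psi> \<alpha>))\<^sup>2) \<le> (\<integral>\<^sup>+t\<in>{0..1}. ennreal ((sqrt_deriv F (\<psi> t) * p t)\<^sup>2) \<partial>lborel)"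
    (is "_ \<le> ?J")
proof (cases "?J = \<infinity>")
  case False
  define k where "k t = sqrt_deriv F (\<psi> t) * p t" for t
  have [measurable]: "k \<in> borel_measurable borel" unfolding k_def by measurable
  have pi: "p integrable_on {0..1}" using p unfolding absolutely_integrable_on_def by auto
  have "continuous_on {0..1} (\<lambda>t. \<psi> 0 + integral {0..t} p)"
    by (intro continuous_intros indefinite_integral_continuous_1 pi)
  then have c\<psi>: "continuous_on {0..1} \<psi>"
    by (rule continuous_on_eq) (rule \<psi>[symmetric])
  then have "bounded (\<psi> ` {0..1})"
    by (intro compact_imp_bounded compact_continuous_image) auto
  then obtain d where d: "\<And>t. t \<in> {0..1} \<Longrightarrow> \<bar>\<psi> t\<bar> \<le> d"
    unfolding bounded_iff by (metis imageI real_norm_def)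
  obtain B where B: "\<And>k s. s \<in> {c..d} \<Longrightarrow> \<bar>quotient_root F k s\<bar> \<le> B"
    using quotient_root_bounded[OF sf \<open>0 < c\<close>, of d] by blast
  have range: "\<psi> t \<in> {c..d}" if "t \<in> {\<alpha>..\<beta>}" for t
    using above[OF that] d[of t] that ab by (auto simp: abs_le_iff)
  have p': "p absolutely_integrable_on {\<alpha>..\<beta>}"
    by (rule absolutely_integrable_on_subinterval[OF p]) (use ab in auto)
  have \<psi>': "\<psi> t = \<psi> \<alpha> + integral {\<alpha>..t} p" if "t \<in> {\<alpha>..\<beta>}" for t
  proof -
    have t: "t \<in> {0..1}" "\<alpha> \<in> {0..1}" "\<alpha> \<le> t" using that ab by auto
    have "integral {0..\<alpha>} p + integral {\<alpha>..t} p = integral {0..t} p"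
      using t by (intro Henstock_Kurzweil_Integration.integral_combine integrable_on_subinterval[OF pi]) auto
    then show ?thesis using \<psi>[OF t(1)] \<psi>[OF t(2)] by linarith
  qed
  have lim: "(\<lambda>k. quotient_root F k s) \<longlonglongrightarrow> sqrt_deriv F s" if "s \<in> {c..d}" for s
    using that \<open>0 < c\<close> by (intro quotient_root_tendsto[OF sf]) auto
  note chain = chain_rule_limit_of_continuous[OF \<open>\<alpha> \<le> \<beta>\<close> p' \<psi>' range quotient_root_continuous[OF sf] B lim, folded k_def]
  define X where "X = G (\<psi> \<beta>) - G (\<psi> \<alpha>)"
  have X: "X = integral {\<alpha>..\<beta>} k"
    using chain(1) integral_sqrt_deriv[OF \<open>0 < c\<close> above, of \<alpha>] integral_sqrt_deriv[OF \<open>0 < c\<close> above, of \<beta>] \<open>\<alpha> \<le> \<beta>\<close>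
    by (simp add: X_def)
  have J: "?J = (\<integral>\<^sup>+t. ennreal (indicator {0..1} t *\<^sub>R (k t)\<^sup>2) \<partial>lborel)"
    by (auto simp: k_def indicator_def intro!: nn_integral_cong)
  have k2: "set_integrable lborel {0..1} (\<lambda>t. (k t)\<^sup>2)"
    unfolding set_integrable_def using False unfolding J
    by (intro integrableI_bounded) (auto simp: less_top)
  note k2' = set_borel_integral_eq_integral[OF k2]
  have "?J = ennreal (integral {0..1} (\<lambda>t. (k t)\<^sup>2))"
    using k2 unfolding J k2'(2)[symmetric] set_lebesgue_integral_def set_integrable_def
    by (intro nn_integral_eq_integral) auto
  moreover have "X\<^sup>2 \<le> integral {0..1} (\<lambda>t. (k t)\<^sup>2)"
  proof -
    have k2'': "(\<lambda>t. (k t)\<^sup>2) integrable_on {\<alpha>..\<beta>}"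
      by (rule integrable_on_subinterval[OF k2'(1)]) (use ab in auto)
    have "2 * X * X = integral {\<alpha>..\<beta>} (\<lambda>t. 2 * X * k t)"
      by (simp add: X)
    also have "\<dots> \<le> integral {\<alpha>..\<beta>} (\<lambda>t. X\<^sup>2 + (k t)\<^sup>2)"
      using chain(2) k2'' by (intro integral_le integrable_on_mult_right integrable_add) (auto simp: sum_squares_bound)
    also have "\<dots> = X\<^sup>2 * (\<beta> - \<alpha>) + integral {\<alpha>..\<beta>} (\<lambda>t. (k t)\<^sup>2)"
      using k2'' \<open>\<alpha> \<le> \<beta>\<close> by (subst integral_add) auto
    also have "integral {\<alpha>..\<beta>} (\<lambda>t. (k t)\<^sup>2) \<le> integral {0..1} (\<lambda>t. (k t)\<^sup>2)"
      using ab by (intro integral_subset_le k2'(1) k2'') auto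
    also have "X\<^sup>2 * (\<beta> - \<alpha>) \<le> X\<^sup>2 * 1" using ab by (intro mult_left_mono) auto
    finally show ?thesis by (simp add: power2_eq_square)
  qed
  ultimately show ?thesis by (simp add: X_def[symmetric] ennreal_leI)
qed simp

text \<open>
  A path that touches the level \<open>0\<close> is cut at a level \<open>c\<close> between its end values: after the last
  (or before the first) visit of \<open>c\<close> it stays above \<open>c\<close>.  Only this part of the path is used, and it
  accounts for the whole increment as \<open>c\<close> tends to the smaller end value, \<open>G\<close> being continuous.
\<close>

lemma G_increment_along_path:
  fixes \<psi> p :: "real \<Rightarrow> real"
  assumes p: "p absolutely_integrable_on {0..1}"
    and meas: "p \<in> borel_measurable borel" "\<psi> \<in> borel_measurable borel"
    and \<psi>: "\<And>t. t \<in> {0..1} \<Longrightarrow> \<psi> t = \<psi> 0 + integral {0..t} p"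
    and nonneg: "\<And>t. t \<in> {0..1} \<Longrightarrow> 0 \<le> \<psi> t"
  shows "ennreal ((G (\<psi> 1) - G (\<psi> 0))\<^sup>2) \<le> (\<integral>\<^sup>+t\<in>{0..1}. ennreal ((sqrt_deriv F (\<psi> t) * p t)\<^sup>2) \<partial>lborel)"
    (is "_ \<le> ?J")
proof (cases "\<psi> 0 = \<psi> 1")
  case False
  define m M where "m = min (\<psi> 0) (\<psi> 1)" and "M = max (\<psi> 0) (\<psi> 1)"
  have m: "0 \<le> m" "m < M" using nonneg[of 0] nonneg[of 1] False by (auto simp: m_def M_def)
  have pi: "p integrable_on {0..1}" using p unfolding absolutely_integrable_on_def by auto
  have "continuous_on {0..1} (\<lambda>t. \<psi> 0 + integral {0..t} p)"
    by (intro continuous_intros indefinite_integral_continuous_1 pi)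
  then have c\<psi>: "continuous_on {0..1} \<psi>"
    by (rule continuous_on_eq) (rule \<psi>[symmetric])
  note above = G_increment_above[OF p meas \<psi>]
  have main: "ennreal ((G M - G c)\<^sup>2) \<le> ?J" if c: "m < c" "c < M" for c
  proof -
    define S where "S = {t\<in>{0..1}. \<psi> t \<le> c}"
    have "closed S" unfolding S_def
      by (intro continuous_closed_preimage_constant continuous_on_closed_Collect_le c\<psi>) (auto intro!: continuous_intros)
    moreover have "S \<subseteq> {0..1}" by (auto simp: S_def)
    ultimately have "compact S" by (meson bounded_closed_interval bounded_subset compact_eq_bounded_closed)
    have "0 \<in> S \<or> 1 \<in> S" using c by (auto simp: S_def m_def min_def split: if_splits)
    then have "S \<noteq> {}" by blast
    have c0: "0 < c" using c m by simp
    show ?thesis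
    proof (cases "\<psi> 0 < \<psi> 1")
      case True
      obtain \<alpha> where \<alpha>: "\<alpha> \<in> S" "\<And>t. t \<in> S \<Longrightarrow> t \<le> \<alpha>"
        using compact_attains_sup[OF \<open>compact S\<close> \<open>S \<noteq> {}\<close>] by blast
      then have a: "0 \<le> \<alpha>" "\<alpha> \<le> 1" "\<psi> \<alpha> \<le> c" by (auto simp: S_def)
      have "\<exists>t\<ge>\<alpha>. t \<le> 1 \<and> \<psi> t = c"
        using a c True by (intro IVT' continuous_on_subset[OF c\<psi>]) (auto simp: M_def)
      then obtain t where t: "\<alpha> \<le> t" "t \<le> 1" "\<psi> t = c" by blast
      then have "t = \<alpha>" using \<alpha>(2)[of t] a by (auto simp: S_def)
      moreover have "c \<le> \<psi> s" if "s \<in> {\<alpha>..1}" for s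
        using \<alpha>(2)[of s] that t \<open>t = \<alpha>\<close> a by (cases "s = \<alpha>"; cases "c \<le> \<psi> s") (auto simp: S_def)
      ultimately show ?thesis
        using above[of c \<alpha> 1] a c0 t True by (simp add: M_def)
    next
      case False
      obtain \<beta> where \<beta>: "\<beta> \<in> S" "\<And>t. t \<in> S \<Longrightarrow> \<beta> \<le> t"
        using compact_attains_inf[OF \<open>compact S\<close> \<open>S \<noteq> {}\<close>] by blast
      then have b: "0 \<le> \<beta>" "\<beta> \<le> 1" "\<psi> \<beta> \<le> c" by (auto simp: S_def)
      have "\<exists>t\<ge>0. t \<le> \<beta> \<and> \<psi> t = c"
        using b c False by (intro IVT2' continuous_on_subset[OF c\<psi>]) (auto simp: M_def)
      then obtain t where t: "0 \<le> t" "t \<le> \<beta>" "\<psi> t = c" by blast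
      then have "t = \<beta>" using \<beta>(2)[of t] b by (auto simp: S_def)
      moreover have "c \<le> \<psi> s" if "s \<in> {0..\<beta>}" for s
        using \<beta>(2)[of s] that t \<open>t = \<beta>\<close> b by (cases "s = \<beta>"; cases "c \<le> \<psi> s") (auto simp: S_def)
      ultimately show ?thesis
        using above[of c 0 \<beta>] b c0 t False by (simp add: M_def power2_commute max_absorb1)
    qed
  qed
  have G: "(G \<longlongrightarrow> G m) (at_right m)"
    using G_continuous[OF sf] m by (auto simp: continuous_on_def intro: tendsto_within_subset)
  have "((\<lambda>c. ennreal ((G M - G c)\<^sup>2)) \<longlongrightarrow> ennreal ((G M - G m)\<^sup>2)) (at_right m)"
    by (intro tendsto_intros G)
  then have "ennreal ((G M - G m)\<^sup>2) \<le> ?J"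
  proof (rule tendsto_upperbound)
    show "\<forall>\<^sub>F c in at_right m. ennreal ((G M - G c)\<^sup>2) \<le> ?J"
      using eventually_at_right_real[OF m(2)] by eventually_elim (auto intro: main)
  qed simp
  moreover have "(G M - G m)\<^sup>2 = (G (\<psi> 1) - G (\<psi> 0))\<^sup>2"
    by (auto simp: m_def M_def min_def max_def power2_commute)
  ultimately show ?thesis by simp
qed simp

text \<open>
  Since \<open>G\<close> is bounded on \<open>{0..M}\<close>, the exponent of hypothesis (ii) may be raised to at least one;
  then \<open>\<integral> G(u)\<close> can be estimated by a power of \<open>\<integral> H(u)\<close>.
\<close>

lemma G_powr_le_H:
  assumes lam: "0 < lam" "lam < 2" "0 < C" "\<And>s. s \<in> {0..M} \<Longrightarrow> sqrt (s * F s) powr lam \<le> C * H s"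
  obtains \<mu> K where "1 \<le> \<mu>" "\<mu> < 2" "0 < K" "\<And>s. s \<in> {0..M} \<Longrightarrow> G s powr \<mu> \<le> K * H s"
proof -
  define \<mu> where "\<mu> = max lam 1"
  define K where "K = (\<bar>G M\<bar> + 1) powr (\<mu> - lam) * C"
  have "G s powr \<mu> \<le> K * H s" if s: "s \<in> {0..M}" for s
  proof -
    have G: "0 \<le> G s" "G s \<le> G M" using s G_nonneg[OF sf] G_mono[OF sf] by auto
    have "G s powr \<mu> = G s powr (\<mu> - lam) * G s powr lam"
      by (simp flip: powr_add)
    also have "\<dots> \<le> (\<bar>G M\<bar> + 1) powr (\<mu> - lam) * sqrt (s * F s) powr lam"
      using G G_le_sqrt[OF sf, of s] s lam by (intro mult_mono powr_mono2) (auto simp: \<mu>_def)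
    also have "\<dots> \<le> (\<bar>G M\<bar> + 1) powr (\<mu> - lam) * (C * H s)"
      using lam(4)[OF s] by (intro mult_left_mono) auto
    finally show ?thesis by (simp add: K_def mult.assoc)
  qed
  moreover have "0 < K" using lam by (simp add: K_def)
  ultimately show ?thesis using that[of \<mu> K] lam by (auto simp: \<mu>_def)
qed

end

section \<open>Translations and a Nash inequality\<close>

lemma ball_measurable [measurable]: "ball c r \<in> sets borel"
  for c :: "'a::euclidean_space"
  by auto

lemma cylinder_measurable [measurable]: "ball c r \<times> {s<..<t} \<in> sets borel"
  for c :: "'a::euclidean_space" and s t :: real
  by (intro borel_open open_Times) auto

lemma AE_imp_ex_Ioo:
  fixes a b :: real
  assumes "AE t in lborel. Q t" "a < b"
  shows "\<exists>t\<in>{a<..<b}. Q t"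
proof (rule ccontr)
  assume "\<not> ?thesis"
  then have "AE t in lborel. t \<notin> {a<..<b}"
    using assms(1) by (auto elim!: eventually_mono)
  then have "emeasure lborel {a<..<b} = 0"
    by (subst (asm) AE_iff_measurable[of "{a<..<b}"]) auto
  then show False using assms(2) by simp
qed

lemma continuous_nonneg_if_AE_nonneg:
  fixes \<psi> :: "real \<Rightarrow> real"
  assumes cont: "continuous_on {0..1} \<psi>" and ae: "AE t in lborel. t \<in> {0..1} \<longrightarrow> 0 \<le> \<psi> t"
    and t: "t \<in> {0..1}"
  shows "0 \<le> \<psi> t"
proof (rule ccontr)
  assume "\<not> 0 \<le> \<psi> t"
  then obtain \<delta> where \<delta>: "\<delta> > 0" "\<And>s. s \<in> {0..1} \<Longrightarrow> \<bar>s - t\<bar> < \<delta> \<Longrightarrow> \<bar>\<psi> s - \<psi> t\<bar> < - \<psi> t"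
    using cont[unfolded continuous_on_iff, rule_format, OF t, of "- \<psi> t"] by (auto simp: dist_real_def)
  define a b where "a = max 0 (t - \<delta>)" and "b = min 1 (t + \<delta>)"
  define I where "I = {a<..<b}"
  have "AE s in lborel. s \<notin> I"
    using ae
  proof eventually_elim
    case (elim s)
    show ?case
    proof
      assume "s \<in> I"
      then have "s \<in> {0..1}" "\<bar>s - t\<bar> < \<delta>" by (auto simp: I_def a_def b_def)
      with \<delta>(2)[of s] elim show False by auto
    qed
  qed
  then have "emeasure lborel I = 0"
    by (subst (asm) AE_iff_measurable[of I]) (auto simp: I_def)
  moreover have "a < b" using t \<delta>(1) by (auto simp: a_def b_def)
  ultimately show False by (simp add: I_def)
qed

context
  fixes P h H F G :: "real \<Rightarrow> real"
  assumes sf: "structure_functions P h H F G"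
begin

lemmas [measurable] = sqrt_deriv_measurable[OF sf]

text \<open>
  For almost every \<open>z\<close> the identity of increments holds at almost all positions on the segment from \<open>z\<close>
  to \<open>z + e\<close> and at its end.  So along the segment \<open>U\<close> has a continuous version, an indefinite
  integral, to which the one-dimensional estimate applies.
\<close>

lemma AE_G_increment:
  fixes U d :: "'a::euclidean_space \<Rightarrow> real"
  assumes [measurable]: "U \<in> borel_measurable borel" and U: "\<And>z. 0 \<le> U z" "\<And>z. U z \<le> M"
    and d: "integrable lborel d"
    and weak: "\<And>\<eta>. C1_test_function V \<eta> \<Longrightarrow>
      (LBINT z. U z * frechet_derivative \<eta> (at z) e) = - (LBINT z. d z * \<eta> z)"
    and W: "open W" "bounded W" "\<And>z \<sigma>. z \<in> W \<Longrightarrow> \<sigma> \<in> {0..1} \<Longrightarrow> z + \<sigma> *\<^sub>R e \<in> V"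
  shows "AE z in lborel. z \<in> W \<longrightarrow> ennreal ((G (U (z + e)) - G (U z))\<^sup>2)
    \<le> (\<integral>\<^sup>+\<sigma>\<in>{0..1}. ennreal ((sqrt_deriv F (U (z + \<sigma> *\<^sub>R e)) * d (z + \<sigma> *\<^sub>R e))\<^sup>2) \<partial>lborel)"
proof -
  have [measurable]: "d \<in> borel_measurable borel" using d by auto
  have [measurable]: "W \<in> sets borel" using W by auto
  define k where "k t z = (LBINT \<sigma>. (if 0 \<le> \<sigma> \<and> \<sigma> \<le> t then d (z + \<sigma> *\<^sub>R e) else 0))" for t z
  have kI: "k t z = (LBINT \<sigma>. indicator {0..t} \<sigma> * d (z + \<sigma> *\<^sub>R e))" for t z
    unfolding k_def by (intro Bochner_Integration.integral_cong) auto
  have inc: "AE z in lborel. z \<in> W \<longrightarrow> U (z + t *\<^sub>R e) - U z = k t z" if t: "t \<in> {0..1}" for t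
    unfolding kI
    by (rule increment_eq_integral_of_weak_derivative[where M = M and V = V])
      (use U W(3) t in \<open>auto intro: weak d W(1,2) simp: abs_le_iff order_trans[of "- M" 0]\<close>)
  have [measurable]: "(\<lambda>x. k (fst x) (snd x)) \<in> borel_measurable (borel \<Otimes>\<^sub>M borel)"
    unfolding k_def by measurable
  have [measurable]: "(\<lambda>t. k t z) \<in> borel_measurable borel" for z
    unfolding k_def by measurable
  have "AE t in lborel. AE z in lborel. t \<in> {0..1} \<longrightarrow> z \<in> W \<longrightarrow> U (z + t *\<^sub>R e) - U z = k t z"
  proof (rule AE_I2)
    fix t
    show "AE z in lborel. t \<in> {0..1} \<longrightarrow> z \<in> W \<longrightarrow> U (z + t *\<^sub>R e) - U z = k t z"
      using inc[of t] by (cases "t \<in> {0..1}") auto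
  qed
  then have "AE z in lborel. AE t in lborel. t \<in> {0..1} \<longrightarrow> z \<in> W \<longrightarrow> U (z + t *\<^sub>R e) - U z = k t z"
  proof (rule lborel_pair.AE_commute[where P = "\<lambda>t z. t \<in> {0..1} \<longrightarrow> z \<in> W \<longrightarrow> U (z + t *\<^sub>R e) - U z = k t z", THEN iffD1, rotated])
    show "{x \<in> space (lborel \<Otimes>\<^sub>M lborel). fst x \<in> {0..1} \<longrightarrow> snd x \<in> W \<longrightarrow>
        U (snd x + fst x *\<^sub>R e) - U (snd x) = k (fst x) (snd x)} \<in> sets (lborel \<Otimes>\<^sub>M lborel)"
      by measurable
  qed
  moreover have "AE z in lborel. integrable lborel (\<lambda>\<sigma>. indicator {0..1} \<sigma> * d (z + \<sigma> *\<^sub>R e))"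
    using lborel_pair.AE_integrable_snd[OF pair_product_integrable_translate[OF d, of "\<lambda>_. 1" 1 1 e]] by simp
  moreover have "AE z in lborel. z \<in> W \<longrightarrow> U (z + 1 *\<^sub>R e) - U z = k 1 z"
    by (rule inc) simp
  ultimately show ?thesis
  proof eventually_elim
    case (elim z)
    show ?case
    proof
      assume z: "z \<in> W"
      define p where "p \<sigma> = indicator {0..1} \<sigma> * d (z + \<sigma> *\<^sub>R e)" for \<sigma>
      define \<psi> where "\<psi> t = U z + k t z" for t
      have [measurable]: "p \<in> borel_measurable borel" "\<psi> \<in> borel_measurable borel"
        unfolding p_def \<psi>_def by measurable
      have p: "set_integrable lborel {0..1} p"
        using elim(2) unfolding set_integrable_def p_def by (simp add: indicator_inter_arith[symmetric] flip: mult.assoc)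
      have p': "p absolutely_integrable_on {0..1}"
        using p unfolding set_integrable_def by (subst integrable_completion) auto
      have ki: "k t z = integral {0..t} p" if t: "t \<in> {0..1}" for t
      proof -
        have "k t z = (LBINT \<sigma>:{0..t}. p \<sigma>)"
          unfolding kI set_lebesgue_integral_def p_def using t
          by (intro Bochner_Integration.integral_cong) (auto simp: indicator_def)
        also have "\<dots> = integral {0..t} p"
          by (rule set_borel_integral_eq_integral(2)[OF set_integrable_subset[OF p]]) (use t in auto)
        finally show ?thesis .
      qed
      have k0: "k 0 z = 0" using ki[of 0] by simp
      have \<psi>0: "\<psi> 0 = U z" by (simp add: \<psi>_def k0)
      have \<psi>1: "\<psi> 1 = U (z + e)" using elim(3) z by (simp add: \<psi>_def)
      have \<psi>: "\<psi> t = \<psi> 0 + integral {0..t} p" if "t \<in> {0..1}" for t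
        using ki[OF that] by (simp add: \<psi>_def k0)
      have "continuous_on {0..1} (\<lambda>t. U z + integral {0..t} p)"
        using p' unfolding absolutely_integrable_on_def
        by (intro continuous_intros indefinite_integral_continuous_1) auto
      then have c\<psi>: "continuous_on {0..1} \<psi>"
        by (rule continuous_on_eq) (simp add: \<psi>_def ki)
      have ae: "AE t in lborel. t \<in> {0..1} \<longrightarrow> \<psi> t = U (z + t *\<^sub>R e)"
        using elim(1) by eventually_elim (use z in \<open>auto simp: \<psi>_def\<close>)
      then have "AE t in lborel. t \<in> {0..1} \<longrightarrow> 0 \<le> \<psi> t"
        by eventually_elim (use U in auto)
      note nonneg = continuous_nonneg_if_AE_nonneg[OF c\<psi> this]
      have "ennreal ((G (\<psi> 1) - G (\<psi> 0))\<^sup>2) \<le> (\<integral>\<^sup>+t\<in>{0..1}. ennreal ((sqrt_deriv F (\<psi> t) * p t)\<^sup>2) \<partial>lborel)"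
        by (rule G_increment_along_path[OF sf p' _ _ \<psi> nonneg]) auto
      also have "\<dots> = (\<integral>\<^sup>+\<sigma>\<in>{0..1}. ennreal ((sqrt_deriv F (U (z + \<sigma> *\<^sub>R e)) * d (z + \<sigma> *\<^sub>R e))\<^sup>2) \<partial>lborel)"
        by (rule nn_integral_cong_AE, use ae in eventually_elim) (auto simp: indicator_def p_def)
      finally show "ennreal ((G (U (z + e)) - G (U z))\<^sup>2)
          \<le> (\<integral>\<^sup>+\<sigma>\<in>{0..1}. ennreal ((sqrt_deriv F (U (z + \<sigma> *\<^sub>R e)) * d (z + \<sigma> *\<^sub>R e))\<^sup>2) \<partial>lborel)"
        unfolding \<psi>0 \<psi>1 .
    qed
  qed
qed

text \<open>
  The substitute for a weak gradient of \<open>G(U)\<close>: integrate the estimate on segments over \<open>W\<close> and use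
  that each translate of \<open>W\<close> along the segment stays in \<open>V\<close>.
\<close>

lemma G_translation_estimate:
  fixes U d N :: "'a::euclidean_space \<Rightarrow> real"
  assumes [measurable]: "U \<in> borel_measurable borel" and U: "\<And>z. 0 \<le> U z" "\<And>z. U z \<le> M"
    and d: "integrable lborel d"
    and weak: "\<And>\<eta>. C1_test_function V \<eta> \<Longrightarrow>
      (LBINT z. U z * frechet_derivative \<eta> (at z) e) = - (LBINT z. d z * \<eta> z)"
    and W: "open W" "bounded W" "\<And>z \<sigma>. z \<in> W \<Longrightarrow> \<sigma> \<in> {0..1} \<Longrightarrow> z + \<sigma> *\<^sub>R e \<in> V"
    and [measurable]: "V \<in> sets borel" "N \<in> borel_measurable borel"
    and dN: "\<And>z. \<bar>d z\<bar> \<le> L * N z"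
  shows "(\<integral>\<^sup>+z\<in>W. ennreal ((G (U (z + e)) - G (U z))\<^sup>2) \<partial>lborel)
    \<le> ennreal (L\<^sup>2) * (\<integral>\<^sup>+z\<in>V. ennreal ((sqrt_deriv F (U z) * N z)\<^sup>2) \<partial>lborel)"
proof -
  have [measurable]: "d \<in> borel_measurable borel" using d by auto
  have [measurable]: "W \<in> sets borel" using W by auto
  define Q where "Q z = ennreal ((sqrt_deriv F (U z) * d z)\<^sup>2)" for z
  have [measurable]: "Q \<in> borel_measurable borel" unfolding Q_def by measurable
  have ae: "AE z in lborel. z \<in> W \<longrightarrow> ennreal ((G (U (z + e)) - G (U z))\<^sup>2)
    \<le> (\<integral>\<^sup>+\<sigma>\<in>{0..1}. ennreal ((sqrt_deriv F (U (z + \<sigma> *\<^sub>R e)) * d (z + \<sigma> *\<^sub>R e))\<^sup>2) \<partial>lborel)"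
    by (rule AE_G_increment[OF assms(1) U d weak W]; assumption)
  have "(\<integral>\<^sup>+z\<in>W. ennreal ((G (U (z + e)) - G (U z))\<^sup>2) \<partial>lborel)
      \<le> (\<integral>\<^sup>+z\<in>W. (\<integral>\<^sup>+\<sigma>\<in>{0..1}. Q (z + \<sigma> *\<^sub>R e) \<partial>lborel) \<partial>lborel)"
    using ae
    by (intro nn_integral_mono_AE, elim eventually_mono) (auto simp: indicator_def Q_def)
  also have "\<dots> = (\<integral>\<^sup>+z. \<integral>\<^sup>+\<sigma>. Q (z + \<sigma> *\<^sub>R e) * indicator {0..1} \<sigma> * indicator W z \<partial>lborel \<partial>lborel)"
    by (simp add: nn_integral_multc)
  also have "\<dots> = (\<integral>\<^sup>+\<sigma>. \<integral>\<^sup>+z. Q (z + \<sigma> *\<^sub>R e) * indicator {0..1} \<sigma> * indicator W z \<partial>lborel \<partial>lborel)"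
    by (rule lborel_pair.Fubini') measurable
  also have "\<dots> \<le> (\<integral>\<^sup>+\<sigma>. (\<integral>\<^sup>+z. Q (z + \<sigma> *\<^sub>R e) * indicator V (z + \<sigma> *\<^sub>R e) \<partial>lborel) * indicator {0..1::real} \<sigma> \<partial>lborel)"
    using W(3) by (intro nn_integral_mono) (auto simp: indicator_def intro!: nn_integral_mono)
  also have "\<dots> = (\<integral>\<^sup>+\<sigma>. (\<integral>\<^sup>+z\<in>V. Q z \<partial>lborel) * indicator {0..1::real} \<sigma> \<partial>lborel)"
    using nn_integral_lborel_translate[of "\<lambda>z. Q z * indicator V z"] by simp
  also have "\<dots> = (\<integral>\<^sup>+z\<in>V. Q z \<partial>lborel)"
    by (simp add: nn_integral_cmult_indicator)
  also have "\<dots> \<le> (\<integral>\<^sup>+z. ennreal (L\<^sup>2) * (ennreal ((sqrt_deriv F (U z) * N z)\<^sup>2) * indicator V z) \<partial>lborel)"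
  proof (rule nn_integral_mono)
    fix z
    have "(d z)\<^sup>2 \<le> (L * N z)\<^sup>2" using dN[of z] by (simp add: abs_le_square_iff[symmetric])
    then have "(sqrt_deriv F (U z) * d z)\<^sup>2 \<le> L\<^sup>2 * (sqrt_deriv F (U z) * N z)\<^sup>2"
      using mult_left_mono[of "(d z)\<^sup>2" "(L * N z)\<^sup>2" "(sqrt_deriv F (U z))\<^sup>2"]
      by (simp add: power_mult_distrib mult.left_commute)
    then show "Q z * indicator V z \<le> ennreal (L\<^sup>2) * (ennreal ((sqrt_deriv F (U z) * N z)\<^sup>2) * indicator V z)"
      by (auto simp: Q_def indicator_def ennreal_mult'[symmetric] intro!: ennreal_leI)
  qed
  also have "\<dots> = ennreal (L\<^sup>2) * (\<integral>\<^sup>+z\<in>V. ennreal ((sqrt_deriv F (U z) * N z)\<^sup>2) \<partial>lborel)"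
    by (rule nn_integral_cmult) measurable
  finally show ?thesis .
qed

end

lemma nn_integral_lborel_snd:
  fixes f :: "'a::euclidean_space \<times> 'b::euclidean_space \<Rightarrow> ennreal"
  assumes "f \<in> borel_measurable borel"
  shows "(\<integral>\<^sup>+z. f z \<partial>lborel) = (\<integral>\<^sup>+\<tau>. \<integral>\<^sup>+x. f (x, \<tau>) \<partial>lborel \<partial>lborel)"
proof -
  have "f \<in> borel_measurable (lborel \<Otimes>\<^sub>M lborel)" using assms by (simp add: lborel_prod)
  from lborel_pair.nn_integral_snd[OF this] show ?thesis by (simp add: lborel_prod)
qed

text \<open>
  Average \<open>w(z)\<^sup>2 \<le> (w(z + y) - w(z))\<^sup>2 + 2 w(z) w(z + y)\<close> over \<open>|y| < \<rho>\<close>.  For a fixed time the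
  average of the product over \<open>x\<close> and \<open>y\<close> is at most the square of the integral of \<open>w\<close> over the
  enlarged ball, divided by the volume of the ball of radius \<open>\<rho>\<close>.
\<close>

lemma nash_inequality_translations:
  fixes w :: "'a::euclidean_space \<times> real \<Rightarrow> real"
  assumes [measurable]: "w \<in> borel_measurable borel" and w: "\<And>z. 0 \<le> w z"
    and trans: "\<And>y. norm y < \<rho> \<Longrightarrow>
      (\<integral>\<^sup>+z\<in>ball x0 r \<times> {s<..<t}. ennreal ((w (z + (y, 0)) - w z)\<^sup>2) \<partial>lborel) \<le> E"
    and slices: "AE \<tau> in lborel. \<tau> \<in> {s<..<t} \<longrightarrow> (\<integral>\<^sup>+x\<in>ball x0 (r + \<rho>). ennreal (w (x, \<tau>)) \<partial>lborel) \<le> ennreal S"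
    and "0 \<le> S" "s \<le> t" "0 < \<rho>"
  shows "emeasure lborel (ball 0 \<rho> :: 'a set) * (\<integral>\<^sup>+z\<in>ball x0 r \<times> {s<..<t}. ennreal ((w z)\<^sup>2) \<partial>lborel)
    \<le> emeasure lborel (ball 0 \<rho> :: 'a set) * E + ennreal (2 * S\<^sup>2 * (t - s))"
proof -
  let ?Q = "ball x0 r \<times> {s<..<t}" and ?B = "ball 0 \<rho> :: 'a set"
  have "emeasure lborel ?B * (\<integral>\<^sup>+z\<in>?Q. ennreal ((w z)\<^sup>2) \<partial>lborel)
      = (\<integral>\<^sup>+y\<in>?B. (\<integral>\<^sup>+z\<in>?Q. ennreal ((w z)\<^sup>2) \<partial>lborel) \<partial>lborel)"
    by (subst nn_integral_cmult_indicator) (auto simp: mult.commute)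
  also have "\<dots> \<le> (\<integral>\<^sup>+y. E * indicator ?B y +
      (\<integral>\<^sup>+z. ennreal (2 * w z * w (z + (y, 0))) * indicator ?Q z * indicator ?B y \<partial>lborel) \<partial>lborel)"
  proof (rule nn_integral_mono)
    fix y :: 'a
    show "(\<integral>\<^sup>+z\<in>?Q. ennreal ((w z)\<^sup>2) \<partial>lborel) * indicator ?B y
      \<le> E * indicator ?B y + (\<integral>\<^sup>+z. ennreal (2 * w z * w (z + (y, 0))) * indicator ?Q z * indicator ?B y \<partial>lborel)"
    proof (cases "y \<in> ?B")
      case True
      have "(\<integral>\<^sup>+z\<in>?Q. ennreal ((w z)\<^sup>2) \<partial>lborel)
          \<le> (\<integral>\<^sup>+z. ennreal ((w (z + (y, 0)) - w z)\<^sup>2) * indicator ?Q z + ennreal (2 * w z * w (z + (y, 0))) * indicator ?Q z \<partial>lborel)"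
      proof (rule nn_integral_mono)
        fix z
        have "(w z)\<^sup>2 \<le> (w (z + (y, 0)) - w z)\<^sup>2 + 2 * w z * w (z + (y, 0))"
          by (simp add: power2_diff)
        then show "ennreal ((w z)\<^sup>2) * indicator ?Q z
          \<le> ennreal ((w (z + (y, 0)) - w z)\<^sup>2) * indicator ?Q z + ennreal (2 * w z * w (z + (y, 0))) * indicator ?Q z"
          using w by (auto simp: indicator_def ennreal_plus[symmetric] simp del: ennreal_plus intro!: ennreal_leI)
      qed
      also have "\<dots> = (\<integral>\<^sup>+z\<in>?Q. ennreal ((w (z + (y, 0)) - w z)\<^sup>2) \<partial>lborel)
          + (\<integral>\<^sup>+z\<in>?Q. ennreal (2 * w z * w (z + (y, 0))) \<partial>lborel)"
        by (rule nn_integral_add) measurable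
      also have "\<dots> \<le> E + (\<integral>\<^sup>+z\<in>?Q. ennreal (2 * w z * w (z + (y, 0))) \<partial>lborel)"
        using True by (intro add_right_mono trans) auto
      finally show ?thesis using True by simp
    qed simp
  qed
  also have "\<dots> = (\<integral>\<^sup>+y. E * indicator ?B y \<partial>lborel) +
      (\<integral>\<^sup>+y. \<integral>\<^sup>+z. ennreal (2 * w z * w (z + (y, 0))) * indicator ?Q z * indicator ?B y \<partial>lborel \<partial>lborel)"
    by (rule nn_integral_add) measurable
  also have "(\<integral>\<^sup>+y. E * indicator ?B y \<partial>lborel) = emeasure lborel ?B * E"
    by (subst nn_integral_cmult_indicator) (auto simp: mult.commute)
  also have "(\<integral>\<^sup>+y. \<integral>\<^sup>+z. ennreal (2 * w z * w (z + (y, 0))) * indicator ?Q z * indicator ?B y \<partial>lborel \<partial>lborel)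
      = (\<integral>\<^sup>+z. \<integral>\<^sup>+y. ennreal (2 * w z * w (z + (y, 0))) * indicator ?Q z * indicator ?B y \<partial>lborel \<partial>lborel)"
    by (rule lborel_pair.Fubini') measurable
  also have "\<dots> = (\<integral>\<^sup>+\<tau>. \<integral>\<^sup>+x. \<integral>\<^sup>+y. ennreal (2 * w (x, \<tau>) * w ((x, \<tau>) + (y, 0))) * indicator ?Q (x, \<tau>) * indicator ?B y \<partial>lborel \<partial>lborel \<partial>lborel)"
    by (rule nn_integral_lborel_snd) measurable
  also have "\<dots> \<le> (\<integral>\<^sup>+\<tau>. ennreal (2 * S\<^sup>2) * indicator {s<..<t} \<tau> \<partial>lborel)"
  proof (rule nn_integral_mono_AE, use slices in eventually_elim)
    case (elim \<tau>)
    show "(\<integral>\<^sup>+x. \<integral>\<^sup>+y. ennreal (2 * w (x, \<tau>) * w ((x, \<tau>) + (y, 0))) * indicator ?Q (x, \<tau>) * indicator ?B y \<partial>lborel \<partial>lborel)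
        \<le> ennreal (2 * S\<^sup>2) * indicator {s<..<t} \<tau>"
    proof (cases "\<tau> \<in> {s<..<t}")
      case True
      let ?B' = "ball x0 (r + \<rho>)"
      have S: "(\<integral>\<^sup>+x\<in>?B'. ennreal (w (x, \<tau>)) \<partial>lborel) \<le> ennreal S" using elim True by simp
      have inner: "(\<integral>\<^sup>+y. ennreal (w (x + y, \<tau>)) * indicator ?B y \<partial>lborel) \<le> ennreal S" if x: "x \<in> ball x0 r" for x
      proof -
        have "(\<integral>\<^sup>+y. ennreal (w (x + y, \<tau>)) * indicator ?B y \<partial>lborel)
            = (\<integral>\<^sup>+y. ennreal (w (y, \<tau>)) * indicator ?B (y - x) \<partial>lborel)"
          using nn_integral_lborel_translate[of "\<lambda>y. ennreal (w (y, \<tau>)) * indicator ?B (y - x)" x]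
          by (simp add: add.commute)
        also have "\<dots> \<le> (\<integral>\<^sup>+x\<in>?B'. ennreal (w (x, \<tau>)) \<partial>lborel)"
        proof (rule nn_integral_mono)
          fix y
          have "y \<in> ?B'" if "y - x \<in> ?B"
          proof -
            have "dist x0 y \<le> dist x0 x + dist x y" by (rule dist_triangle)
            moreover have "dist x y < \<rho>" using that by (simp add: dist_norm norm_minus_commute)
            ultimately show ?thesis using x by simp
          qed
          then show "ennreal (w (y, \<tau>)) * indicator ?B (y - x) \<le> ennreal (w (y, \<tau>)) * indicator ?B' y"
            by (auto simp: indicator_def)
        qed
        finally show ?thesis using S by simp
      qed
      have "(\<integral>\<^sup>+x. \<integral>\<^sup>+y. ennreal (2 * w (x, \<tau>) * w ((x, \<tau>) + (y, 0))) * indicator ?Q (x, \<tau>) * indicator ?B y \<partial>lborel \<partial>lborel)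
          \<le> (\<integral>\<^sup>+x. ennreal (2 * S) * (ennreal (w (x, \<tau>)) * indicator ?B' x) \<partial>lborel)"
      proof (rule nn_integral_mono)
        fix x
        show "(\<integral>\<^sup>+y. ennreal (2 * w (x, \<tau>) * w ((x, \<tau>) + (y, 0))) * indicator ?Q (x, \<tau>) * indicator ?B y \<partial>lborel)
          \<le> ennreal (2 * S) * (ennreal (w (x, \<tau>)) * indicator ?B' x)"
        proof (cases "x \<in> ball x0 r")
          case x: True
          have "(\<integral>\<^sup>+y. ennreal (2 * w (x, \<tau>) * w ((x, \<tau>) + (y, 0))) * indicator ?Q (x, \<tau>) * indicator ?B y \<partial>lborel)
              = (\<integral>\<^sup>+y. ennreal (2 * w (x, \<tau>)) * (ennreal (w (x + y, \<tau>)) * indicator ?B y) \<partial>lborel)"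
            using x True w by (intro nn_integral_cong) (auto simp: ennreal_mult' mult.assoc)
          also have "\<dots> = ennreal (2 * w (x, \<tau>)) * (\<integral>\<^sup>+y. ennreal (w (x + y, \<tau>)) * indicator ?B y \<partial>lborel)"
            by (rule nn_integral_cmult) measurable
          also have "\<dots> \<le> ennreal (2 * w (x, \<tau>)) * ennreal S"
            using inner[OF x] by (rule mult_left_mono) simp
          also have "\<dots> = ennreal (2 * S) * (ennreal (w (x, \<tau>)) * indicator ?B' x)"
            using x w[of "(x, \<tau>)"] \<open>0 \<le> S\<close> \<open>0 < \<rho>\<close> by (auto simp: ennreal_mult'[symmetric] ennreal_mult[symmetric] indicator_def mult_ac)
          finally show ?thesis .
        qed simp
      qed
      also have "\<dots> = ennreal (2 * S) * (\<integral>\<^sup>+x\<in>?B'. ennreal (w (x, \<tau>)) \<partial>lborel)"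
        by (rule nn_integral_cmult) measurable
      also have "\<dots> \<le> ennreal (2 * S) * ennreal S" using S by (rule mult_left_mono) simp
      also have "\<dots> = ennreal (2 * S\<^sup>2) * indicator {s<..<t} \<tau>"
        using True \<open>0 \<le> S\<close> by (simp add: ennreal_mult'[symmetric] ennreal_mult[symmetric] power2_eq_square mult_ac)
      finally show ?thesis .
    qed simp
  qed
  also have "\<dots> = ennreal (2 * S\<^sup>2 * (t - s))"
    using \<open>s \<le> t\<close> by (simp add: nn_integral_cmult_indicator ennreal_mult'')
  finally show ?thesis by (simp add: add_left_mono)
qed

section \<open>Iteration on shrinking balls\<close>

context
  fixes P h H F G :: "real \<Rightarrow> real"
  assumes sf: "structure_functions P h H F G"
begin

text \<open>
  Young's inequality in place of Hoelder's: \<open>G \<le> a + a powr (1 - \<mu>) * G powr \<mu>\<close> for every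
  \<open>a > 0\<close>, and \<open>a = Y powr (1 / \<mu>)\<close> makes the two contributions comparable.
\<close>

lemma nn_integral_G_le_of_H:
  fixes f :: "'a \<Rightarrow> real"
  assumes \<mu>: "1 \<le> \<mu>" "0 < K" "\<And>s. s \<in> {0..M} \<Longrightarrow> G s powr \<mu> \<le> K * H s"
    and f[measurable]: "f \<in> borel_measurable N" and f0: "\<And>x. 0 \<le> f x" and fM: "\<And>x. f x \<le> M"
    and B[measurable]: "B \<in> sets N" and b: "emeasure N B \<le> ennreal b" "0 \<le> b"
    and HY: "(\<integral>\<^sup>+x\<in>B. ennreal (H (f x)) \<partial>N) \<le> ennreal Y" and Y: "0 < Y"
  shows "(\<integral>\<^sup>+x\<in>B. ennreal (G (f x)) \<partial>N) \<le> ennreal ((b + K) * Y powr (1 / \<mu>))"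
proof -
  define a where "a = Y powr (1 / \<mu>)"
  have a: "0 < a" using Y by (simp add: a_def)
  have [measurable]: "(\<lambda>x. H (f x)) \<in> borel_measurable N" by (rule H_comp_measurable[OF sf f f0])
  have H0: "0 \<le> H (f x)" for x by (rule H_nonneg[OF sf f0])
  have pt: "G (f x) \<le> a + a powr (1 - \<mu>) * K * H (f x)" for x
  proof (cases "G (f x) \<le> a")
    case True
    then show ?thesis using H0[of x] \<mu>(2) by (simp add: add_increasing2)
  next
    case False
    then have "G (f x) = G (f x) powr (1 - \<mu>) * G (f x) powr \<mu>" using a by (simp flip: powr_add)
    also have "\<dots> \<le> a powr (1 - \<mu>) * (K * H (f x))"
      using False a \<mu> f0 fM by (intro mult_mono powr_mono2') auto
    finally show ?thesis using a by (simp add: mult.assoc)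
  qed
  have "(\<integral>\<^sup>+x\<in>B. ennreal (G (f x)) \<partial>N)
      \<le> (\<integral>\<^sup>+x. ennreal a * indicator B x + ennreal (a powr (1 - \<mu>) * K) * (ennreal (H (f x)) * indicator B x) \<partial>N)"
    using pt a H0 \<mu>(2) by (intro nn_integral_mono)
      (auto simp: indicator_def ennreal_mult'[symmetric] ennreal_plus[symmetric] simp del: ennreal_plus intro!: ennreal_leI)
  also have "\<dots> = (\<integral>\<^sup>+x. ennreal a * indicator B x \<partial>N)
      + (\<integral>\<^sup>+x. ennreal (a powr (1 - \<mu>) * K) * (ennreal (H (f x)) * indicator B x) \<partial>N)"
    by (rule nn_integral_add) measurable
  also have "(\<integral>\<^sup>+x. ennreal (a powr (1 - \<mu>) * K) * (ennreal (H (f x)) * indicator B x) \<partial>N)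
      = ennreal (a powr (1 - \<mu>) * K) * (\<integral>\<^sup>+x\<in>B. ennreal (H (f x)) \<partial>N)"
    by (rule nn_integral_cmult) measurable
  also have "\<dots> \<le> ennreal (a powr (1 - \<mu>) * K) * ennreal Y"
    using HY by (rule mult_left_mono) simp
  also have "(\<integral>\<^sup>+x. ennreal a * indicator B x \<partial>N) = ennreal a * emeasure N B"
    by (rule nn_integral_cmult_indicator) measurable
  also have "\<dots> \<le> ennreal a * ennreal b" using b by (intro mult_left_mono) auto
  also have "ennreal a * ennreal b + ennreal (a powr (1 - \<mu>) * K) * ennreal Y = ennreal (a * b + a powr (1 - \<mu>) * K * Y)"
    using a b \<mu>(2) Y by (simp add: ennreal_mult'[symmetric] ennreal_plus[symmetric] del: ennreal_plus)
  also have "a powr (1 - \<mu>) * K * Y = K * a"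
  proof -
    have "a powr (1 - \<mu>) * Y = Y powr ((1 - \<mu>) / \<mu>) * Y powr 1" using Y by (simp add: a_def powr_powr)
    also have "\<dots> = Y powr (1 / \<mu>)" using \<mu>(1) unfolding powr_add[symmetric] by (simp add: field_simps)
    finally show ?thesis by (simp add: a_def)
  qed
  finally show ?thesis by (simp add: a_def algebra_simps add_mono)
qed

end

text \<open>
  The iteration needs only a weak space gradient, the comparison of \<open>G\<close> with \<open>H\<close>, and the two energy
  bounds, each for almost every final time.  The gradient is integrable away from the initial time
  only, so the bound of its energy is stated on \<open>{s<..<t}\<close> with \<open>s > 0\<close>, uniformly in \<open>s\<close>.
\<close>

locale local_energy_estimates =
  fixes P h H F G :: "real \<Rightarrow> real" and U :: "'a::euclidean_space \<times> real \<Rightarrow> real" and D :: "'a \<times> real \<Rightarrow> 'a"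
    and M R T C \<mu> K :: real and x0 :: 'a
  assumes sf: "structure_functions P h H F G"
    and U[measurable]: "U \<in> borel_measurable borel" and U0: "0 \<le> U z" and UM: "U z \<le> M"
    and D[measurable]: "D \<in> borel_measurable borel"
    and D_int: "0 < s \<Longrightarrow> s < t \<Longrightarrow> t < T \<Longrightarrow> set_integrable lborel (ball x0 R \<times> {s<..<t}) D"
    and weak: "C1_test_function (ball x0 R \<times> {0<..<T}) \<eta> \<Longrightarrow>
      (LBINT z. U z * frechet_derivative \<eta> (at z) (v, 0)) = - (LBINT z. (D z \<bullet> v) * \<eta> z)"
    and pos: "0 < R" "0 < T" "0 < C"
    and \<mu>: "1 \<le> \<mu>" "\<mu> < 2" "0 < K" "s \<in> {0..M} \<Longrightarrow> G s powr \<mu> \<le> K * H s"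
    and energy_H: "0 < r \<Longrightarrow> 0 < \<delta> \<Longrightarrow> r + \<delta> \<le> R \<Longrightarrow> AE t in lborel. t \<in> {0<..<T} \<longrightarrow>
      (\<integral>\<^sup>+x\<in>ball x0 r. ennreal (H (U (x, t))) \<partial>lborel)
      \<le> ennreal (C / \<delta>\<^sup>2) * (\<integral>\<^sup>+z\<in>ball x0 (r + \<delta>) \<times> {0<..<t}. ennreal ((G (U z))\<^sup>2) \<partial>lborel)"
    and energy_D: "0 < r \<Longrightarrow> 0 < \<delta> \<Longrightarrow> r + \<delta> \<le> R \<Longrightarrow> AE t in lborel. t \<in> {0<..<T} \<longrightarrow> (\<forall>s\<in>{0<..<t}.
      (\<integral>\<^sup>+z\<in>ball x0 r \<times> {s<..<t}. ennreal ((sqrt_deriv F (U z) * norm (D z))\<^sup>2) \<partial>lborel)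
      \<le> ennreal (C / \<delta>\<^sup>2) * (\<integral>\<^sup>+z\<in>ball x0 (r + \<delta>) \<times> {0<..<t}. ennreal ((G (U z))\<^sup>2) \<partial>lborel))"
begin

lemmas [measurable] = sqrt_deriv_measurable[OF sf]

lemmas [measurable] = G_comp_measurable[OF sf U U0] H_comp_measurable[OF sf U U0]

lemma GU_nonneg: "0 \<le> G (U z)"
  by (rule G_nonneg[OF sf U0])

definition G_square_mass :: "real \<Rightarrow> real \<Rightarrow> ennreal"
  where "G_square_mass r t = (\<integral>\<^sup>+z\<in>ball x0 r \<times> {0<..<t}. ennreal ((G (U z))\<^sup>2) \<partial>lborel)"

lemma G_square_mass_mono: "r \<le> r' \<Longrightarrow> t \<le> t' \<Longrightarrow> G_square_mass r t \<le> G_square_mass r' t'"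
  unfolding G_square_mass_def by (intro nn_integral_mono) (auto simp: indicator_def)

definition ball_volume :: real where "ball_volume = unit_ball_vol (real DIM('a))"

lemma ball_volume_pos: "0 < ball_volume"
  by (simp add: ball_volume_def)

lemma emeasure_ball_power: "0 \<le> r \<Longrightarrow> emeasure lborel (ball c r :: 'a set) = ennreal (ball_volume * r ^ DIM('a))"
  by (simp add: emeasure_ball ball_volume_def)

text \<open>
  The gradient is set to zero outside the cylinder, which makes it integrable on the whole space and
  goes unnoticed by test functions supported in the cylinder.
\<close>

lemma translation_energy:
  assumes r: "0 < r" "0 < \<delta>" "r + \<delta> \<le> R" and s: "0 < s" "s < t" "t < T" and y: "norm y < \<delta>" "norm y \<le> \<rho>"
    and E: "(\<integral>\<^sup>+z\<in>ball x0 (r + \<delta>) \<times> {s<..<t}. ennreal ((sqrt_deriv F (U z) * norm (D z))\<^sup>2) \<partial>lborel) \<le> ennreal Y"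
  shows "(\<integral>\<^sup>+z\<in>ball x0 r \<times> {s<..<t}. ennreal ((G (U (z + (y, 0))) - G (U z))\<^sup>2) \<partial>lborel) \<le> ennreal (\<rho>\<^sup>2 * Y)"
proof -
  let ?V = "ball x0 (r + \<delta>) \<times> {s<..<t}" and ?W = "ball x0 r \<times> {s<..<t}"
  define d where "d z = indicator ?V z * (D z \<bullet> y)" for z
  have "(\<integral>\<^sup>+z\<in>?W. ennreal ((G (U (z + (y, 0))) - G (U z))\<^sup>2) \<partial>lborel)
    \<le> ennreal ((norm y)\<^sup>2) * (\<integral>\<^sup>+z\<in>?V. ennreal ((sqrt_deriv F (U z) * norm (D z))\<^sup>2) \<partial>lborel)"
  proof (rule G_translation_estimate[OF sf U U0 UM, where d = d])
    have "set_integrable lborel ?V D"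
      by (rule set_integrable_subset[OF D_int[OF s]]) (use r in auto)
    then have "set_integrable lborel ?V (\<lambda>z. D z \<bullet> y)"
      unfolding set_integrable_def using integrable_inner_left[of y lborel "\<lambda>z. indicator ?V z *\<^sub>R D z"] by simp
    then show "integrable lborel d" unfolding d_def set_integrable_def by simp
    show "(LBINT z. U z * frechet_derivative \<eta> (at z) (y, 0)) = - (LBINT z. d z * \<eta> z)"
      if \<eta>: "C1_test_function ?V \<eta>" for \<eta>
    proof -
      have "C1_test_function (ball x0 R \<times> {0<..<T}) \<eta>"
        using \<eta> r s unfolding C1_test_function_def compactly_contained_def by fastforce
      from weak[OF this, of y] have "(LBINT z. U z * frechet_derivative \<eta> (at z) (y, 0)) = - (LBINT z. (D z \<bullet> y) * \<eta> z)" .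
      also have "(LBINT z. (D z \<bullet> y) * \<eta> z) = (LBINT z. d z * \<eta> z)"
      proof (intro Bochner_Integration.integral_cong refl)
        fix z
        have "z \<in> ?V" if "\<eta> z \<noteq> 0"
          using \<eta> that closure_subset[of "{z. \<eta> z \<noteq> 0}"] unfolding C1_test_function_def compactly_contained_def by blast
        then show "(D z \<bullet> y) * \<eta> z = d z * \<eta> z" unfolding d_def by (cases "\<eta> z = 0") auto
      qed
      finally show ?thesis .
    qed
    show "open ?W" by (intro open_Times) auto
    show "bounded ?W" by (intro bounded_Times) auto
    show "z + \<sigma> *\<^sub>R (y, 0) \<in> ?V" if z: "z \<in> ?W" and \<sigma>: "\<sigma> \<in> {0..1}" for z \<sigma>
    proof -
      have "norm (\<sigma> *\<^sub>R y) \<le> norm y" using \<sigma> by (simp add: mult_left_le_one_le)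
      moreover have "dist x0 (fst z + \<sigma> *\<^sub>R y) \<le> dist x0 (fst z) + norm (\<sigma> *\<^sub>R y)"
        using dist_triangle[of x0 "fst z + \<sigma> *\<^sub>R y" "fst z"] by (simp add: dist_norm)
      ultimately have "dist x0 (fst z + \<sigma> *\<^sub>R y) < r + \<delta>" using z y by (auto simp: mem_Times_iff)
      then show ?thesis using z by (auto simp: mem_Times_iff)
    qed
    show "\<bar>d z\<bar> \<le> norm y * norm (D z)" for z
      using Cauchy_Schwarz_ineq2[of "D z" y] by (auto simp: d_def indicator_def mult.commute)
  qed (use U0 UM in measurable)
  also have "\<dots> \<le> ennreal (\<rho>\<^sup>2) * ennreal Y"
    using y E by (intro mult_mono ennreal_leI power_mono) auto
  finally show ?thesis by (simp add: ennreal_mult')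
qed

text \<open>
  The energy on the ball of radius \<open>r + \<delta>\<close> is at most \<open>Y\<close>.  In the Nash inequality the gradient
  contributes \<open>\<rho>\<^sup>2 Y\<close>, while the integral of \<open>G(U)\<close> over a time slice is of order
  \<open>Y powr (1 / \<mu>)\<close>; since \<open>\<mu> < 2\<close> the second term is superlinear in \<open>a\<close>, and it carries the small factor \<open>t\<close>.
\<close>

lemma one_step:
  assumes r: "0 < r" "0 < \<delta>" "r + 2 * \<delta> \<le> R" and \<rho>: "0 < \<rho>" "\<rho> \<le> \<delta>" and t: "0 < t" "t < T"
    and a: "0 < a" "G_square_mass (r + 2 * \<delta>) t \<le> ennreal a"
    and good: "\<forall>s\<in>{0<..<t}.
      (\<integral>\<^sup>+z\<in>ball x0 (r + \<delta>) \<times> {s<..<t}. ennreal ((sqrt_deriv F (U z) * norm (D z))\<^sup>2) \<partial>lborel)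
      \<le> ennreal (C / \<delta>\<^sup>2) * G_square_mass (r + 2 * \<delta>) t"
  defines "Y \<equiv> C * a / \<delta>\<^sup>2"
  shows "G_square_mass r t \<le> ennreal (\<rho>\<^sup>2 * Y + 2 * t * ((ball_volume * R ^ DIM('a) + K) * Y powr (1 / \<mu>))\<^sup>2 / (ball_volume * \<rho> ^ DIM('a)))"
proof -
  define w where "w = ball_volume * \<rho> ^ DIM('a)"
  have w: "0 < w" using ball_volume_pos \<rho> by (simp add: w_def)
  have ball_w: "emeasure lborel (ball 0 \<rho> :: 'a set) = ennreal w"
    using \<rho> by (subst emeasure_ball_power) (auto simp: w_def)
  define S where "S = (ball_volume * R ^ DIM('a) + K) * Y powr (1 / \<mu>)"
  have Y: "0 < Y" using a(1) pos r by (simp add: Y_def)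
  have bK: "0 \<le> ball_volume * R ^ DIM('a)" using ball_volume_pos pos by simp
  have S: "0 \<le> S" unfolding S_def using bK \<mu>(3) by simp
  have energy_le: "ennreal (C / \<delta>\<^sup>2) * G_square_mass (r + 2 * \<delta>) t \<le> ennreal Y"
  proof -
    have "ennreal (C / \<delta>\<^sup>2) * G_square_mass (r + 2 * \<delta>) t \<le> ennreal (C / \<delta>\<^sup>2) * ennreal a"
      using a(2) by (rule mult_left_mono) simp
    then show ?thesis using a pos by (simp add: Y_def ennreal_mult'[symmetric])
  qed
  have eq: "r + \<delta> + \<delta> = r + 2 * \<delta>" by simp
  have slices: "AE \<tau> in lborel. \<tau> \<in> {s<..<t} \<longrightarrow> (\<integral>\<^sup>+x\<in>ball x0 (r + \<rho>). ennreal (G (U (x, \<tau>))) \<partial>lborel) \<le> ennreal S"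
    if s: "0 < s" for s
  proof -
    have "AE \<tau> in lborel. \<tau> \<in> {0<..<T} \<longrightarrow> (\<integral>\<^sup>+x\<in>ball x0 (r + \<delta>). ennreal (H (U (x, \<tau>))) \<partial>lborel)
      \<le> ennreal (C / \<delta>\<^sup>2) * (\<integral>\<^sup>+z\<in>ball x0 (r + \<delta> + \<delta>) \<times> {0<..<\<tau>}. ennreal ((G (U z))\<^sup>2) \<partial>lborel)"
      by (rule energy_H) (use r in auto)
    then show ?thesis
    proof eventually_elim
      case (elim \<tau>)
      show ?case
      proof
        assume \<tau>: "\<tau> \<in> {s<..<t}"
        then have "\<tau> \<in> {0<..<T}" using s t by auto
        from elim[rule_format, OF this]
        have "(\<integral>\<^sup>+x\<in>ball x0 (r + \<delta>). ennreal (H (U (x, \<tau>))) \<partial>lborel) \<le> ennreal (C / \<delta>\<^sup>2) * G_square_mass (r + 2 * \<delta>) \<tau>"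
          unfolding G_square_mass_def eq .
        also have "\<dots> \<le> ennreal (C / \<delta>\<^sup>2) * G_square_mass (r + 2 * \<delta>) t"
          using \<tau> by (intro mult_left_mono G_square_mass_mono) auto
        also have "\<dots> \<le> ennreal Y" by (rule energy_le)
        finally have HY: "(\<integral>\<^sup>+x\<in>ball x0 (r + \<delta>). ennreal (H (U (x, \<tau>))) \<partial>lborel) \<le> ennreal Y" .
        have "(\<integral>\<^sup>+x\<in>ball x0 (r + \<rho>). ennreal (G (U (x, \<tau>))) \<partial>lborel) \<le> (\<integral>\<^sup>+x\<in>ball x0 (r + \<delta>). ennreal (G (U (x, \<tau>))) \<partial>lborel)"
          using \<rho> by (intro nn_integral_mono) (auto simp: indicator_def)
        also have "\<dots> \<le> ennreal S"
          unfolding S_def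
        proof (rule nn_integral_G_le_of_H[OF sf \<mu>(1,3,4) _ U0 UM _ _ bK HY Y])
          show "emeasure lborel (ball x0 (r + \<delta>)) \<le> ennreal (ball_volume * R ^ DIM('a))"
            using r ball_volume_pos by (subst emeasure_ball_power) (auto intro!: ennreal_leI mult_left_mono power_mono)
        qed auto
        finally show "(\<integral>\<^sup>+x\<in>ball x0 (r + \<rho>). ennreal (G (U (x, \<tau>))) \<partial>lborel) \<le> ennreal S" .
      qed
    qed
  qed
  have main: "(\<integral>\<^sup>+z\<in>ball x0 r \<times> {s<..<t}. ennreal ((G (U z))\<^sup>2) \<partial>lborel) \<le> ennreal (\<rho>\<^sup>2 * Y + 2 * t * S\<^sup>2 / w)"
    (is "?I \<le> _") if s: "0 < s" "s < t" for s
  proof -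
    have "emeasure lborel (ball 0 \<rho> :: 'a set) * ?I
      \<le> emeasure lborel (ball 0 \<rho> :: 'a set) * ennreal (\<rho>\<^sup>2 * Y) + ennreal (2 * S\<^sup>2 * (t - s))"
    proof (rule nash_inequality_translations[OF G_comp_measurable[OF sf U U0] GU_nonneg _ slices[OF s(1)] S _ \<rho>(1)])
      fix y :: 'a assume y: "norm y < \<rho>"
      show "(\<integral>\<^sup>+z\<in>ball x0 r \<times> {s<..<t}. ennreal ((G (U (z + (y, 0))) - G (U z))\<^sup>2) \<partial>lborel) \<le> ennreal (\<rho>\<^sup>2 * Y)"
        by (rule translation_energy[OF r(1,2) _ s t(2)]) (use r y \<rho> good s order_trans[OF _ energy_le] in auto)
    qed (use s in auto)
    also have "\<dots> = ennreal (w * (\<rho>\<^sup>2 * Y) + 2 * S\<^sup>2 * (t - s))"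
      using w Y s by (auto simp: ball_w ennreal_mult'[symmetric] ennreal_plus[symmetric] simp del: ennreal_plus)
    also have "\<dots> \<le> ennreal (w * (\<rho>\<^sup>2 * Y + 2 * t * S\<^sup>2 / w))"
    proof (rule ennreal_leI)
      have "2 * S\<^sup>2 * (t - s) \<le> 2 * S\<^sup>2 * t" using s by (intro mult_left_mono) auto
      then show "w * (\<rho>\<^sup>2 * Y) + 2 * S\<^sup>2 * (t - s) \<le> w * (\<rho>\<^sup>2 * Y + 2 * t * S\<^sup>2 / w)"
        using w by (simp add: distrib_left mult_ac)
    qed
    finally have "ennreal w * ?I \<le> ennreal w * ennreal (\<rho>\<^sup>2 * Y + 2 * t * S\<^sup>2 / w)"
      using w by (simp add: ball_w ennreal_mult')
    then show ?thesis using w by (simp add: ennreal_mult_le_mult_iff)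
  qed
  define N where "N = density lborel (\<lambda>z. ennreal ((G (U z))\<^sup>2))"
  define Q where "Q n = ball x0 r \<times> {t / real (n + 2)<..<t}" for n :: nat
  have N: "emeasure N (ball x0 r \<times> {s<..<t}) = (\<integral>\<^sup>+z\<in>ball x0 r \<times> {s<..<t}. ennreal ((G (U z))\<^sup>2) \<partial>lborel)" for s
    unfolding N_def by (rule emeasure_density) auto
  have "(\<lambda>n. emeasure N (Q n)) \<longlonglongrightarrow> emeasure N (\<Union>n. Q n)"
  proof (rule Lim_emeasure_incseq)
    show "range Q \<subseteq> sets N" by (auto simp: Q_def N_def)
    show "incseq Q"
    proof (rule monoI)
      fix m n :: nat assume "m \<le> n"
      then have "t / real (n + 2) \<le> t / real (m + 2)" using t by (intro divide_left_mono) auto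
      then show "Q m \<le> Q n" unfolding Q_def by (intro Sigma_mono) (auto simp del: of_nat_add)
    qed
  qed
  moreover have "(\<Union>n. Q n) = ball x0 r \<times> {0<..<t}"
  proof (intro equalityI subsetI)
    fix z assume z: "z \<in> ball x0 r \<times> {0<..<t}"
    obtain n where "t / snd z < real n" using reals_Archimedean2 by blast
    then have "t / real (n + 2) < snd z" using z by (auto simp: field_simps mem_Times_iff)
    then show "z \<in> (\<Union>n. Q n)" using z by (auto simp: Q_def mem_Times_iff intro!: exI[of _ n])
  next
    fix z assume "z \<in> (\<Union>n. Q n)"
    then obtain n where "t / real (n + 2) < snd z" "z \<in> ball x0 r \<times> {..<t}" by (auto simp: Q_def)
    moreover have "0 < t / real (n + 2)" using t by simp
    ultimately show "z \<in> ball x0 r \<times> {0<..<t}" by (auto simp: mem_Times_iff simp del: of_nat_add)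
  qed
  ultimately have "(\<lambda>n. emeasure N (Q n)) \<longlonglongrightarrow> G_square_mass r t" by (simp add: N G_square_mass_def)
  moreover have "emeasure N (Q n) \<le> ennreal (\<rho>\<^sup>2 * Y + 2 * t * S\<^sup>2 / w)" for n
    unfolding Q_def N using t by (intro main) (auto simp: field_simps add_pos_nonneg)
  ultimately have "G_square_mass r t \<le> ennreal (\<rho>\<^sup>2 * Y + 2 * t * S\<^sup>2 / w)" by (intro LIMSEQ_le_const2) auto
  then show ?thesis unfolding S_def w_def .
qed

lemma G_square_mass_0: "G_square_mass R T \<le> ennreal (ball_volume * R ^ DIM('a) * T * (G M)\<^sup>2)"
proof -
  have GM: "(G (U z))\<^sup>2 \<le> (G M)\<^sup>2" for z
    using G_mono[OF sf U0 UM] GU_nonneg by (intro power_mono) auto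
  have "G_square_mass R T \<le> (\<integral>\<^sup>+z\<in>ball x0 R \<times> {0<..<T}. ennreal ((G M)\<^sup>2) \<partial>lborel)"
    unfolding G_square_mass_def by (intro nn_integral_mono mult_right_mono ennreal_leI GM) auto
  also have "\<dots> = ennreal ((G M)\<^sup>2) * emeasure lborel (ball x0 R \<times> {0<..<T})"
    by (rule nn_integral_cmult_indicator) auto
  also have "emeasure lborel (ball x0 R \<times> {0<..<T}) = ennreal (ball_volume * R ^ DIM('a)) * ennreal T"
    using pos unfolding lborel_prod[symmetric]
    by (subst lborel.emeasure_pair_measure_Times) (auto simp: emeasure_ball_power)
  finally show ?thesis
    using pos ball_volume_pos by (simp add: ennreal_mult'[symmetric] ennreal_mult[symmetric] mult_ac)
qed

text \<open>
  The radii decrease to \<open>R'\<close> with gaps \<open>2 \<delta>\<^sub>n\<close>, and \<open>\<delta>\<^sub>n\<close> and \<open>\<rho>\<^sub>n\<close> are halved in each step.  The factor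
  \<open>4\<^sup>n\<close> that comes from \<open>1 / \<delta>\<^sub>n\<^sup>2\<close> is cancelled by \<open>\<rho>\<^sub>n\<^sup>2\<close> in the first term of \<open>one_step\<close>.  In the second
  one it is outweighed, together with the growth of \<open>\<rho>\<^sub>n\<^sup>-\<^sup>N\<close>, by the superlinear power of \<open>q\<^sup>n\<close> as soon
  as \<open>q\<close> is small.
\<close>

lemma vanishing:
  assumes R': "0 < R'" "R' < R"
  shows "\<exists>T'. 0 < T' \<and> T' \<le> T \<and> (AE z in lborel. z \<in> ball x0 R' \<times> {0<..<T'} \<longrightarrow> U z = 0)"
proof -
  let ?N = "DIM('a)"
  \<comment> \<open>the exponent of superlinearity\<close>
  define \<nu> where "\<nu> = 2 / \<mu>"
  have \<nu>: "1 < \<nu>" using \<mu>(1,2) by (simp add: \<nu>_def)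
  define L where "L = 4 powr \<nu> * 2 ^ ?N"
  have L: "1 < L"
  proof -
    have "1 < 4 powr \<nu>" using \<nu> by simp
    then show ?thesis unfolding L_def using less_le_trans[of 1 "4 powr \<nu>" "4 powr \<nu> * 2 ^ ?N"] by simp
  qed
  \<comment> \<open>the rate of decay, chosen so that \<open>q\<^sup>\<nu>\<close> times the loss \<open>L\<close> per step is again \<open>q\<close>\<close>
  define q where "q = L powr (- (1 / (\<nu> - 1)))"
  have q: "0 < q" "q < 1"
    using L \<nu> powr_less_mono[of "- (1 / (\<nu> - 1))" 0 L] by (auto simp: q_def)
  have Lq: "L * q powr (\<nu> - 1) = 1"
  proof -
    have "- (1 / (\<nu> - 1)) * (\<nu> - 1) = -1" using \<nu> by simp
    then have "q powr (\<nu> - 1) = L powr (-1)" by (simp only: q_def powr_powr)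
    then show ?thesis using L by (simp add: powr_minus)
  qed
  define a\<^sub>0 where "a\<^sub>0 = ball_volume * R ^ ?N * T * (G M)\<^sup>2 + 1"
  have a\<^sub>0: "0 < a\<^sub>0" using ball_volume_pos pos by (simp add: a\<^sub>0_def add_nonneg_pos)
  define Y\<^sub>0 where "Y\<^sub>0 = 16 * C * a\<^sub>0 / (R - R')\<^sup>2"
  have Y\<^sub>0: "0 < Y\<^sub>0" using pos a\<^sub>0 R' by (simp add: Y\<^sub>0_def)
  \<comment> \<open>small enough for \<open>\<rho>\<^sub>n \<le> \<delta>\<^sub>n\<close> and for the gradient term to be half of the desired bound\<close>
  define c where "c = min ((R - R') / 4) (sqrt (a\<^sub>0 * q / (2 * Y\<^sub>0)))"
  have c: "0 < c" "c \<le> (R - R') / 4"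
    using R' a\<^sub>0 q Y\<^sub>0 unfolding c_def by (simp, intro min.cobounded1)
  have "c\<^sup>2 \<le> (sqrt (a\<^sub>0 * q / (2 * Y\<^sub>0)))\<^sup>2" using c by (intro power_mono) (auto simp: c_def)
  then have cY: "c\<^sup>2 * Y\<^sub>0 \<le> a\<^sub>0 * q / 2" using a\<^sub>0 q Y\<^sub>0 by (simp add: field_simps)
  define \<kappa> where "\<kappa> = ball_volume * R ^ ?N + K"
  have \<kappa>: "0 < \<kappa>" using ball_volume_pos pos \<mu>(3) by (simp add: \<kappa>_def add_pos_pos)
  define b where "b = 2 * \<kappa>\<^sup>2 * Y\<^sub>0 powr \<nu> / (ball_volume * c ^ ?N)"
  have b: "0 < b" using \<kappa> Y\<^sub>0 ball_volume_pos c by (simp add: b_def)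
  define r where "r n = R' + (R - R') / 2 ^ n" for n :: nat
  define \<delta> where "\<delta> n = (R - R') / (4 * 2 ^ n)" for n :: nat
  have \<delta>: "0 < \<delta> n" for n using R' by (simp add: \<delta>_def)
  have r_Suc: "r (Suc n) + 2 * \<delta> n = r n" for n by (simp add: r_def \<delta>_def field_simps)
  have r_pos: "0 < r n" "R' \<le> r n" for n using R' by (auto simp: r_def add_pos_pos)
  have r_le: "r n \<le> R" for n
  proof -
    have "(R - R') / 2 ^ n \<le> (R - R') / 1" using R' by (intro divide_left_mono) auto
    then show ?thesis by (simp add: r_def)
  qed
  define good where "good n t \<longleftrightarrow> (\<forall>s\<in>{0<..<t}.
      (\<integral>\<^sup>+z\<in>ball x0 (r (Suc n) + \<delta> n) \<times> {s<..<t}. ennreal ((sqrt_deriv F (U z) * norm (D z))\<^sup>2) \<partial>lborel)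
      \<le> ennreal (C / (\<delta> n)\<^sup>2) * G_square_mass (r n) t)" for n t
  have good_ae: "AE t in lborel. \<forall>n. t \<in> {0<..<T} \<longrightarrow> good n t"
  proof (subst AE_all_countable, rule allI)
    fix n
    have "r (Suc n) + \<delta> n + \<delta> n = r n" using r_Suc[of n] by simp
    then show "AE t in lborel. t \<in> {0<..<T} \<longrightarrow> good n t"
      using energy_D[of "r (Suc n) + \<delta> n" "\<delta> n"] r_le[of n] r_pos(1)[of "Suc n"] \<delta>[of n]
      unfolding good_def G_square_mass_def by (simp add: add_pos_pos)
  qed
  \<comment> \<open>up to this time the second term is at most the other half\<close>
  define t\<^sub>1 where "t\<^sub>1 = min T (a\<^sub>0 * q / (2 * b))"
  have t\<^sub>1: "0 < t\<^sub>1" using pos a\<^sub>0 q b by (simp add: t\<^sub>1_def)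
  have "\<exists>t\<in>{0<..<t\<^sub>1}. \<forall>n. t \<in> {0<..<T} \<longrightarrow> good n t"
    by (rule AE_imp_ex_Ioo[OF good_ae t\<^sub>1])
  then obtain t where t: "0 < t" "t < T" "t < a\<^sub>0 * q / (2 * b)" and good: "\<And>n. good n t"
    by (auto simp: t\<^sub>1_def)
  have tb: "t * b \<le> a\<^sub>0 * q / 2" using t(3) b by (simp add: field_simps)
  have iter: "G_square_mass (r n) t \<le> ennreal (a\<^sub>0 * q ^ n)" for n
  proof (induction n)
    case 0
    have "G_square_mass (r 0) t \<le> G_square_mass R T" using t by (intro G_square_mass_mono) (auto simp: r_def)
    also have "\<dots> \<le> ennreal a\<^sub>0" using G_square_mass_0 by (rule order_trans) (auto simp: a\<^sub>0_def intro!: ennreal_leI)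
    finally show ?case by simp
  next
    case (Suc n)
    define \<rho> where "\<rho> = c / 2 ^ n"
    define Y where "Y = C * (a\<^sub>0 * q ^ n) / (\<delta> n)\<^sup>2"
    have "2 ^ n * (2 ^ n :: real) = 4 ^ n" by (simp flip: power_mult_distrib)
    then have Y: "Y = Y\<^sub>0 * (4 * q) ^ n"
      using R' by (simp add: Y_def Y\<^sub>0_def \<delta>_def power2_eq_square power_mult_distrib field_simps)
    have "G_square_mass (r (Suc n)) t \<le> ennreal (\<rho>\<^sup>2 * Y + 2 * t * (\<kappa> * Y powr (1 / \<mu>))\<^sup>2 / (ball_volume * \<rho> ^ ?N))"
      unfolding \<kappa>_def Y_def
    proof (rule one_step[OF r_pos(1) \<delta> _ _ _ t(1,2)])
      show "\<rho> \<le> \<delta> n" using c by (simp add: \<rho>_def \<delta>_def field_simps)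
    qed (use r_le c a\<^sub>0 q Suc good[of n] in \<open>auto simp: r_Suc \<rho>_def good_def\<close>)
    also have "\<dots> \<le> ennreal (a\<^sub>0 * q ^ Suc n)"
    proof (rule ennreal_leI)
      have "(2 ^ n)\<^sup>2 = (4 ^ n :: real)" by (simp add: power2_eq_square flip: power_mult_distrib)
      then have "\<rho>\<^sup>2 * Y = c\<^sup>2 * Y\<^sub>0 * q ^ n"
        by (simp add: \<rho>_def Y power_divide power_mult_distrib)
      also have "\<dots> \<le> a\<^sub>0 * q / 2 * q ^ n" using cY q by (intro mult_right_mono) auto
      finally have 1: "\<rho>\<^sup>2 * Y \<le> a\<^sub>0 * q / 2 * q ^ n" .
      have Yp: "(Y powr (1 / \<mu>))\<^sup>2 = Y\<^sub>0 powr \<nu> * ((4 * q) powr \<nu>) ^ n"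
      proof -
        have "(Y powr (1 / \<mu>))\<^sup>2 = Y powr \<nu>"
          by (simp add: \<nu>_def power2_eq_square powr_add[symmetric])
        also have "\<dots> = Y\<^sub>0 powr \<nu> * ((4 * q) ^ n) powr \<nu>"
          unfolding Y by (simp add: powr_mult)
        also have "((4 * q) ^ n) powr \<nu> = ((4 * q) powr \<nu>) ^ n"
          by (induction n) (auto simp: powr_mult)
        finally show ?thesis .
      qed
      have "(4 * q) powr \<nu> * 2 ^ ?N = q"
      proof -
        have "q powr \<nu> = q powr (\<nu> - 1) * q powr 1" unfolding powr_add[symmetric] by simp
        then have "(4 * q) powr \<nu> * 2 ^ ?N = L * q powr (\<nu> - 1) * q"
          using q by (simp add: powr_mult L_def mult_ac)
        then show ?thesis using Lq by simp
      qed
      then have qn: "((4 * q) powr \<nu>) ^ n * (2 ^ ?N) ^ n = q ^ n"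
        by (simp flip: power_mult_distrib)
      have \<rho>N: "\<rho> ^ ?N = c ^ ?N / (2 ^ ?N) ^ n"
        by (simp add: \<rho>_def power_divide power_mult[symmetric] mult.commute)
      have "2 * t * (\<kappa> * Y powr (1 / \<mu>))\<^sup>2 / (ball_volume * \<rho> ^ ?N)
          = t * (2 * \<kappa>\<^sup>2 * Y\<^sub>0 powr \<nu> / (ball_volume * c ^ ?N)) * (((4 * q) powr \<nu>) ^ n * (2 ^ ?N) ^ n)"
        unfolding power_mult_distrib[of \<kappa>] Yp \<rho>N by (simp add: field_simps)
      also have "\<dots> = t * b * q ^ n" by (simp only: qn b_def)
      also have "\<dots> \<le> a\<^sub>0 * q / 2 * q ^ n" using tb q by (intro mult_right_mono) auto
      finally have 2: "2 * t * (\<kappa> * Y powr (1 / \<mu>))\<^sup>2 / (ball_volume * \<rho> ^ ?N) \<le> a\<^sub>0 * q / 2 * q ^ n" .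
      show "\<rho>\<^sup>2 * Y + 2 * t * (\<kappa> * Y powr (1 / \<mu>))\<^sup>2 / (ball_volume * \<rho> ^ ?N) \<le> a\<^sub>0 * q ^ Suc n"
        using add_mono[OF 1 2] by simp
    qed
    finally show ?case .
  qed
  have "G_square_mass R' t \<le> ennreal (a\<^sub>0 * q ^ n)" for n
    using G_square_mass_mono[OF r_pos(2)[of n], of t t] iter[of n] by simp
  moreover have "(\<lambda>n. ennreal (a\<^sub>0 * q ^ n)) \<longlonglongrightarrow> ennreal (a\<^sub>0 * 0)"
    using q by (intro tendsto_ennrealI tendsto_mult tendsto_const LIMSEQ_realpow_zero) auto
  ultimately have "G_square_mass R' t \<le> 0"
    by (intro LIMSEQ_le_const[where X = "\<lambda>n. ennreal (a\<^sub>0 * q ^ n)"]) auto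
  then have "(\<integral>\<^sup>+z\<in>ball x0 R' \<times> {0<..<t}. ennreal ((G (U z))\<^sup>2) \<partial>lborel) = 0" by (simp add: G_square_mass_def)
  then have "AE z in lborel. ennreal ((G (U z))\<^sup>2) * indicator (ball x0 R' \<times> {0<..<t}) z = 0"
    by (subst (asm) nn_integral_0_iff_AE) auto
  then have "AE z in lborel. z \<in> ball x0 R' \<times> {0<..<t} \<longrightarrow> U z = 0"
  proof eventually_elim
    case (elim z)
    then show ?case using G_pos[OF sf, of "U z"] U0[of z]
      by (cases "U z = 0") (auto simp: indicator_def less_le split: if_splits)
  qed
  then show ?thesis using t by (intro exI[of _ t]) auto
qed

end

section \<open>The local energy inequality\<close>

text \<open>
  The square of a cutoff function, not normalised; its gradient is at most \<open>4 r\<close> times its square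
  root, which is the only relation between the two that the absorption argument uses.
\<close>

definition cutoff :: "'a::euclidean_space \<Rightarrow> real \<Rightarrow> 'a \<Rightarrow> real"
  where "cutoff x0 r x = (max 0 (r\<^sup>2 - (norm (x - x0))\<^sup>2))\<^sup>2"

definition cutoff_grad :: "'a::euclidean_space \<Rightarrow> real \<Rightarrow> 'a \<Rightarrow> 'a"
  where "cutoff_grad x0 r x = (- 4 * max 0 (r\<^sup>2 - (norm (x - x0))\<^sup>2)) *\<^sub>R (x - x0)"

lemma cutoff_nonneg: "0 \<le> cutoff x0 r x"
  by (simp add: cutoff_def)

lemma cutoff_eq_0: "0 < r \<Longrightarrow> x \<notin> ball x0 r \<Longrightarrow> cutoff x0 r x = 0 \<and> cutoff_grad x0 r x = 0"
  by (auto simp: cutoff_def cutoff_grad_def dist_norm norm_minus_commute max_def power_mono)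

lemma cutoff_le: "0 < r \<Longrightarrow> cutoff x0 r x \<le> r ^ 4"
proof -
  assume r: "0 < r"
  have "(max 0 (r\<^sup>2 - (norm (x - x0))\<^sup>2))\<^sup>2 \<le> (r\<^sup>2)\<^sup>2" by (intro power_mono) auto
  then show ?thesis by (simp add: cutoff_def)
qed

lemma sqrt_cutoff_le: "0 < r \<Longrightarrow> sqrt (cutoff x0 r x) \<le> r\<^sup>2"
  using cutoff_le[of r x0 x] by (intro real_le_lsqrt) auto

lemma cutoff_lower:
  assumes "0 < r" "0 < \<delta>" "x \<in> ball x0 r"
  shows "((r + \<delta>) * \<delta>)\<^sup>2 \<le> cutoff x0 (r + \<delta>) x"
  unfolding cutoff_def
proof (rule power_mono)
  have "(norm (x - x0))\<^sup>2 \<le> r\<^sup>2"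
    using assms by (intro power_mono) (auto simp: dist_norm norm_minus_commute)
  then have "(r + \<delta>)\<^sup>2 - r\<^sup>2 \<le> (r + \<delta>)\<^sup>2 - (norm (x - x0))\<^sup>2" by simp
  moreover have "(r + \<delta>)\<^sup>2 - r\<^sup>2 = (r + \<delta>) * \<delta> + r * \<delta>" by (simp add: power2_eq_square algebra_simps)
  moreover have "0 < r * \<delta>" using assms by simp
  ultimately show "(r + \<delta>) * \<delta> \<le> max 0 ((r + \<delta>)\<^sup>2 - (norm (x - x0))\<^sup>2)" by linarith
qed (use assms in auto)

lemma norm_cutoff_grad:
  assumes "0 < r"
  shows "norm (cutoff_grad x0 r x) \<le> 4 * r * sqrt (cutoff x0 r x)"
proof (cases "x \<in> ball x0 r")
  case True
  then have "norm (x - x0) \<le> r" by (simp add: dist_norm norm_minus_commute)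
  then have "4 * max 0 (r\<^sup>2 - (norm (x - x0))\<^sup>2) * norm (x - x0) \<le> 4 * max 0 (r\<^sup>2 - (norm (x - x0))\<^sup>2) * r"
    by (intro mult_left_mono) auto
  then show ?thesis by (simp add: cutoff_def cutoff_grad_def abs_mult mult_ac)
next
  case False
  then show ?thesis using cutoff_eq_0[OF assms False] by simp
qed

lemma cutoff_has_derivative: "(cutoff x0 r has_derivative (\<lambda>v. cutoff_grad x0 r x \<bullet> v)) (at x)"
proof -
  have "((\<lambda>x. r\<^sup>2 - (x - x0) \<bullet> (x - x0)) has_derivative (\<lambda>v. - (2 * ((x - x0) \<bullet> v)))) (at x)"
    by (auto intro!: derivative_eq_intros simp: inner_commute)
  from has_derivative_compose[OF this DERIV_pos_part_squared[unfolded has_field_derivative_def]]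
  show ?thesis
    unfolding cutoff_def[abs_def] by (simp add: power2_norm_eq_inner cutoff_grad_def mult_ac)
qed

lemma cutoff_grad_continuous: "continuous_on S (cutoff_grad x0 r)"
  unfolding cutoff_grad_def[abs_def] by (intro continuous_intros)

lemma cutoff_continuous: "continuous_on S (cutoff x0 r)"
  unfolding cutoff_def[abs_def] by (intro continuous_intros)

lemma cutoff_measurable [measurable]: "cutoff x0 r \<in> borel_measurable borel" "cutoff_grad x0 r \<in> borel_measurable borel"
  by (intro borel_measurable_continuous_onI cutoff_continuous cutoff_grad_continuous)+

lemma cutoff_fst_measurable [measurable]:
  "(\<lambda>z. cutoff x0 r (fst z :: 'a::euclidean_space)) \<in> borel_measurable (borel :: ('a \<times> real) measure)"
  "(\<lambda>z. cutoff_grad x0 r (fst z :: 'a)) \<in> borel_measurable (borel :: ('a \<times> real) measure)"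
  unfolding cutoff_def cutoff_grad_def
  by (intro borel_measurable_continuous_onI continuous_intros)+

lemma cutoff_lipschitz:
  assumes "0 < r"
  shows "(4 * r * r\<^sup>2)-lipschitz_on UNIV (cutoff x0 r)"
proof (rule bounded_derivative_imp_lipschitz[where f' = "\<lambda>x v. cutoff_grad x0 r x \<bullet> v"])
  show "(cutoff x0 r has_derivative (\<lambda>v. cutoff_grad x0 r x \<bullet> v)) (at x within UNIV)" for x
    by (rule cutoff_has_derivative)
  show "onorm (\<lambda>v. cutoff_grad x0 r x \<bullet> v) \<le> 4 * r * r\<^sup>2" for x
  proof (rule onorm_bound)
    have "norm (cutoff_grad x0 r x) \<le> 4 * r * r\<^sup>2"
      using assms by (intro order_trans[OF norm_cutoff_grad[OF assms]] mult_left_mono sqrt_cutoff_le) auto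
    then show "norm (cutoff_grad x0 r x \<bullet> v) \<le> 4 * r * r\<^sup>2 * norm v" for v
      unfolding real_norm_def
      by (rule order_trans[OF Cauchy_Schwarz_ineq2 mult_right_mono[OF _ norm_ge_zero]])
  qed (use assms in auto)
qed (use assms in auto)

text \<open>
  The differential inequality for Borel versions, tested with the cutoffs only.  It is available
  between the times of a set \<open>good\<close> of full measure: for a solution, the times at which the Borel
  version agrees almost everywhere in space with the representative that is continuous in time.
\<close>

locale energy_inequality =
  fixes P h H F G :: "real \<Rightarrow> real" and U :: "'a::euclidean_space \<times> real \<Rightarrow> real" and D :: "'a \<times> real \<Rightarrow> 'a"
    and M R T C\<^sub>1 :: real and x0 :: 'a and good :: "real set"
  assumes sf: "structure_functions P h H F G"
    and U[measurable]: "U \<in> borel_measurable borel" and U0: "\<And>z. 0 \<le> U z" and UM: "\<And>z. U z \<le> M"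
    and D[measurable]: "D \<in> borel_measurable borel"
    and pos: "0 < R" "0 < T" "0 < C\<^sub>1"
    and F_le: "\<And>s. s \<in> {0<..M} \<Longrightarrow> F s \<le> C\<^sub>1 * sqrt_deriv F s * G s"
    and D_int: "\<And>s t. 0 < s \<Longrightarrow> s < t \<Longrightarrow> t < T \<Longrightarrow> set_integrable lborel (ball x0 R \<times> {s<..<t}) D"
    and Q_int: "\<And>s t. 0 < s \<Longrightarrow> s < t \<Longrightarrow> t < T \<Longrightarrow>
      set_integrable lborel (ball x0 R \<times> {s<..<t}) (\<lambda>z. (sqrt_deriv F (U z) * norm (D z))\<^sup>2)"
    and good: "AE t in lborel. t \<in> {0<..<T} \<longrightarrow> t \<in> good" "good \<subseteq> {0<..<T}"
    and ineq: "\<And>r s t. 0 < r \<Longrightarrow> r \<le> R \<Longrightarrow> s \<in> good \<Longrightarrow> t \<in> good \<Longrightarrow> s < t \<Longrightarrow>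
      (LBINT x. cutoff x0 r x * H (U (x, t))) - (LBINT x. cutoff x0 r x * H (U (x, s)))
      + (LBINT z. indicator (ball x0 R \<times> {s<..<t}) z * (F (U z) * (D z \<bullet> cutoff_grad x0 r (fst z))
          + (sqrt_deriv F (U z) * norm (D z))\<^sup>2 * cutoff x0 r (fst z))) \<le> 0"
    and init: "\<And>d e. 0 < d \<Longrightarrow> 0 < e \<Longrightarrow> \<exists>s\<^sub>0>0. \<forall>s\<in>good. s < s\<^sub>0 \<longrightarrow>
      measure lborel {x \<in> ball x0 R. d < U (x, s)} \<le> e"
begin

lemmas [measurable] = sqrt_deriv_measurable[OF sf]

lemmas [measurable] = F_comp_measurable[OF sf U U0] G_comp_measurable[OF sf U U0] H_comp_measurable[OF sf U U0]

lemma F_le': "F (U z) \<le> C\<^sub>1 * sqrt_deriv F (U z) * G (U z)"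
  using F_le[of "U z"] U0[of z] UM[of z] F_0[OF sf] by (cases "U z = 0") auto

lemma cutoff_H_integrable:
  assumes r: "0 < r"
  shows "integrable lborel (\<lambda>x. cutoff x0 r x * H (U (x, t)))"
proof (rule Bochner_Integration.integrable_bound[where f = "\<lambda>x. r ^ 4 * H M * indicator (ball x0 r) x"])
  have "emeasure lborel (ball x0 r) < \<infinity>" by (rule emeasure_bounded_finite) simp
  then show "integrable lborel (\<lambda>x. r ^ 4 * H M * indicator (ball x0 r) x)"
    by (intro integrable_mult_right integrable_real_indicator) auto
  show "AE x in lborel. norm (cutoff x0 r x * H (U (x, t))) \<le> norm (r ^ 4 * H M * indicator (ball x0 r) x)"
  proof (rule AE_I2)
    fix x
    have H: "0 \<le> H (U (x, t))" "H (U (x, t)) \<le> H M" by (intro H_nonneg[OF sf] H_mono[OF sf] U0 UM)+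
    then have "cutoff x0 r x * H (U (x, t)) \<le> r ^ 4 * H M"
      using r by (intro mult_mono cutoff_le cutoff_nonneg) auto
    then show "norm (cutoff x0 r x * H (U (x, t))) \<le> norm (r ^ 4 * H M * indicator (ball x0 r) x)"
      using H cutoff_nonneg[of x0 r x] cutoff_eq_0[OF r, of x x0] by (cases "x \<in> ball x0 r") auto
  qed
qed measurable

text \<open>
  Where \<open>U \<le> d\<close> the integrand is small since \<open>H(d)\<close> is small; the set where \<open>U > d\<close> has small measure
  for early times, and \<open>H(U) \<le> H(M)\<close> there.
\<close>

lemma initial_energy_small:
  assumes r: "0 < r" "r \<le> R" and e: "0 < e"
  shows "\<exists>s\<^sub>0>0. \<forall>s\<in>good. s < s\<^sub>0 \<longrightarrow> (LBINT x. cutoff x0 r x * H (U (x, s))) \<le> e"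
proof -
  define b where "b = measure lborel (ball x0 R)"
  have b: "0 \<le> b" by (simp add: b_def)
  have M: "0 \<le> M" using U0 UM order_trans by blast
  have HM: "0 \<le> H M" by (rule H_nonneg[OF sf M])
  define e1 where "e1 = e / (2 * r ^ 4 * (b + 1))"
  define e2 where "e2 = e / (2 * r ^ 4 * (H M + 1))"
  have e12: "0 < e1" "0 < e2" using e r b HM by (auto simp: e1_def e2_def)
  obtain d where d: "0 < d" "H d \<le> e1" using H_small[OF sf e12(1)] by blast
  obtain s\<^sub>0 where s\<^sub>0: "0 < s\<^sub>0" "\<And>s. s \<in> good \<Longrightarrow> s < s\<^sub>0 \<Longrightarrow> measure lborel {x \<in> ball x0 R. d < U (x, s)} \<le> e2"
    using init[OF d(1) e12(2)] by blast
  have "(LBINT x. cutoff x0 r x * H (U (x, s))) \<le> e" if s: "s \<in> good" "s < s\<^sub>0" for s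
  proof -
    let ?S = "{x \<in> ball x0 R. d < U (x, s)}"
    have [measurable]: "?S \<in> sets borel" by measurable
    have fin: "emeasure lborel (ball x0 R) < \<infinity>" "emeasure lborel ?S < \<infinity>"
      by (rule emeasure_bounded_finite, rule bounded_subset[of "ball x0 R"]; auto)+
    have "(LBINT x. cutoff x0 r x * H (U (x, s)))
        \<le> (LBINT x. r ^ 4 * e1 * indicator (ball x0 R) x + r ^ 4 * H M * indicator ?S x)"
    proof (rule integral_mono[OF cutoff_H_integrable[OF r(1)]])
      show "integrable lborel (\<lambda>x. r ^ 4 * e1 * indicator (ball x0 R) x + r ^ 4 * H M * indicator ?S x)"
        using fin by (intro Bochner_Integration.integrable_add integrable_mult_right integrable_real_indicator) auto
      fix x
      have H: "0 \<le> H (U (x, s))" by (rule H_nonneg[OF sf U0])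
      show "cutoff x0 r x * H (U (x, s)) \<le> r ^ 4 * e1 * indicator (ball x0 R) x + r ^ 4 * H M * indicator ?S x"
      proof (cases "x \<in> ball x0 r")
        case True
        have "H (U (x, s)) \<le> e1 + H M * indicator ?S x"
        proof (cases "d < U (x, s)")
          case True
          then show ?thesis
            using H_mono[OF sf U0 UM, of "(x, s)"] \<open>x \<in> ball x0 r\<close> r e12 by (simp add: indicator_def)
        next
          case False
          then show ?thesis
            using H_mono[OF sf U0, of "(x, s)" d] d(2) HM by (simp add: indicator_def)
        qed
        then have "cutoff x0 r x * H (U (x, s)) \<le> r ^ 4 * (e1 + H M * indicator ?S x)"
          using r H by (intro mult_mono cutoff_le cutoff_nonneg) auto
        then show ?thesis using True r by (simp add: distrib_left mult.assoc)
      next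
        case False
        then show ?thesis using cutoff_eq_0[OF r(1) False] r e12 HM by (simp add: indicator_def)
      qed
    qed
    also have "\<dots> = r ^ 4 * e1 * b + r ^ 4 * H M * measure lborel ?S"
      using fin by (subst Bochner_Integration.integral_add)
        (auto simp: b_def intro!: integrable_mult_right integrable_real_indicator)
    also have "\<dots> \<le> r ^ 4 * e1 * b + r ^ 4 * H M * e2"
      using s\<^sub>0(2)[OF s] HM r by (intro add_left_mono mult_left_mono) auto
    also have "\<dots> \<le> e / 2 + e / 2"
    proof (rule add_mono)
      have "r ^ 4 * e1 * b = e / 2 * (b / (b + 1))" using r b by (simp add: e1_def)
      also have "\<dots> \<le> e / 2 * 1" using e b by (intro mult_left_mono) auto
      finally show "r ^ 4 * e1 * b \<le> e / 2" by simp
      have "r ^ 4 * H M * e2 = e / 2 * (H M / (H M + 1))" using r by (simp add: e2_def)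
      also have "\<dots> \<le> e / 2 * 1" using e HM by (intro mult_left_mono) auto
      finally show "r ^ 4 * H M * e2 \<le> e / 2" by simp
    qed
    finally show ?thesis by simp
  qed
  then show ?thesis using s\<^sub>0(1) by blast
qed

text \<open>
  By hypothesis (i), \<open>|F(U) D \<cdot> \<nabla>\<theta>| \<le> a b\<close> with \<open>a\<^sup>2 = |\<nabla>G(U)|\<^sup>2 \<theta>\<close> and \<open>b = 4 C\<^sub>1 r G(U)\<close>; half of \<open>a\<^sup>2\<close> is
  absorbed.
\<close>

lemma caccioppoli_between:
  assumes r: "0 < r" "r \<le> R" and st: "s \<in> good" "t \<in> good" "s < t"
  defines "q \<equiv> \<lambda>z. indicator (ball x0 R \<times> {s<..<t}) z * ((sqrt_deriv F (U z) * norm (D z))\<^sup>2 * cutoff x0 r (fst z))"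
  shows "integrable lborel q"
    and "(LBINT x. cutoff x0 r x * H (U (x, t))) + (LBINT z. q z) / 2
      \<le> (LBINT x. cutoff x0 r x * H (U (x, s)))
        + 8 * C\<^sub>1\<^sup>2 * r\<^sup>2 * (LBINT z. indicator (ball x0 r \<times> {s<..<t}) z * (G (U z))\<^sup>2)"
proof -
  let ?V = "ball x0 R \<times> {s<..<t}" and ?V' = "ball x0 r \<times> {s<..<t}"
  have st': "0 < s" "s < t" "t < T" using st good(2) by auto
  have M: "0 \<le> M" using U0 UM order_trans by blast
  have "integrable lborel (\<lambda>z. r ^ 4 * (indicator ?V z *\<^sub>R (sqrt_deriv F (U z) * norm (D z))\<^sup>2))"
    using Q_int[OF st'] unfolding set_integrable_def by (intro integrable_mult_right) auto
  then show q: "integrable lborel q"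
  proof (rule Bochner_Integration.integrable_bound)
    show "AE z in lborel. norm (q z) \<le> norm (r ^ 4 * (indicator ?V z *\<^sub>R (sqrt_deriv F (U z) * norm (D z))\<^sup>2))"
    proof (rule AE_I2)
      fix z
      have "(sqrt_deriv F (U z) * norm (D z))\<^sup>2 * cutoff x0 r (fst z) \<le> (sqrt_deriv F (U z) * norm (D z))\<^sup>2 * r ^ 4"
        by (intro mult_left_mono cutoff_le r) auto
      then show "norm (q z) \<le> norm (r ^ 4 * (indicator ?V z *\<^sub>R (sqrt_deriv F (U z) * norm (D z))\<^sup>2))"
        using cutoff_nonneg[of x0 r "fst z"] by (auto simp: q_def indicator_def abs_mult mult.commute)
    qed
  qed (simp add: q_def)
  define f where "f z = indicator ?V z * (F (U z) * (D z \<bullet> cutoff_grad x0 r (fst z)))" for z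
  have "integrable lborel (\<lambda>z. (F M * (4 * r * r\<^sup>2)) * norm (indicator ?V z *\<^sub>R D z))"
    using D_int[OF st'] unfolding set_integrable_def by (intro integrable_mult_right integrable_norm) auto
  then have f: "integrable lborel f"
  proof (rule Bochner_Integration.integrable_bound)
    have "norm (f z) \<le> (F M * (4 * r * r\<^sup>2)) * norm (indicator ?V z *\<^sub>R D z)" for z
    proof (cases "z \<in> ?V")
      case True
      have "norm (cutoff_grad x0 r x) \<le> 4 * r * r\<^sup>2" for x
        using r(1) by (intro order_trans[OF norm_cutoff_grad] mult_left_mono sqrt_cutoff_le) auto
      then have "norm (D z) * norm (cutoff_grad x0 r (fst z)) \<le> norm (D z) * (4 * r * r\<^sup>2)"
        by (intro mult_left_mono) auto
      then have "\<bar>D z \<bullet> cutoff_grad x0 r (fst z)\<bar> \<le> norm (D z) * (4 * r * r\<^sup>2)"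
        using Cauchy_Schwarz_ineq2 order_trans by blast
      then have "\<bar>F (U z)\<bar> * \<bar>D z \<bullet> cutoff_grad x0 r (fst z)\<bar> \<le> F M * (norm (D z) * (4 * r * r\<^sup>2))"
        using F_mono[OF sf U0 UM] F_nonneg[OF sf U0] F_nonneg[OF sf M] by (intro mult_mono) auto
      then show ?thesis using True by (simp add: f_def abs_mult mult_ac)
    qed (simp add: f_def)
    then show "AE z in lborel. norm (f z) \<le> norm ((F M * (4 * r * r\<^sup>2)) * norm (indicator ?V z *\<^sub>R D z))"
      unfolding real_norm_def[of "_ * norm _"] by (intro AE_I2 order_trans[OF _ abs_ge_self])
  qed (unfold f_def, measurable)
  define w where "w z = indicator ?V' z * (G (U z))\<^sup>2" for z
  have w: "integrable lborel w"
  proof (rule Bochner_Integration.integrable_bound)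
    have "emeasure lborel ?V' < \<infinity>" by (intro emeasure_bounded_finite bounded_Times) auto
    then show "integrable lborel (\<lambda>z. (G M)\<^sup>2 * indicator ?V' z)"
      by (intro integrable_mult_right integrable_real_indicator) auto
    show "AE z in lborel. norm (w z) \<le> norm ((G M)\<^sup>2 * indicator ?V' z)"
      using G_mono[OF sf U0 UM] G_nonneg[OF sf U0] by (auto simp: w_def indicator_def intro!: power_mono)
  qed (unfold w_def, measurable)
  have pt: "q z / 2 - 8 * C\<^sub>1\<^sup>2 * r\<^sup>2 * w z \<le> f z + q z" for z
  proof (cases "z \<in> ?V'")
    case True
    then have zV: "z \<in> ?V" using r by auto
    define a where "a = sqrt_deriv F (U z) * norm (D z) * sqrt (cutoff x0 r (fst z))"
    define b where "b = 4 * C\<^sub>1 * r * G (U z)"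
    have g: "0 \<le> sqrt_deriv F (U z)" by (rule sqrt_deriv_nonneg[OF sf])
    have Gz: "0 \<le> G (U z)" by (rule G_nonneg[OF sf U0])
    have "\<bar>f z\<bar> \<le> F (U z) * (norm (D z) * norm (cutoff_grad x0 r (fst z)))"
      using zV Cauchy_Schwarz_ineq2[of "D z" "cutoff_grad x0 r (fst z)"] F_nonneg[OF sf U0, of z]
      by (auto simp: f_def abs_mult intro!: mult_left_mono)
    also have "\<dots> \<le> (C\<^sub>1 * sqrt_deriv F (U z) * G (U z)) * (norm (D z) * (4 * r * sqrt (cutoff x0 r (fst z))))"
      using F_le'[of z] norm_cutoff_grad[OF r(1)] pos g Gz by (intro mult_mono) auto
    also have "\<dots> = a * b" by (simp add: a_def b_def)
    also have "\<dots> \<le> a\<^sup>2 / 2 + b\<^sup>2 / 2" using sum_squares_bound[of a b] by simp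
    also have "a\<^sup>2 = q z" using zV cutoff_nonneg[of x0 r "fst z"] by (simp add: a_def q_def power_mult_distrib)
    also have "b\<^sup>2 / 2 = 8 * C\<^sub>1\<^sup>2 * r\<^sup>2 * w z" using True by (simp add: b_def w_def power_mult_distrib)
    finally show ?thesis by simp
  next
    case False
    then have "f z = 0" "q z = 0" "w z = 0"
      using cutoff_eq_0[OF r(1), of "fst z" x0] by (auto simp: f_def q_def w_def indicator_def mem_Times_iff)
    then show ?thesis by simp
  qed
  have "(LBINT z. q z) / 2 - 8 * C\<^sub>1\<^sup>2 * r\<^sup>2 * (LBINT z. w z) = (LBINT z. q z / 2 - 8 * C\<^sub>1\<^sup>2 * r\<^sup>2 * w z)"
    using q w by simp
  also have "\<dots> \<le> (LBINT z. f z + q z)"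
    by (intro integral_mono pt) (use q w f in auto)
  also have "\<dots> \<le> (LBINT x. cutoff x0 r x * H (U (x, s))) - (LBINT x. cutoff x0 r x * H (U (x, t)))"
    using ineq[OF r st] by (simp add: f_def q_def distrib_left)
  finally show "(LBINT x. cutoff x0 r x * H (U (x, t))) + (LBINT z. q z) / 2
      \<le> (LBINT x. cutoff x0 r x * H (U (x, s)))
        + 8 * C\<^sub>1\<^sup>2 * r\<^sup>2 * (LBINT z. indicator ?V' z * (G (U z))\<^sup>2)"
    unfolding w_def by simp
qed

text \<open>
  Let the initial time tend to zero through good times.  On the inner ball the cutoff is at least
  \<open>((r + \<delta>) \<delta>)\<^sup>2\<close>, and division by this constant produces \<open>1 / \<delta>\<^sup>2\<close>.
\<close>

lemma caccioppoli:
  assumes r: "0 < r" "0 < \<delta>" "r + \<delta> \<le> R" and t: "t \<in> good" and s: "s \<in> {0<..<t}"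
  shows "(\<integral>\<^sup>+x\<in>ball x0 r. ennreal (H (U (x, t))) \<partial>lborel)
      + (\<integral>\<^sup>+z\<in>ball x0 r \<times> {s<..<t}. ennreal ((sqrt_deriv F (U z) * norm (D z))\<^sup>2) \<partial>lborel) / 2
      \<le> ennreal (8 * C\<^sub>1\<^sup>2 / \<delta>\<^sup>2) * (\<integral>\<^sup>+z\<in>ball x0 (r + \<delta>) \<times> {0<..<t}. ennreal ((G (U z))\<^sup>2) \<partial>lborel)"
proof -
  let ?r = "r + \<delta>"
  let ?X = "LBINT x. cutoff x0 ?r x * H (U (x, t))"
  let ?IH = "\<integral>\<^sup>+x\<in>ball x0 r. ennreal (H (U (x, t))) \<partial>lborel"
  let ?IQ = "\<integral>\<^sup>+z\<in>ball x0 r \<times> {s<..<t}. ennreal ((sqrt_deriv F (U z) * norm (D z))\<^sup>2) \<partial>lborel"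
  let ?A = "\<integral>\<^sup>+z\<in>ball x0 ?r \<times> {0<..<t}. ennreal ((G (U z))\<^sup>2) \<partial>lborel"
  define c where "c = (?r * \<delta>)\<^sup>2"
  have c: "0 < c" using r by (simp add: c_def)
  have r': "0 < ?r" using r by simp
  have low: "c * indicator (ball x0 r) x \<le> cutoff x0 ?r x" for x
    using cutoff_lower[OF r(1,2), of x x0] cutoff_nonneg[of x0 ?r x] by (auto simp: c_def indicator_def)
  have IH: "ennreal c * ?IH \<le> ennreal ?X"
  proof -
    have H: "0 \<le> H (U (x, t))" for x by (rule H_nonneg[OF sf U0])
    have "ennreal c * ?IH = (\<integral>\<^sup>+x. ennreal c * (ennreal (H (U (x, t))) * indicator (ball x0 r) x) \<partial>lborel)"
      by (rule nn_integral_cmult[symmetric]) measurable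
    also have "\<dots> \<le> (\<integral>\<^sup>+x. ennreal (cutoff x0 ?r x * H (U (x, t))) \<partial>lborel)"
    proof (rule nn_integral_mono)
      fix x
      have "c * indicator (ball x0 r) x * H (U (x, t)) \<le> cutoff x0 ?r x * H (U (x, t))"
        using low[of x] H[of x] by (rule mult_right_mono)
      then show "ennreal c * (ennreal (H (U (x, t))) * indicator (ball x0 r) x) \<le> ennreal (cutoff x0 ?r x * H (U (x, t)))"
        using c by (auto simp: indicator_def ennreal_mult'[symmetric] intro!: ennreal_leI split: if_splits)
    qed
    also have "\<dots> = ennreal ?X"
      by (rule nn_integral_eq_integral[OF cutoff_H_integrable[OF r']]) (intro AE_I2 mult_nonneg_nonneg H cutoff_nonneg)
    finally show ?thesis .
  qed
  have eps: "ennreal c * (?IH + ?IQ / 2) \<le> ennreal (8 * C\<^sub>1\<^sup>2 * ?r\<^sup>2) * ?A + ennreal e" if e: "0 < e" for e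
  proof -
    obtain s\<^sub>0 where s\<^sub>0: "0 < s\<^sub>0" "\<And>\<sigma>. \<sigma> \<in> good \<Longrightarrow> \<sigma> < s\<^sub>0 \<Longrightarrow> (LBINT x. cutoff x0 ?r x * H (U (x, \<sigma>))) \<le> e"
      using initial_energy_small[OF r' r(3) e] by blast
    have "\<exists>\<sigma>\<in>{0<..<min s s\<^sub>0}. \<sigma> \<in> {0<..<T} \<longrightarrow> \<sigma> \<in> good"
      by (rule AE_imp_ex_Ioo[OF good(1)]) (use s s\<^sub>0 in auto)
    then obtain \<sigma> where \<sigma>: "\<sigma> \<in> good" "\<sigma> < s" "\<sigma> < s\<^sub>0" "\<sigma> < t" "0 < \<sigma>"
      using s t good(2) by fastforce
    define q where "q z = indicator (ball x0 R \<times> {\<sigma><..<t}) z * ((sqrt_deriv F (U z) * norm (D z))\<^sup>2 * cutoff x0 ?r (fst z))" for z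
    define w where "w z = indicator (ball x0 ?r \<times> {\<sigma><..<t}) z * (G (U z))\<^sup>2" for z
    note cac = caccioppoli_between[OF r' r(3) \<sigma>(1) t \<sigma>(4), folded q_def w_def]
    have q0: "0 \<le> q z" for z unfolding q_def by (intro mult_nonneg_nonneg cutoff_nonneg) auto
    have w0: "0 \<le> w z" for z by (auto simp: w_def)
    have IQ: "ennreal c * ?IQ \<le> ennreal (LBINT z. q z)"
    proof -
      have "ennreal c * ?IQ = (\<integral>\<^sup>+z. ennreal c * (ennreal ((sqrt_deriv F (U z) * norm (D z))\<^sup>2) * indicator (ball x0 r \<times> {s<..<t}) z) \<partial>lborel)"
        by (rule nn_integral_cmult[symmetric]) measurable
      also have "\<dots> \<le> (\<integral>\<^sup>+z. ennreal (q z) \<partial>lborel)"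
      proof (rule nn_integral_mono)
        fix z
        show "ennreal c * (ennreal ((sqrt_deriv F (U z) * norm (D z))\<^sup>2) * indicator (ball x0 r \<times> {s<..<t}) z) \<le> ennreal (q z)"
        proof (cases "z \<in> ball x0 r \<times> {s<..<t}")
          case True
          then have "z \<in> ball x0 R \<times> {\<sigma><..<t}" "c \<le> cutoff x0 ?r (fst z)"
            using r \<sigma> low[of "fst z"] by (auto simp: indicator_def)
          then show ?thesis
            using True c by (auto simp: q_def ennreal_mult'[symmetric] mult.commute intro!: ennreal_leI mult_right_mono)
        qed simp
      qed
      also have "\<dots> = ennreal (LBINT z. q z)"
        by (rule nn_integral_eq_integral[OF cac(1)]) (use q0 in auto)
      finally show ?thesis .
    qed
    have W: "ennreal (LBINT z. w z) \<le> ?A"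
    proof (cases "integrable lborel w")
      case True
      have "ennreal (LBINT z. w z) = (\<integral>\<^sup>+z. ennreal (w z) \<partial>lborel)"
        by (rule nn_integral_eq_integral[symmetric, OF True]) (use w0 in auto)
      also have "\<dots> \<le> ?A"
        using \<sigma> by (intro nn_integral_mono) (auto simp: w_def indicator_def)
      finally show ?thesis .
    qed (simp add: not_integrable_integral_eq)
    have Q0: "0 \<le> (LBINT z. q z)" "0 \<le> (LBINT z. w z)"
      by (intro Bochner_Integration.integral_nonneg q0 w0)+
    have X0: "0 \<le> ?X"
      by (intro Bochner_Integration.integral_nonneg mult_nonneg_nonneg cutoff_nonneg H_nonneg[OF sf] U0)
    have "ennreal c * (?IH + ?IQ / 2) = ennreal c * ?IH + (ennreal c * ?IQ) / 2"
      by (simp add: distrib_left ennreal_times_divide)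
    also have "\<dots> \<le> ennreal ?X + ennreal (LBINT z. q z) / 2"
      by (intro add_mono IH divide_right_mono_ennreal IQ)
    also have "\<dots> = ennreal (?X + (LBINT z. q z) / 2)"
      using X0 Q0 by (simp add: ennreal_plus ennreal_divide_numeral)
    also have "\<dots> \<le> ennreal (8 * C\<^sub>1\<^sup>2 * ?r\<^sup>2 * (LBINT z. w z) + e)"
      using cac(2) s\<^sub>0(2)[OF \<sigma>(1,3)] by (intro ennreal_leI) linarith
    also have "\<dots> = ennreal (8 * C\<^sub>1\<^sup>2 * ?r\<^sup>2) * ennreal (LBINT z. w z) + ennreal e"
      using Q0 e by (simp add: ennreal_plus ennreal_mult)
    also have "\<dots> \<le> ennreal (8 * C\<^sub>1\<^sup>2 * ?r\<^sup>2) * ?A + ennreal e"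
      by (intro add_right_mono mult_left_mono W) auto
    finally show ?thesis .
  qed
  have "ennreal c * (?IH + ?IQ / 2) \<le> ennreal (8 * C\<^sub>1\<^sup>2 * ?r\<^sup>2) * ?A"
    by (rule ennreal_le_epsilon) (rule eps)
  also have "ennreal (8 * C\<^sub>1\<^sup>2 * ?r\<^sup>2) = ennreal c * ennreal (8 * C\<^sub>1\<^sup>2 / \<delta>\<^sup>2)"
    using r c by (simp add: ennreal_mult'[symmetric] c_def power_mult_distrib)
  finally have "ennreal c * (?IH + ?IQ / 2) \<le> ennreal c * (ennreal (8 * C\<^sub>1\<^sup>2 / \<delta>\<^sup>2) * ?A)"
    by (simp add: mult.assoc)
  then show ?thesis using c by (simp add: ennreal_mult_le_mult_iff)
qed

lemma energy_H:
  assumes "0 < r" "0 < \<delta>" "r + \<delta> \<le> R"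
  shows "AE t in lborel. t \<in> {0<..<T} \<longrightarrow>
      (\<integral>\<^sup>+x\<in>ball x0 r. ennreal (H (U (x, t))) \<partial>lborel)
      \<le> ennreal (16 * C\<^sub>1\<^sup>2 / \<delta>\<^sup>2) * (\<integral>\<^sup>+z\<in>ball x0 (r + \<delta>) \<times> {0<..<t}. ennreal ((G (U z))\<^sup>2) \<partial>lborel)"
  using good(1)
proof eventually_elim
  case (elim t)
  show ?case
  proof
    assume t: "t \<in> {0<..<T}"
    let ?A = "\<integral>\<^sup>+z\<in>ball x0 (r + \<delta>) \<times> {0<..<t}. ennreal ((G (U z))\<^sup>2) \<partial>lborel"
    have "(\<integral>\<^sup>+x\<in>ball x0 r. ennreal (H (U (x, t))) \<partial>lborel) \<le> ennreal (8 * C\<^sub>1\<^sup>2 / \<delta>\<^sup>2) * ?A"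
      by (rule order_trans[OF _ caccioppoli[OF assms, of t "t / 2"]]) (use t elim in \<open>auto intro: add_increasing2\<close>)
    also have "\<dots> \<le> ennreal (16 * C\<^sub>1\<^sup>2 / \<delta>\<^sup>2) * ?A"
      by (intro mult_right_mono ennreal_leI divide_right_mono) auto
    finally show "(\<integral>\<^sup>+x\<in>ball x0 r. ennreal (H (U (x, t))) \<partial>lborel) \<le> ennreal (16 * C\<^sub>1\<^sup>2 / \<delta>\<^sup>2) * ?A" .
  qed
qed

lemma energy_D:
  assumes "0 < r" "0 < \<delta>" "r + \<delta> \<le> R"
  shows "AE t in lborel. t \<in> {0<..<T} \<longrightarrow> (\<forall>s\<in>{0<..<t}.
      (\<integral>\<^sup>+z\<in>ball x0 r \<times> {s<..<t}. ennreal ((sqrt_deriv F (U z) * norm (D z))\<^sup>2) \<partial>lborel)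
      \<le> ennreal (16 * C\<^sub>1\<^sup>2 / \<delta>\<^sup>2) * (\<integral>\<^sup>+z\<in>ball x0 (r + \<delta>) \<times> {0<..<t}. ennreal ((G (U z))\<^sup>2) \<partial>lborel))"
  using good(1)
proof eventually_elim
  case (elim t)
  show ?case
  proof (intro impI ballI)
    fix s assume t: "t \<in> {0<..<T}" and s: "s \<in> {0<..<t}"
    let ?A = "\<integral>\<^sup>+z\<in>ball x0 (r + \<delta>) \<times> {0<..<t}. ennreal ((G (U z))\<^sup>2) \<partial>lborel"
    let ?I = "\<integral>\<^sup>+z\<in>ball x0 r \<times> {s<..<t}. ennreal ((sqrt_deriv F (U z) * norm (D z))\<^sup>2) \<partial>lborel"
    have "?I / 2 \<le> ennreal (8 * C\<^sub>1\<^sup>2 / \<delta>\<^sup>2) * ?A"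
      by (rule order_trans[OF _ caccioppoli[OF assms, of t s]]) (use t s elim in \<open>auto intro: add_increasing\<close>)
    then have "2 * (?I / 2) \<le> 2 * (ennreal (8 * C\<^sub>1\<^sup>2 / \<delta>\<^sup>2) * ?A)" by (rule mult_left_mono) simp
    also have "2 * (?I / 2) = ?I" by (simp add: ennreal_times_divide mult.commute[of 2] mult_divide_eq_ennreal)
    also have "2 * (ennreal (8 * C\<^sub>1\<^sup>2 / \<delta>\<^sup>2) * ?A) = ennreal (16 * C\<^sub>1\<^sup>2 / \<delta>\<^sup>2) * ?A"
    proof -
      have "2 * ennreal (8 * C\<^sub>1\<^sup>2 / \<delta>\<^sup>2) = ennreal (2 * (8 * C\<^sub>1\<^sup>2 / \<delta>\<^sup>2))"
        by (subst ennreal_mult) auto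
      also have "2 * (8 * C\<^sub>1\<^sup>2 / \<delta>\<^sup>2) = 16 * C\<^sub>1\<^sup>2 / \<delta>\<^sup>2" by simp
      finally show ?thesis by (simp only: mult.assoc[symmetric])
    qed
    finally show "?I \<le> ennreal (16 * C\<^sub>1\<^sup>2 / \<delta>\<^sup>2) * ?A" .
  qed
qed

end

section \<open>Borel versions of the solution and of its gradient\<close>

lemma AE_lborel_snd:
  fixes Q :: "'a::euclidean_space \<times> 'b::euclidean_space \<Rightarrow> bool"
  assumes "AE z in lborel. Q z"
  shows "AE \<tau> in lborel. AE x in lborel. Q (x, \<tau>)"
proof -
  obtain N where N: "{z. \<not> Q z} \<subseteq> N" "N \<in> sets borel" "emeasure lborel N = 0"
    using assms by (auto elim!: AE_E)
  have [measurable]: "N \<in> sets borel" by fact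
  have "(\<integral>\<^sup>+\<tau>. \<integral>\<^sup>+x. indicator N (x, \<tau>) \<partial>lborel \<partial>lborel) = (\<integral>\<^sup>+z. indicator N z \<partial>lborel)"
    by (rule nn_integral_lborel_snd[symmetric]) auto
  also have "\<dots> = 0" using N by simp
  finally have "AE \<tau> in lborel. (\<integral>\<^sup>+x. indicator N (x, \<tau>) \<partial>lborel) = 0"
    by (subst (asm) nn_integral_0_iff_AE) auto
  then show ?thesis
  proof eventually_elim
    case (elim \<tau>)
    then have "AE x in lborel. indicator N (x, \<tau>) = (0::ennreal)"
      by (subst (asm) nn_integral_0_iff_AE) auto
    then show ?case by eventually_elim (use N(1) in \<open>auto simp: indicator_def\<close>)
  qed
qed

lemma borel_measurable_lebesgue_AE:
  fixes f g :: "'a::euclidean_space \<Rightarrow> 'b::topological_space"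
  assumes "g \<in> borel_measurable borel" "AE z in lborel. f z = g z"
  shows "f \<in> borel_measurable lebesgue"
proof (rule measurableI)
  fix S :: "'b set" assume S: "S \<in> sets borel"
  show "f -` S \<inter> space lebesgue \<in> sets lebesgue"
  proof (rule completion.in_sets_AE)
    have "AE z in lebesgue. f z = g z" using assms(2) by (rule AE_completion)
    then show "AE z in lebesgue. (z \<in> g -` S \<inter> space lebesgue) = (z \<in> f -` S \<inter> space lebesgue)"
      by eventually_elim auto
    have "g -` S \<inter> space lborel \<in> sets lborel"
      using assms(1) S by (intro measurable_sets) auto
    then show "g -` S \<inter> space lebesgue \<in> sets lebesgue" by auto
  qed auto
qed auto

text \<open>
  Lebesgue measure is complete, so \<open>f\<close> inherits measurability on \<open>S\<close> from its Borel version.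
\<close>

lemma lebesgue_integral_borel_version:
  fixes f g :: "'a::euclidean_space \<Rightarrow> real"
  assumes g: "g \<in> borel_measurable borel" and ae: "AE z in lborel. indicator S z * f z = g z"
  shows "(LINT z:S|lebesgue. f z) = (LBINT z. g z)"
    and "set_integrable lebesgue S f \<longleftrightarrow> integrable lborel g"
proof -
  have m: "(\<lambda>z. indicator S z *\<^sub>R f z) \<in> borel_measurable lebesgue"
    using borel_measurable_lebesgue_AE[OF g ae] by simp
  have g': "g \<in> borel_measurable lebesgue" using g by (simp add: measurable_completion)
  have ae': "AE z in lebesgue. indicator S z *\<^sub>R f z = g z"
    using AE_completion[OF ae] by simp
  show "(LINT z:S|lebesgue. f z) = (LBINT z. g z)"
    unfolding set_lebesgue_integral_def integral_cong_AE[OF m g' ae']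
    by (rule integral_completion) (use g in simp)
  show "set_integrable lebesgue S f \<longleftrightarrow> integrable lborel g"
    unfolding set_integrable_def integrable_cong_AE[OF m g' ae']
    by (rule integrable_completion) (use g in simp)
qed

lemma ex_borel_version:
  fixes f :: "'a::euclidean_space \<Rightarrow> 'b::euclidean_space"
  assumes f: "f \<in> borel_measurable (lebesgue_on S)" and S: "S \<in> sets lebesgue"
  shows "\<exists>g\<in>borel_measurable borel. AE z in lborel. z \<in> S \<longrightarrow> f z = g z"
proof -
  have "(\<lambda>z. indicator S z *\<^sub>R f z) \<in> borel_measurable lebesgue"
    using f S by (subst (asm) borel_measurable_restrict_space_iff) auto
  then have "\<exists>g\<in>borel_measurable lborel. AE z in lborel. (indicator S z *\<^sub>R f z) \<bullet> b = g z" for b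
    by (intro completion_ex_borel_measurable_real borel_measurable_inner) auto
  then obtain g where g: "\<And>b. g b \<in> borel_measurable borel"
      "\<And>b. AE z in lborel. (indicator S z *\<^sub>R f z) \<bullet> b = g b z"
    by (simp add: Bex_def) metis
  show ?thesis
  proof
    show "(\<lambda>z. \<Sum>b\<in>Basis. g b z *\<^sub>R b) \<in> borel_measurable borel"
      using g(1) by (intro borel_measurable_sum borel_measurable_scaleR) auto
    have "AE z in lborel. \<forall>b\<in>Basis. (indicator S z *\<^sub>R f z) \<bullet> b = g b z"
      using g(2) by (intro AE_finite_allI) auto
    then show "AE z in lborel. z \<in> S \<longrightarrow> f z = (\<Sum>b\<in>Basis. g b z *\<^sub>R b)"
    proof eventually_elim
      case (elim z)
      show ?case
      proof
        assume "z \<in> S"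
        then have "(\<Sum>b\<in>Basis. g b z *\<^sub>R b) = (\<Sum>b\<in>Basis. (f z \<bullet> b) *\<^sub>R b)"
          using elim by (intro sum.cong) auto
        then show "f z = (\<Sum>b\<in>Basis. g b z *\<^sub>R b)" by (simp add: euclidean_representation)
      qed
    qed
  qed
qed

lemma lipschitz_test_function_cutoff:
  assumes "0 < r" "cball x0 r \<subseteq> \<Omega>"
  shows "lipschitz_test_function \<Omega> (cutoff x0 r)"
proof -
  have sub: "closure {x. cutoff x0 r x \<noteq> 0} \<subseteq> cball x0 r"
  proof (rule closure_minimal)
    show "{x. cutoff x0 r x \<noteq> 0} \<subseteq> cball x0 r"
      using cutoff_eq_0[OF assms(1), of _ x0] by (force simp: less_imp_le)
  qed auto
  then have "compact (closure {x. cutoff x0 r x \<noteq> 0})"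
    by (metis bounded_cball bounded_subset closed_closure compact_eq_bounded_closed)
  then show ?thesis
    using sub assms lipschitz_on_subset[OF cutoff_lipschitz[OF assms(1)], of \<Omega>]
    unfolding lipschitz_test_function_def compactly_contained_def by blast
qed

lemma grad_cutoff: "grad (cutoff x0 r) x = cutoff_grad x0 r x"
proof -
  have "frechet_derivative (cutoff x0 r) (at x) = (\<lambda>v. cutoff_grad x0 r x \<bullet> v)"
    by (rule frechet_derivative_at[OF cutoff_has_derivative, symmetric])
  then show ?thesis by (simp add: grad_def vec_eq_iff inner_axis)
qed

text \<open>
  The coordinate directions add up to an arbitrary one.  The products are integrable because the
  support of \<open>\<eta>\<close> is compact in the cylinder, hence stays away from the initial time.
\<close>

lemma weak_space_gradient_borel_version:
  fixes U :: "(real ^ 'n) \<times> real \<Rightarrow> real" and D :: "(real ^ 'n) \<times> real \<Rightarrow> real ^ 'n"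
  assumes grad: "weak_space_gradient \<Omega> T u Du"
    and [measurable]: "U \<in> borel_measurable borel" "D \<in> borel_measurable borel"
    and bU: "\<And>z. \<bar>U z\<bar> \<le> M"
    and Uu: "AE z in lborel. z \<in> \<Omega> \<times> {0<..<T} \<longrightarrow> U z = u z"
    and Dd: "AE z in lborel. z \<in> \<Omega> \<times> {0<..<T} \<longrightarrow> D z = Du z"
    and sub: "B \<subseteq> \<Omega>" and "0 < T"
    and D_int: "\<And>s t. 0 < s \<Longrightarrow> s < t \<Longrightarrow> t < T \<Longrightarrow> set_integrable lborel (B \<times> {s<..<t}) D"
    and \<eta>: "C1_test_function (B \<times> {0<..<T}) \<eta>"
  shows "(LBINT z. U z * frechet_derivative \<eta> (at z) (v, 0)) = - (LBINT z. (D z \<bullet> v) * \<eta> z)"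
proof -
  define A where "A = closure {z. \<eta> z \<noteq> 0}"
  let ?d = "\<lambda>v z. frechet_derivative \<eta> (at z) v"
  have C: "C1 \<eta>" by (rule C1_test_function_C1[OF \<eta>])
  have K: "compact A" "A \<subseteq> B \<times> {0<..<T}"
    using \<eta> by (auto simp: C1_test_function_def compactly_contained_def A_def)
  have K\<Omega>: "A \<subseteq> \<Omega> \<times> {0<..<T}" using K sub by auto
  have \<eta>\<Omega>: "C1_test_function (\<Omega> \<times> {0<..<T}) \<eta>"
    using \<eta> K\<Omega> unfolding C1_test_function_def compactly_contained_def A_def by auto
  have off: "\<eta> z = 0" "?d v z = 0" if "z \<notin> A" for z v
    using that closure_subset[of "{z. \<eta> z \<noteq> 0}"] frechet_derivative_0_off_support[OF that[unfolded A_def]]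
    by (auto simp: A_def)
  have c: "continuous_on S \<eta>" "continuous_on S (?d v)" for S v
    by (rule C1_continuous[OF C] C1_continuous_derivative[OF C])+
  have [measurable]: "\<eta> \<in> borel_measurable borel" "?d v \<in> borel_measurable borel" for v
    by (intro borel_measurable_continuous_onI c)+
  have [measurable]: "(\<lambda>z. D z $ i) \<in> borel_measurable borel" for i
    using borel_measurable_inner[of D borel "\<lambda>_. axis i 1"] by (simp add: inner_axis)
  have [measurable]: "A \<in> sets borel" by (auto simp: A_def)
  have finK: "emeasure lborel A < \<infinity>" by (rule emeasure_bounded_finite[OF compact_imp_bounded[OF K(1)]])
  have intU: "integrable lborel (\<lambda>z. U z * ?d v z)" for v
  proof -
    have "bounded (?d v ` A)" by (intro compact_imp_bounded compact_continuous_image c K)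
    then obtain L where L: "\<And>z. z \<in> A \<Longrightarrow> \<bar>?d v z\<bar> \<le> L"
      unfolding bounded_iff by (metis imageI real_norm_def)
    show ?thesis
    proof (rule Bochner_Integration.integrable_bound)
      show "integrable lborel (\<lambda>z. \<bar>M * L\<bar> * indicator A z)"
        using finK by (intro integrable_mult_right integrable_real_indicator) auto
      show "AE z in lborel. norm (U z * ?d v z) \<le> norm (\<bar>M * L\<bar> * indicator A z)"
      proof (rule AE_I2)
        fix z
        show "norm (U z * ?d v z) \<le> norm (\<bar>M * L\<bar> * indicator A z)"
        proof (cases "z \<in> A")
          case True
          have "0 \<le> M" using bU[of z] by linarith
          then have "\<bar>U z\<bar> * \<bar>?d v z\<bar> \<le> M * L" using bU L[OF True] by (intro mult_mono) auto
          then have "norm (U z * ?d v z) \<le> \<bar>M * L\<bar>" unfolding real_norm_def abs_mult[of "U z"] by linarith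
          then show ?thesis using True by simp
        next
          case False
          then have "?d v z = 0" by (rule off(2))
          then show ?thesis by simp
        qed
      qed
    qed measurable
  qed
  have intD: "integrable lborel (\<lambda>z. D z $ i * \<eta> z)" for i
  proof -
    have "bounded (\<eta> ` A)" by (intro compact_imp_bounded compact_continuous_image c K)
    then obtain L where L: "\<And>z. z \<in> A \<Longrightarrow> \<bar>\<eta> z\<bar> \<le> L"
      unfolding bounded_iff by (metis imageI real_norm_def)
    have cpt: "compact (snd ` A)" by (intro compact_continuous_image K continuous_intros)
    have "\<exists>s t. 0 < s \<and> s < t \<and> t < T \<and> A \<subseteq> B \<times> {s<..<t}"
    proof (cases "A = {}")
      case True
      then show ?thesis using \<open>0 < T\<close> by (intro exI[of _ "T / 3"] exI[of _ "T / 2"]) auto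
    next
      case False
      then have ne: "snd ` A \<noteq> {}" by blast
      obtain a where a: "a \<in> snd ` A" "\<And>t. t \<in> snd ` A \<Longrightarrow> a \<le> t"
        using compact_attains_inf[OF cpt ne] by blast
      obtain b where b: "b \<in> snd ` A" "\<And>t. t \<in> snd ` A \<Longrightarrow> t \<le> b"
        using compact_attains_sup[OF cpt ne] by blast
      have "0 < a" "a \<le> b" "b < T" using a b K(2) by auto
      moreover have "z \<in> B \<times> {a / 2<..<(b + T) / 2}" if "z \<in> A" for z
      proof -
        have "fst z \<in> B" "snd z \<in> snd ` A" using that K(2) by auto
        then show ?thesis using a(2)[of "snd z"] b(2)[of "snd z"] \<open>0 < a\<close> \<open>b < T\<close> by (auto simp: mem_Times_iff)
      qed
      ultimately show ?thesis by (intro exI[of _ "a / 2"] exI[of _ "(b + T) / 2"]) auto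
    qed
    then obtain s t where st: "0 < s" "s < t" "t < T" "A \<subseteq> B \<times> {s<..<t}" by blast
    have "integrable lborel (\<lambda>z. \<bar>L\<bar> * norm (indicator (B \<times> {s<..<t}) z *\<^sub>R D z))"
      using D_int[OF st(1-3)] unfolding set_integrable_def by (intro integrable_mult_right integrable_norm) auto
    then show ?thesis
    proof (rule Bochner_Integration.integrable_bound)
      show "AE z in lborel. norm (D z $ i * \<eta> z) \<le> norm (\<bar>L\<bar> * norm (indicator (B \<times> {s<..<t}) z *\<^sub>R D z))"
      proof (rule AE_I2)
        fix z
        show "norm (D z $ i * \<eta> z) \<le> norm (\<bar>L\<bar> * norm (indicator (B \<times> {s<..<t}) z *\<^sub>R D z))"
        proof (cases "z \<in> A")
          case True
          have "\<bar>D z $ i\<bar> * \<bar>\<eta> z\<bar> \<le> norm (D z) * \<bar>L\<bar>"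
            using L[OF True] component_le_norm_cart[of "D z" i] by (intro mult_mono) auto
          moreover have "indicator (B \<times> {s<..<t}) z = (1::real)" using True st(4) by (auto simp: indicator_def)
          ultimately show ?thesis by (simp add: abs_mult mult.commute)
        next
          case False
          then have "\<eta> z = 0" by (rule off(1))
          then show ?thesis by simp
        qed
      qed
      show "(\<lambda>z. D z $ i * \<eta> z) \<in> borel_measurable lborel" by measurable
    qed
  qed
  have comp: "(LBINT z. U z * ?d (axis i 1, 0) z) = - (LBINT z. D z $ i * \<eta> z)" for i
  proof -
    have "(LINT z:\<Omega> \<times> {0<..<T}|lebesgue. u z * ?d (axis i 1, 0) z) = - (LINT z:\<Omega> \<times> {0<..<T}|lebesgue. Du z $ i * \<eta> z)"
      using grad \<eta>\<Omega> unfolding weak_space_gradient_def weak_derivative_def by blast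
    also have "(LINT z:\<Omega> \<times> {0<..<T}|lebesgue. u z * ?d (axis i 1, 0) z) = (LBINT z. U z * ?d (axis i 1, 0) z)"
    proof (rule lebesgue_integral_borel_version(1))
      show "AE z in lborel. indicator (\<Omega> \<times> {0<..<T}) z * (u z * ?d (axis i 1, 0) z) = U z * ?d (axis i 1, 0) z"
        using Uu
      proof eventually_elim
        case (elim z)
        then show ?case using off(2)[of z "(axis i 1, 0)"] K\<Omega>
          by (cases "z \<in> A") (auto simp: indicator_def)
      qed
    qed measurable
    also have "(LINT z:\<Omega> \<times> {0<..<T}|lebesgue. Du z $ i * \<eta> z) = (LBINT z. D z $ i * \<eta> z)"
    proof (rule lebesgue_integral_borel_version(1))
      show "AE z in lborel. indicator (\<Omega> \<times> {0<..<T}) z * (Du z $ i * \<eta> z) = D z $ i * \<eta> z"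
        using Dd
      proof eventually_elim
        case (elim z)
        then show ?case using off(1)[of z] K\<Omega>
          by (cases "z \<in> A") (auto simp: indicator_def)
      qed
    qed measurable
    finally show ?thesis .
  qed
  have lin: "linear (frechet_derivative \<eta> (at z))" for z
    using C1_has_derivative[OF C] has_derivative_linear by blast
  have dv: "?d (v, 0) z = (\<Sum>i\<in>UNIV. v $ i * ?d (axis i 1, 0) z)" for z
  proof -
    have "(v, 0::real) = (\<Sum>i\<in>UNIV. v $ i *\<^sub>R (axis i 1, 0))"
      using basis_expansion[of v] by (simp add: prod_eq_iff fst_sum snd_sum scalar_mult_eq_scaleR)
    then have "?d (v, 0) z = ?d (\<Sum>i\<in>UNIV. v $ i *\<^sub>R (axis i 1, 0)) z" by (rule arg_cong)
    also have "\<dots> = (\<Sum>i\<in>UNIV. ?d (v $ i *\<^sub>R (axis i 1, 0)) z)" by (rule linear_sum[OF lin])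
    also have "\<dots> = (\<Sum>i\<in>UNIV. v $ i * ?d (axis i 1, 0) z)"
      by (simp only: linear_scale[OF lin] real_scaleR_def)
    finally show ?thesis .
  qed
  have "(LBINT z. U z * ?d (v, 0) z) = (LBINT z. (\<Sum>i\<in>UNIV. v $ i * (U z * ?d (axis i 1, 0) z)))"
    by (simp add: dv sum_distrib_left mult.left_commute)
  also have "\<dots> = (\<Sum>i\<in>UNIV. v $ i * (LBINT z. U z * ?d (axis i 1, 0) z))"
    using intU by (subst Bochner_Integration.integral_sum) auto
  also have "\<dots> = - (\<Sum>i\<in>UNIV. v $ i * (LBINT z. D z $ i * \<eta> z))"
    by (simp add: comp sum_negf)
  also have "(\<Sum>i\<in>UNIV. v $ i * (LBINT z. D z $ i * \<eta> z)) = (LBINT z. (\<Sum>i\<in>UNIV. v $ i * (D z $ i * \<eta> z)))"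
    using intD by (subst Bochner_Integration.integral_sum) auto
  also have "\<dots> = (LBINT z. (D z \<bullet> v) * \<eta> z)"
    by (simp add: inner_vec_def sum_distrib_left sum_distrib_right mult_ac)
  finally show ?thesis .
qed

text \<open>
  At good times \<open>U\<close> may replace \<open>v\<close>, and \<open>u\<^sub>0\<close> vanishes on the ball; so convergence in measure says that
  the superlevel sets of \<open>U\<close> become small.
\<close>

lemma initial_limit_measure_small:
  fixes U :: "(real ^ 'n) \<times> real \<Rightarrow> real"
  assumes lim: "initial_limit_in_measure \<Omega> v u\<^sub>0" and "open \<Omega>" and u0: "continuous_on \<Omega> u\<^sub>0"
    and v: "\<And>t. t \<in> {0<..<T} \<Longrightarrow> (\<lambda>x. v (x, t)) \<in> borel_measurable (lebesgue_on \<Omega>)"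
    and [measurable]: "U \<in> borel_measurable borel" and U0: "\<And>z. 0 \<le> U z"
    and good: "good \<subseteq> {0<..<T}" "\<And>t. t \<in> good \<Longrightarrow> AE x in lborel. x \<in> \<Omega> \<longrightarrow> U (x, t) = v (x, t)"
    and ball: "cball x0 R \<subseteq> \<Omega>" "AE x in lborel. x \<in> ball x0 R \<longrightarrow> u\<^sub>0 x = 0"
    and de: "0 < d" "0 < e"
  shows "\<exists>s\<^sub>0>0. \<forall>s\<in>good. s < s\<^sub>0 \<longrightarrow> measure lborel {x \<in> ball x0 R. d < U (x, s)} \<le> e"
proof -
  let ?K = "cball x0 R"
  define A where "A t = {x \<in> ?K. d < \<bar>v (x, t) - u\<^sub>0 x\<bar>}" for t
  have "((\<lambda>t. measure lebesgue (A t)) \<longlongrightarrow> 0) (at_right 0)"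
    using lim[unfolded initial_limit_in_measure_def, rule_format, of ?K d] ball(1) de(1)
    unfolding A_def by simp
  then have "\<forall>\<^sub>F t in at_right 0. measure lebesgue (A t) < e"
    using de(2) by (rule order_tendstoD)
  then obtain s\<^sub>0 where s\<^sub>0: "0 < s\<^sub>0" "\<And>s. 0 < s \<Longrightarrow> s < s\<^sub>0 \<Longrightarrow> measure lebesgue (A s) < e"
    by (auto simp: eventually_at_right_field)
  have "measure lborel {x \<in> ball x0 R. d < U (x, s)} \<le> e" if s: "s \<in> good" "s < s\<^sub>0" for s
  proof -
    define B where "B = {x \<in> ball x0 R. d < U (x, s)}"
    have sT: "s \<in> {0<..<T}" using good(1) s by auto
    have [measurable]: "B \<in> sets borel" unfolding B_def by measurable
    have \<Omega>: "\<Omega> \<in> sets lebesgue" using \<open>open \<Omega>\<close> by auto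
    have "u\<^sub>0 \<in> borel_measurable (lebesgue_on \<Omega>)"
      using u0 \<Omega> by (rule continuous_imp_measurable_on_sets_lebesgue)
    with v[OF sT] have "{x \<in> space (lebesgue_on \<Omega>). d < \<bar>v (x, s) - u\<^sub>0 x\<bar>} \<in> sets (lebesgue_on \<Omega>)"
      by measurable
    then have "{x \<in> \<Omega>. d < \<bar>v (x, s) - u\<^sub>0 x\<bar>} \<in> sets lebesgue"
      using \<Omega> by (subst (asm) sets_restrict_space_iff) auto
    then have "?K \<inter> {x \<in> \<Omega>. d < \<bar>v (x, s) - u\<^sub>0 x\<bar>} \<in> sets lebesgue" by auto
    also have "?K \<inter> {x \<in> \<Omega>. d < \<bar>v (x, s) - u\<^sub>0 x\<bar>} = A s"
      unfolding A_def using ball(1) by blast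
    finally have S: "A s \<in> sets lebesgue" .
    have "AE x in lborel. x \<in> B \<longrightarrow> x \<in> A s"
      using good(2)[OF s(1)] ball(2) by eventually_elim (use ball(1) in \<open>auto simp: A_def B_def subset_iff\<close>)
    then have "emeasure lebesgue B \<le> emeasure lebesgue (A s)"
      using S by (intro emeasure_mono_AE AE_completion) auto
    moreover have "emeasure lebesgue (A s) < \<infinity>"
    proof -
      have "emeasure lebesgue (A s) \<le> emeasure lebesgue ?K" by (rule emeasure_mono) (auto simp: A_def)
      also have "\<dots> < \<infinity>" using emeasure_bounded_finite[of ?K] by simp
      finally show ?thesis .
    qed
    ultimately have "measure lebesgue B \<le> measure lebesgue (A s)"
      unfolding measure_def by (intro enn2real_mono) auto
    moreover have "measure lebesgue (A s) < e" using s\<^sub>0(2)[of s] sT s(2) by simp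
    moreover have "measure lebesgue B = measure lborel B" by (rule measure_completion) simp
    ultimately show ?thesis unfolding B_def by linarith
  qed
  then show ?thesis using s\<^sub>0(1) by blast
qed

text \<open>
  Here \<open>U\<close> is a Borel version of \<open>u\<close>, truncated so that \<open>0 \<le> U \<le> M\<close> holds everywhere, and \<open>D\<close> is a Borel
  version of its weak gradient.
\<close>

lemma borel_version_solution_estimates:
  fixes \<Omega> :: "(real ^ 'n) set" and P h H F G :: "real \<Rightarrow> real"
    and u :: "(real ^ 'n) \<times> real \<Rightarrow> real" and T M C\<^sub>1 R :: real
  assumes \<Omega>: "open \<Omega>" and T: "0 < T" and M: "0 < M" and R: "0 < R"
    and sf: "structure_functions P h H F G"
    and i: "0 < C\<^sub>1" "\<forall>s\<in>{0<..M}. F s \<le> C\<^sub>1 * sqrt (deriv F s) * G s"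
    and solution: "weak_solution_ineq \<Omega> T H F u"
    and bounds: "AE z in lebesgue. z \<in> \<Omega> \<times> {0..T} \<longrightarrow> 0 \<le> u z \<and> u z \<le> M"
    and ball: "cball x0 R \<subseteq> \<Omega>" "AE x in lebesgue. x \<in> ball x0 R \<longrightarrow> u (x, 0) = 0"
  obtains U D good where
    "energy_inequality P h H F G U D M R T C\<^sub>1 x0 good"
    "\<And>\<eta> v. C1_test_function (ball x0 R \<times> {0<..<T}) \<eta> \<Longrightarrow>
      (LBINT z. U z * frechet_derivative \<eta> (at z) (v, 0)) = - (LBINT z. (D z \<bullet> v) * \<eta> z)"
    "AE z in lborel. z \<in> \<Omega> \<times> {0<..<T} \<longrightarrow> U z = u z"
proof -
  define Q where "Q = \<Omega> \<times> {0<..<T}"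
  have bounds': "AE z in lborel. z \<in> \<Omega> \<times> {0..T} \<longrightarrow> 0 \<le> u z \<and> u z \<le> M"
    using bounds by (simp add: AE_completion_iff)
  have ball': "AE x in lborel. x \<in> ball x0 R \<longrightarrow> u (x, 0) = 0"
    using ball(2) by (simp add: AE_completion_iff)
  have u_meas: "u \<in> borel_measurable (lebesgue_on (\<Omega> \<times> {0..T}))" and u0: "continuous_on \<Omega> (\<lambda>x. u (x, 0))"
    using solution by (simp_all add: weak_solution_ineq_def Linf_loc_def)
  obtain Du ut v where
    grad: "weak_space_gradient \<Omega> T u Du" and Du: "Lp_loc 2 (\<Omega> \<times> {0<..T}) Du"
    and "weak_time_derivative \<Omega> T u ut" "Lp_loc 1 (\<Omega> \<times> {0<..T}) ut"
    and v: "time_continuous_representative \<Omega> T u v"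
    and init: "initial_limit_in_measure \<Omega> v (\<lambda>x. u (x, 0))"
    and gG: "Lp_loc 1 (\<Omega> \<times> {0<..T}) (grad_G_squared F u Du)"
    and all_ineq: "\<forall>\<theta> s t. lipschitz_test_function \<Omega> \<theta> \<and> (\<forall>x. 0 \<le> \<theta> x) \<and> 0 < s \<and> s < t \<and> t \<le> T \<longrightarrow>
        (LINT x:\<Omega>|lebesgue. \<theta> x * H (v (x, t))) - (LINT x:\<Omega>|lebesgue. \<theta> x * H (v (x, s)))
        + (LINT z:\<Omega> \<times> {s..t}|lebesgue.
            F (u z) * (Du z \<bullet> grad \<theta> (fst z)) + grad_G_squared F u Du z * \<theta> (fst z)) \<le> 0"
    using solution unfolding weak_solution_ineq_def by (elim conjE exE) (rule that)
  have ineq: "(LINT x:\<Omega>|lebesgue. \<theta> x * H (v (x, t))) - (LINT x:\<Omega>|lebesgue. \<theta> x * H (v (x, s)))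
        + (LINT z:\<Omega> \<times> {s..t}|lebesgue.
            F (u z) * (Du z \<bullet> grad \<theta> (fst z)) + grad_G_squared F u Du z * \<theta> (fst z)) \<le> 0"
    if "lipschitz_test_function \<Omega> \<theta>" "\<forall>x. 0 \<le> \<theta> x" "0 < s" "s < t" "t \<le> T" for \<theta> s t
    by (rule all_ineq[rule_format]) (intro conjI that)
  have sets: "\<Omega> \<times> {0..T} \<in> sets lebesgue" "\<Omega> \<times> {0<..T} \<in> sets lebesgue"
  proof -
    have "\<Omega> \<times> I \<in> sets borel" if "I \<in> sets borel" for I :: "real set"
      using \<Omega> that by (intro borel_Times) auto
    then show "\<Omega> \<times> {0..T} \<in> sets lebesgue" "\<Omega> \<times> {0<..T} \<in> sets lebesgue" by auto
  qed
  obtain u1 where u1[measurable]: "u1 \<in> borel_measurable borel"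
    and u1u: "AE z in lborel. z \<in> \<Omega> \<times> {0..T} \<longrightarrow> u z = u1 z"
    using ex_borel_version[OF u_meas sets(1)] by blast
  obtain D where D[measurable]: "D \<in> borel_measurable borel"
    and DDu: "AE z in lborel. z \<in> \<Omega> \<times> {0<..T} \<longrightarrow> Du z = D z"
    using ex_borel_version[OF _ sets(2), of Du] Du unfolding Lp_loc_def by blast
  define U where "U z = max 0 (min M (u1 z))" for z
  have U[measurable]: "U \<in> borel_measurable borel" unfolding U_def by measurable
  have U0: "0 \<le> U z" and UM: "U z \<le> M" for z using M by (auto simp: U_def)
  have Uu: "AE z in lborel. z \<in> Q \<longrightarrow> U z = u z"
    using u1u bounds' by eventually_elim (auto simp: U_def Q_def)
  have Dd: "AE z in lborel. z \<in> Q \<longrightarrow> D z = Du z"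
    using DDu by eventually_elim (auto simp: Q_def)
  have vu: "AE z in lborel. z \<in> \<Omega> \<times> {0<..T} \<longrightarrow> v z = u z"
    using v unfolding time_continuous_representative_def by (simp add: AE_completion_iff)
  define good where "good = {t \<in> {0<..<T}. AE x in lborel. x \<in> \<Omega> \<longrightarrow> U (x, t) = v (x, t)}"
  have "AE z in lborel. z \<in> Q \<longrightarrow> U z = v z"
    using Uu vu by eventually_elim (auto simp: Q_def)
  from AE_lborel_snd[OF this]
  have good_ae: "AE t in lborel. t \<in> {0<..<T} \<longrightarrow> t \<in> good"
  proof eventually_elim
    case (elim t)
    then show ?case by (auto simp: good_def Q_def elim!: eventually_mono)
  qed
  have good_sub: "good \<subseteq> {0<..<T}" by (auto simp: good_def)
  have cyl: "ball x0 R \<times> {s<..<t} \<subseteq> Q" "compact (cball x0 R \<times> {s..t})" "cball x0 R \<times> {s..t} \<subseteq> \<Omega> \<times> {0<..T}"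
    "ball x0 R \<times> {s<..<t} \<subseteq> cball x0 R \<times> {s..t}"
    if "0 < s" "t < T" for s t
    using that ball(1) ball_subset_cball[of x0 R] by (auto simp: Q_def intro!: compact_Times)
  have [measurable]: "sqrt_deriv F \<in> borel_measurable borel" by (rule sqrt_deriv_measurable[OF sf])
  have D_int: "set_integrable lborel (ball x0 R \<times> {s<..<t}) D" if st: "0 < s" "s < t" "t < T" for s t
  proof -
    let ?V = "ball x0 R \<times> {s<..<t}"
    have "set_integrable lebesgue (cball x0 R \<times> {s..t}) (\<lambda>z. norm (Du z) ^ 2)"
      using Du cyl[OF st(1,3)] unfolding Lp_loc_def by blast
    then have "set_integrable lebesgue ?V (\<lambda>z. norm (Du z) ^ 2)"
      by (rule set_integrable_subset) (use cyl(4)[OF st(1,3)] in auto)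
    then have I2: "integrable lborel (\<lambda>z. indicator ?V z * (norm (D z))\<^sup>2)"
    proof (subst (asm) lebesgue_integral_borel_version(2))
      show "AE z in lborel. indicator ?V z * (norm (Du z))\<^sup>2 = indicator ?V z * (norm (D z))\<^sup>2"
        using Dd by eventually_elim (use cyl(1)[OF st(1,3)] in \<open>auto simp: indicator_def\<close>)
    qed measurable
    have "emeasure lborel ?V < \<infinity>" by (intro emeasure_bounded_finite bounded_Times) auto
    then have I1: "integrable lborel (\<lambda>z. indicator ?V z :: real)" by (intro integrable_real_indicator) auto
    show ?thesis unfolding set_integrable_def
    proof (rule Bochner_Integration.integrable_bound[OF Bochner_Integration.integrable_add[OF I1 I2]])
      show "AE z in lborel. norm (indicator ?V z *\<^sub>R D z) \<le> norm (indicator ?V z + indicator ?V z * (norm (D z))\<^sup>2)"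
      proof (rule AE_I2)
        fix z
        have "norm (D z) \<le> 1 + (norm (D z))\<^sup>2"
          using sum_squares_bound[of 1 "norm (D z)"] norm_ge_zero[of "D z"] unfolding power_one by linarith
        then show "norm (indicator ?V z *\<^sub>R D z) \<le> norm (indicator ?V z + indicator ?V z * (norm (D z))\<^sup>2)"
          by (auto simp: indicator_def)
      qed
    qed measurable
  qed
  have gg: "grad_G_squared F u Du z = (sqrt_deriv F (U z) * norm (D z))\<^sup>2"
    if "U z = u z" "D z = Du z" for z
  proof (cases "U z = 0")
    case False
    then have "0 < U z" using U0[of z] by simp
    then show ?thesis using that sqrt_deriv_squared[OF sf, of "U z"] by (simp add: grad_G_squared_def power_mult_distrib)
  qed (use that in \<open>simp add: grad_G_squared_def\<close>)
  have Q_int: "set_integrable lborel (ball x0 R \<times> {s<..<t}) (\<lambda>z. (sqrt_deriv F (U z) * norm (D z))\<^sup>2)"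
    if st: "0 < s" "s < t" "t < T" for s t
  proof -
    let ?V = "ball x0 R \<times> {s<..<t}"
    have "set_integrable lebesgue (cball x0 R \<times> {s..t}) (\<lambda>z. norm (grad_G_squared F u Du z) ^ 1)"
      using gG cyl[OF st(1,3)] unfolding Lp_loc_def by blast
    then have "set_integrable lebesgue ?V (\<lambda>z. norm (grad_G_squared F u Du z) ^ 1)"
      by (rule set_integrable_subset) (use cyl(4)[OF st(1,3)] in auto)
    then have "integrable lborel (\<lambda>z. indicator ?V z * (sqrt_deriv F (U z) * norm (D z))\<^sup>2)"
    proof (subst (asm) lebesgue_integral_borel_version(2))
      show "AE z in lborel. indicator ?V z * norm (grad_G_squared F u Du z) ^ 1 = indicator ?V z * (sqrt_deriv F (U z) * norm (D z))\<^sup>2"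
        using Dd Uu by eventually_elim (use cyl(1)[OF st(1,3)] gg in \<open>auto simp: indicator_def\<close>)
    qed measurable
    then show ?thesis unfolding set_integrable_def by simp
  qed
  have cutoff_ineq: "(LBINT x. cutoff x0 r x * H (U (x, t))) - (LBINT x. cutoff x0 r x * H (U (x, s)))
      + (LBINT z. indicator (ball x0 R \<times> {s<..<t}) z * (F (U z) * (D z \<bullet> cutoff_grad x0 r (fst z))
          + (sqrt_deriv F (U z) * norm (D z))\<^sup>2 * cutoff x0 r (fst z))) \<le> 0"
    if r: "0 < r" "r \<le> R" and st: "s \<in> good" "t \<in> good" "s < t" for r s t
  proof -
    have st': "0 < s" "t < T" using st good_sub by auto
    have off: "cutoff x0 r x = 0" "cutoff_grad x0 r x = 0" if "x \<notin> ball x0 R" for x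
      using cutoff_eq_0[OF r(1), of x x0] that r(2) by auto
    have bO: "ball x0 R \<subseteq> \<Omega>" using ball(1) ball_subset_cball by blast
    have slice: "(LINT x:\<Omega>|lebesgue. cutoff x0 r x * H (v (x, \<tau>))) = (LBINT x. cutoff x0 r x * H (U (x, \<tau>)))"
      if "\<tau> \<in> good" for \<tau>
    proof (rule lebesgue_integral_borel_version(1))
      note [measurable] = H_comp_measurable[OF sf U U0]
      show "(\<lambda>x. cutoff x0 r x * H (U (x, \<tau>))) \<in> borel_measurable borel" by measurable
      have "AE x in lborel. x \<in> \<Omega> \<longrightarrow> U (x, \<tau>) = v (x, \<tau>)" using that by (simp add: good_def)
      then show "AE x in lborel. indicator \<Omega> x * (cutoff x0 r x * H (v (x, \<tau>))) = cutoff x0 r x * H (U (x, \<tau>))"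
      proof eventually_elim
        case (elim x)
        then show ?case using off(1)[of x] bO by (cases "x \<in> ball x0 R") (auto simp: indicator_def)
      qed
    qed
    have space_time: "(LINT z:\<Omega> \<times> {s..t}|lebesgue.
            F (u z) * (Du z \<bullet> grad (cutoff x0 r) (fst z)) + grad_G_squared F u Du z * cutoff x0 r (fst z))
        = (LBINT z. indicator (ball x0 R \<times> {s<..<t}) z * (F (U z) * (D z \<bullet> cutoff_grad x0 r (fst z))
          + (sqrt_deriv F (U z) * norm (D z))\<^sup>2 * cutoff x0 r (fst z)))"
    proof (rule lebesgue_integral_borel_version(1))
      note [measurable] = F_comp_measurable[OF sf U U0]
      show "(\<lambda>z. indicator (ball x0 R \<times> {s<..<t}) z * (F (U z) * (D z \<bullet> cutoff_grad x0 r (fst z))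
          + (sqrt_deriv F (U z) * norm (D z))\<^sup>2 * cutoff x0 r (fst z))) \<in> borel_measurable borel"
        by measurable
      have b: "(0, 1) \<in> (Basis :: ((real ^ 'n) \<times> real) set)" by (simp add: Basis_prod_def)
      have "AE z in lborel. z \<bullet> (0 :: real ^ 'n, 1 :: real) \<noteq> s" "AE z in lborel. z \<bullet> (0 :: real ^ 'n, 1 :: real) \<noteq> t"
        by (rule AE_lborel_inner_neq[OF b])+
      then show "AE z in lborel. indicator (\<Omega> \<times> {s..t}) z *
            (F (u z) * (Du z \<bullet> grad (cutoff x0 r) (fst z)) + grad_G_squared F u Du z * cutoff x0 r (fst z))
          = indicator (ball x0 R \<times> {s<..<t}) z * (F (U z) * (D z \<bullet> cutoff_grad x0 r (fst z))
            + (sqrt_deriv F (U z) * norm (D z))\<^sup>2 * cutoff x0 r (fst z))"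
        using Uu Dd
      proof eventually_elim
        case (elim z)
        show ?case
        proof (cases "z \<in> ball x0 R \<times> {s<..<t}")
          case True
          then have zQ: "z \<in> Q" using cyl(1)[OF st'] by blast
          have "z \<in> \<Omega> \<times> {s..t}" using True bO by (auto simp: mem_Times_iff)
          then show ?thesis using True elim(3,4) zQ gg[of z] by (simp add: grad_cutoff)
        next
          case False
          then have "fst z \<notin> ball x0 R \<or> z \<notin> \<Omega> \<times> {s..t}" using elim(1,2) by (cases z) auto
          then show ?thesis using False off[of "fst z"] by (auto simp: grad_cutoff)
        qed
      qed
    qed
    have "lipschitz_test_function \<Omega> (cutoff x0 r)"
      using r ball(1) by (intro lipschitz_test_function_cutoff) (auto intro: order_trans[OF subset_cball])
    from ineq[OF this _ st'(1) st(3) less_imp_le[OF st'(2)]] cutoff_nonneg[of x0 r]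
    show ?thesis unfolding slice[OF st(1)] slice[OF st(2)] space_time by blast
  qed
  have init_small: "\<exists>s\<^sub>0>0. \<forall>s\<in>good. s < s\<^sub>0 \<longrightarrow> measure lborel {x \<in> ball x0 R. d < U (x, s)} \<le> e"
    if "0 < d" "0 < e" for d e
  proof (rule initial_limit_measure_small[OF init \<Omega> u0 _ U U0 good_sub _ ball(1) ball' that])
    show "(\<lambda>x. v (x, t)) \<in> borel_measurable (lebesgue_on \<Omega>)" if "t \<in> {0<..<T}" for t
      using v that unfolding time_continuous_representative_def Lp_loc_def by auto
  qed (simp add: good_def)
  have "energy_inequality P h H F G U D M R T C\<^sub>1 x0 good"
  proof (unfold_locales)
    show "F s \<le> C\<^sub>1 * sqrt_deriv F s * G s" if "s \<in> {0<..M}" for s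
      using i(2) that by (auto simp: sqrt_deriv_def)
  qed (use sf U U0 UM D R T i(1) D_int Q_int good_ae good_sub cutoff_ineq init_small in auto)
  moreover have "(LBINT z. U z * frechet_derivative \<eta> (at z) (v, 0)) = - (LBINT z. (D z \<bullet> v) * \<eta> z)"
    if "C1_test_function (ball x0 R \<times> {0<..<T}) \<eta>" for \<eta> v
    by (rule weak_space_gradient_borel_version[OF grad U D _ Uu[unfolded Q_def] Dd[unfolded Q_def] _ T D_int that, where M = M])
      (use U0 UM ball(1) ball_subset_cball in \<open>auto simp: abs_le_iff intro: order_trans[OF _ U0]\<close>)
  ultimately show ?thesis using that Uu[unfolded Q_def] by blast
qed

theorem theorem1:
  fixes \<Omega> \<Omega>' :: "(real ^ 'n) set"
    and P h H F G :: "real \<Rightarrow> real"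
    and u :: "(real ^ 'n) \<times> real \<Rightarrow> real"
    and \<phi> :: "real ^ 'n \<Rightarrow> real \<Rightarrow> real"
    and T M lam C\<^sub>1 C\<^sub>2 :: real
  assumes domain: "open \<Omega>" "connected \<Omega>" "\<Omega> \<noteq> {}" "bounded \<Omega>"
    and "0 < T" and "0 < M"
    and nonlin: "structure_functions P h H F G"
    and i: "0 < C\<^sub>1" "\<forall>s\<in>{0<..M}. F s \<le> C\<^sub>1 * sqrt (deriv F s) * G s"
    and ii: "0 < lam" "lam < 2" "0 < C\<^sub>2" "\<forall>s\<in>{0..M}. sqrt (s * F s) powr lam \<le> C\<^sub>2 * H s"
    and solution: "weak_solution_ineq \<Omega> T H F u"
    and bounds: "AE z in lebesgue. z \<in> \<Omega> \<times> {0..T} \<longrightarrow> 0 \<le> u z \<and> u z \<le> M"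
    and boundary: "boundary_data \<Omega> T u \<phi>"
    and \<phi>_nonneg: "\<forall>x\<in>frontier \<Omega>. \<forall>t\<in>{0<..<T}. 0 \<le> \<phi> x t"
    and \<phi>_initial: "\<forall>x\<in>frontier \<Omega>. (\<phi> x \<longlongrightarrow> 0) (at_right 0)"
    and "\<Omega>' \<subseteq> \<Omega>"
    and initial: "AE x in lebesgue. x \<in> \<Omega>' \<longrightarrow> u (x, 0) = 0"
  shows "\<forall>x\<^sub>0 R R'. compactly_contained (ball x\<^sub>0 R) \<Omega>' \<and> 0 < R' \<and> R' < R \<longrightarrow>
    (\<exists>T'. 0 < T' \<and> T' \<le> T \<and>
      (AE z in lebesgue. z \<in> ball x\<^sub>0 R' \<times> {0..T'} \<longrightarrow> u z = 0))"
proof (intro allI impI, elim conjE)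
  fix x\<^sub>0 :: "real ^ 'n" and R R' :: real
  assume cc: "compactly_contained (ball x\<^sub>0 R) \<Omega>'" and R': "0 < R'" "R' < R"
  have R: "0 < R" using R' by simp
  have cb: "cball x\<^sub>0 R \<subseteq> \<Omega>'"
    using cc R by (simp add: compactly_contained_def)
  have ball0: "AE x in lebesgue. x \<in> ball x\<^sub>0 R \<longrightarrow> u (x, 0) = 0"
    using initial by eventually_elim (use cb ball_subset_cball[of x\<^sub>0 R] in blast)
  obtain U D good where E: "energy_inequality P h H F G U D M R T C\<^sub>1 x\<^sub>0 good"
    and weak: "\<And>\<eta> v. C1_test_function (ball x\<^sub>0 R \<times> {0<..<T}) \<eta> \<Longrightarrow>
      (LBINT z. U z * frechet_derivative \<eta> (at z) (v, 0)) = - (LBINT z. (D z \<bullet> v) * \<eta> z)"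
    and Uu: "AE z in lborel. z \<in> \<Omega> \<times> {0<..<T} \<longrightarrow> U z = u z"
    by (rule borel_version_solution_estimates[OF domain(1) \<open>0 < T\<close> \<open>0 < M\<close> R nonlin i solution bounds
        order_trans[OF cb \<open>\<Omega>' \<subseteq> \<Omega>\<close>] ball0]) (rule that; assumption)
  obtain \<mu> K where \<mu>: "1 \<le> \<mu>" "\<mu> < 2" "0 < K" "\<And>s. s \<in> {0..M} \<Longrightarrow> G s powr \<mu> \<le> K * H s"
    using G_powr_le_H[OF nonlin ii(1-3), of M] ii(4) by blast
  have C: "0 < 16 * C\<^sub>1\<^sup>2" using i(1) by simp
  interpret E: energy_inequality P h H F G U D M R T C\<^sub>1 x\<^sub>0 good by (rule E)
  interpret local_energy_estimates P h H F G U D M R T "16 * C\<^sub>1\<^sup>2" \<mu> K x\<^sub>0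
    by unfold_locales (assumption | rule nonlin E.U E.U0 E.UM E.D E.D_int weak R \<open>0 < T\<close> C \<mu> E.energy_H E.energy_D)+
  obtain T' where T': "0 < T'" "T' \<le> T" "AE z in lborel. z \<in> ball x\<^sub>0 R' \<times> {0<..<T'} \<longrightarrow> U z = 0"
    using vanishing[OF R'] by blast
  have b: "(0, 1) \<in> (Basis :: ((real ^ 'n) \<times> real) set)" by (simp add: Basis_prod_def)
  have "AE z in lborel. z \<bullet> (0 :: real ^ 'n, 1 :: real) \<noteq> 0" "AE z in lborel. z \<bullet> (0 :: real ^ 'n, 1 :: real) \<noteq> T'"
    by (rule AE_lborel_inner_neq[OF b])+
  then have "AE z in lborel. z \<in> ball x\<^sub>0 R' \<times> {0..T'} \<longrightarrow> u z = 0"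
    using T'(3) Uu
  proof eventually_elim
    case (elim z)
    show ?case
    proof
      assume z: "z \<in> ball x\<^sub>0 R' \<times> {0..T'}"
      then have "z \<in> ball x\<^sub>0 R' \<times> {0<..<T'}" using elim(1,2) by (cases z) auto
      moreover then have "z \<in> \<Omega> \<times> {0<..<T}"
        using cb R' \<open>\<Omega>' \<subseteq> \<Omega>\<close> T'(2) by (fastforce simp: subset_iff mem_Times_iff)
      ultimately show "u z = 0" using elim(3,4) by simp
    qed
  qed
  then have "AE z in lebesgue. z \<in> ball x\<^sub>0 R' \<times> {0..T'} \<longrightarrow> u z = 0" by (rule AE_completion)
  then show "\<exists>T'. 0 < T' \<and> T' \<le> T \<and> (AE z in lebesgue. z \<in> ball x\<^sub>0 R' \<times> {0..T'} \<longrightarrow> u z = 0)"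
    using T' by blast
qed

end
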